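(* There is an absolute constant $C$ such that, for every integer $n\ge 2$, the symmetric group $S_n$ has a presentation of length at most $C\log n$ with $18$ generators and $58$ relations.
   Context: The length of a presentation $\langle X\mid R\rangle$ is $|X|$ plus the sum of the lengths of the relations as words in $X\cup X^{-1}$. Relations are counted as a list (a trivial or repeated relation is allowed). *)

theory Defs
  imports Complex_Main "HOL-Algebra.Sym_Groups"
begin

text \<open>A word in \<open>X \<union> X\<inverse>\<close> is a list of signed letters: \<open>(x, True)\<close> stands for \<open>x\<close> and
  \<open>(x, False)\<close> for \<open>x\<inverse>\<close>. Words need not be reduced.\<close>

type_synonym 'a word = "('a \<times> bool) list"

definition words :: "'a set \<Rightarrow> 'a word set" where
  "words X = lists (X \<times> UNIV)"

inductive_set free_eq :: "'a set \<Rightarrow> ('a word \<times> 'a word) set" for X :: "'a set" where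
  refl: "u \<in> words X \<Longrightarrow> (u, u) \<in> free_eq X"
| sym: "(u, v) \<in> free_eq X \<Longrightarrow> (v, u) \<in> free_eq X"
| trans: "(u, v) \<in> free_eq X \<Longrightarrow> (v, w) \<in> free_eq X \<Longrightarrow> (u, w) \<in> free_eq X"
| cancel: "u \<in> words X \<Longrightarrow> v \<in> words X \<Longrightarrow> x \<in> X \<Longrightarrow>
    (u @ [(x, b), (x, \<not> b)] @ v, u @ v) \<in> free_eq X"

definition word_class :: "'a set \<Rightarrow> 'a word \<Rightarrow> 'a word set" where
  "word_class X u = free_eq X `` {u}"

definition free_group :: "'a set \<Rightarrow> 'a word set monoid" where
  "free_group X =
    \<lparr>carrier = words X // free_eq X,
     mult = (\<lambda>A B. \<Union>u\<in>A. \<Union>v\<in>B. word_class X (u @ v)),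
     one = word_class X []\<rparr>"

definition normal_closure :: "('a, 'b) monoid_scheme \<Rightarrow> 'a set \<Rightarrow> 'a set" where
  "normal_closure G S = \<Inter> {N. N \<lhd> G \<and> S \<subseteq> N}"

text \<open>Relations are relators, given as a list of words, so that trivial and repeated relations
  are counted.\<close>

definition presented_group :: "'a set \<Rightarrow> 'a word list \<Rightarrow> 'a word set set monoid" where
  "presented_group X rs =
    free_group X Mod normal_closure (free_group X) (word_class X ` set rs)"

definition is_presentation :: "'a set \<Rightarrow> 'a word list \<Rightarrow> ('b, 'c) monoid_scheme \<Rightarrow> bool" where
  "is_presentation X rs G \<longleftrightarrow> finite X \<and> set rs \<subseteq> words X \<and> presented_group X rs \<cong> G"

definition presentation_length :: "'a set \<Rightarrow> 'a word list \<Rightarrow> nat" where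
  "presentation_length X rs = card X + sum_list (map length rs)"

lemma free_eq_words: "(u, v) \<in> free_eq X \<Longrightarrow> u \<in> words X \<and> v \<in> words X"
  by (induction rule: free_eq.induct) (auto simp: words_def)

lemma equiv_free_eq: "equiv (words X) (free_eq X)"
proof (rule equivI)
  show "free_eq X \<subseteq> words X \<times> words X" by (auto dest: free_eq_words)
  show "refl_on (words X) (free_eq X)" by (rule refl_onI) (rule free_eq.refl)
  show "Relation.sym (free_eq X)" by (rule symI) (rule free_eq.sym)
  show "Relation.trans (free_eq X)" by (rule transI) (rule free_eq.trans)
qed

lemma words_append: "u \<in> words X \<Longrightarrow> v \<in> words X \<Longrightarrow> u @ v \<in> words X"
  by (simp add: words_def)

lemma free_eq_append_right: "(u, v) \<in> free_eq X \<Longrightarrow> w \<in> words X \<Longrightarrow> (u @ w, v @ w) \<in> free_eq X"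
proof (induction rule: free_eq.induct)
  case (cancel u v x b)
  then show ?case using free_eq.cancel[of u X "v @ w" x b] by (simp add: words_append)
next
  case (trans u v w')
  then show ?case by (blast intro: free_eq.trans)
qed (simp_all add: free_eq.refl free_eq.sym words_append)

lemma free_eq_append_left: "(u, v) \<in> free_eq X \<Longrightarrow> w \<in> words X \<Longrightarrow> (w @ u, w @ v) \<in> free_eq X"
proof (induction rule: free_eq.induct)
  case (cancel u v x b)
  then show ?case using free_eq.cancel[of "w @ u" X v x b] by (simp add: words_append)
next
  case (trans u v w')
  then show ?case by (blast intro: free_eq.trans)
qed (simp_all add: free_eq.refl free_eq.sym words_append)

lemma free_eq_append:
  assumes "(u, u') \<in> free_eq X" "(v, v') \<in> free_eq X"
  shows "(u @ v, u' @ v') \<in> free_eq X"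
  using assms by (meson free_eq.trans free_eq_append_left free_eq_append_right free_eq_words)

lemma word_class_eq_iff:
  "u \<in> words X \<Longrightarrow> v \<in> words X \<Longrightarrow> word_class X u = word_class X v \<longleftrightarrow> (u, v) \<in> free_eq X"
  unfolding word_class_def by (rule eq_equiv_class_iff[OF equiv_free_eq])

lemma carrier_free_group: "carrier (free_group X) = word_class X ` words X"
  by (auto simp: free_group_def quotient_def word_class_def)

lemma mult_free_group:
  assumes u: "u \<in> words X" and v: "v \<in> words X"
  shows "word_class X u \<otimes>\<^bsub>free_group X\<^esub> word_class X v = word_class X (u @ v)"
proof -
  have eq: "word_class X (u' @ v') = word_class X (u @ v)"
    if "u' \<in> word_class X u" "v' \<in> word_class X v" for u' v'
  proof -
    have "(u @ v, u' @ v') \<in> free_eq X"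
      using that free_eq_append unfolding word_class_def by blast
    then show ?thesis
      unfolding word_class_def by (rule equiv_class_eq[OF equiv_free_eq, symmetric])
  qed
  have ne: "u \<in> word_class X u" "v \<in> word_class X v"
    using free_eq.refl[OF u] free_eq.refl[OF v] by (simp_all add: word_class_def)
  have "(\<Union>u'\<in>word_class X u. \<Union>v'\<in>word_class X v. word_class X (u' @ v')) = word_class X (u @ v)"
    using eq ne by blast
  then show ?thesis by (simp add: free_group_def)
qed

lemma one_free_group: "\<one>\<^bsub>free_group X\<^esub> = word_class X []"
  by (simp add: free_group_def)

lemma free_eq_inverse:
  "u \<in> words X \<Longrightarrow> (rev (map (\<lambda>(x, b). (x, \<not> b)) u) @ u, []) \<in> free_eq X"
proof (induction u)
  case Nil
  then show ?case by (auto intro: free_eq.refl)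
next
  case (Cons a u)
  obtain x b where a: "a = (x, b)" by (cases a)
  let ?i = "rev (map (\<lambda>(x, b). (x, \<not> b)) u)"
  have w: "u \<in> words X" "x \<in> X" using Cons.prems a by (auto simp: words_def)
  then have "?i \<in> words X" by (auto simp: words_def)
  from free_eq.cancel[OF this w(1) w(2), of "\<not> b"] show ?case
    using free_eq.trans[OF _ Cons.IH[OF w(1)]] a by simp
qed

lemma group_free_group: "group (free_group X)"
proof (rule groupI)
  fix A B assume "A \<in> carrier (free_group X)" "B \<in> carrier (free_group X)"
  then obtain u v where "u \<in> words X" "v \<in> words X" "A = word_class X u" "B = word_class X v"
    by (auto simp: carrier_free_group)
  then show "A \<otimes>\<^bsub>free_group X\<^esub> B \<in> carrier (free_group X)"
    by (simp add: mult_free_group words_append carrier_free_group)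
next
  show "\<one>\<^bsub>free_group X\<^esub> \<in> carrier (free_group X)"
    by (simp add: one_free_group carrier_free_group words_def)
next
  fix A B D
  assume "A \<in> carrier (free_group X)" "B \<in> carrier (free_group X)" "D \<in> carrier (free_group X)"
  then obtain u v w where "u \<in> words X" "v \<in> words X" "w \<in> words X"
    "A = word_class X u" "B = word_class X v" "D = word_class X w"
    by (auto simp: carrier_free_group)
  then show "A \<otimes>\<^bsub>free_group X\<^esub> B \<otimes>\<^bsub>free_group X\<^esub> D
      = A \<otimes>\<^bsub>free_group X\<^esub> (B \<otimes>\<^bsub>free_group X\<^esub> D)"
    by (simp add: mult_free_group words_append)
next
  fix A assume "A \<in> carrier (free_group X)"
  then obtain u where u: "u \<in> words X" "A = word_class X u" by (auto simp: carrier_free_group)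
  have nil: "[] \<in> words X" by (simp add: words_def)
  show "\<one>\<^bsub>free_group X\<^esub> \<otimes>\<^bsub>free_group X\<^esub> A = A"
    using mult_free_group[OF nil u(1)] u(2) by (simp add: one_free_group)
  let ?i = "rev (map (\<lambda>(x, b). (x, \<not> b)) u)"
  have i: "?i \<in> words X" using u(1) by (auto simp: words_def)
  have "word_class X (?i @ u) = word_class X []"
    using free_eq_inverse[OF u(1)] word_class_eq_iff[OF words_append[OF i u(1)] nil] by blast
  then have "word_class X ?i \<otimes>\<^bsub>free_group X\<^esub> A = \<one>\<^bsub>free_group X\<^esub>"
    using mult_free_group[OF i u(1)] u(2) by (simp add: one_free_group)
  moreover have "word_class X ?i \<in> carrier (free_group X)"
    using i by (simp only: carrier_free_group imageI)
  ultimately show "\<exists>B\<in>carrier (free_group X). B \<otimes>\<^bsub>free_group X\<^esub> A = \<one>\<^bsub>free_group X\<^esub>"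
    by blast
qed

end

(*
For q = 2^k the maps v + 1, v z, 1 / v generate the action of SL(2, q) on the q + 1 points of the projective
line and satisfy boundedly many relations of length O(k) in which every element has a Bruhat normal form.
Adding a transposition e that exchanges infinity with a new center point, its conjugates form a star of
transpositions indexed by the projective line; since SL(2, q) is transitive on triples, the Coxeter
relations between them follow from a single instance. A second copy of SL(2, q), conjugated such that an element
of order q + 1 becomes the product of the diagonal element v z of the first copy with a word in e and its
conjugates, makes the resulting presentation of the symmetric group on q + 2 points exact: the discrepancies
between the letters and the permutations they represent satisfy the relations with e = 1, where one
element has order dividing 2 (q - 1) and 2 (q + 1), hence 4, which forces every letter to be trivial.

The two cycles of lengths q - 1 and q + 1 nearly coincide, so that quotients of their powers are cycles on short
arcs, and all of these are words of length O(k). Two copies of the presentation sharing the complement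
of an arc of d points then present the symmetric group on q + 2 + d points, after
adding six relations of length O(k).
*)

theory Submission
  imports Defs "HOL-Algebra.Algebraic_Closure_Type" "HOL-Library.Z2"
begin

text \<open>Exponents up to \<open>2 ^ k\<close> must cost only \<open>O(k)\<close> letters. A
  translation is written by Horner's rule in its binary coordinates, a diagonal element is a product
  of three translations and three copies of \<open>w\<close>, and an arbitrary power of the torus
  element of order \<open>q + 1\<close> is brought to Bruhat normal form; this is why all words on
  arcs are short.

  One copy of SL(2, q) could not suffice: setting \<open>e = 1\<close> leaves its own relations,
  which have nontrivial solutions. The second copy identifies a torus of order \<open>q + 1\<close>
  with one of order \<open>q - 1\<close>, and these orders are coprime since \<open>q\<close> is
  even. The relations do not give the orders directly: a diagonal element with multiplier 1 is only
  shown to square to 1, which is the source of the factors 2 and of the exponent 4.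

  Counting: a base presentation has 7 letters and 24 relators, two of them with the six gluing
  relations have 14 and 54, and four letters that are set to 1 give 18 and 58. The ranges from
  \<open>q + 3\<close> to \<open>2 q + 2\<close> for \<open>q = 4, 8, 16, ...\<close> cover every
  \<open>n >= 7\<close>.\<close>

no_notation var (\<open>X\<index>\<close>) (* would capture the variable X *)

section \<open>Groups as a type class and symmetric groups\<close>

class mgroup = monoid_mult + inverse +
  assumes left_inv [simp]: "inverse a * a = 1"
begin

lemma left_inv_assoc [simp]: "inverse a * (a * b) = b"
  by (simp flip: mult.assoc)

lemma left_cancel [simp]: "a * b = a * c \<longleftrightarrow> b = c"
  using left_inv_assoc by metis

lemma right_inv [simp]: "a * inverse a = 1"
  by (metis left_inv left_inv_assoc mult_1_right)

lemma right_inv_assoc [simp]: "a * (inverse a * b) = b"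
  by (simp flip: mult.assoc)

lemma right_cancel [simp]: "b * a = c * a \<longleftrightarrow> b = c"
  by (metis mult.assoc mult_1_right right_inv)

lemma inv_inv [simp]: "inverse (inverse a) = a"
  by (metis left_inv_assoc mult_1_right left_inv)

lemma inv_unique: "a * b = 1 \<Longrightarrow> inverse a = b"
  by (metis left_inv_assoc mult_1_right)

lemma inv_mult [simp]: "inverse (a * b) = inverse b * inverse a"
  by (rule inv_unique) (simp add: mult.assoc)

lemma inv_one [simp]: "inverse 1 = 1"
  by (rule inv_unique) simp

lemma inv_eq_iff [simp]: "inverse a = inverse b \<longleftrightarrow> a = b"
  using inv_inv by metis

lemma inv_power: "inverse (a ^ n) = inverse a ^ n"
  by (induction n) (simp_all add: power_commutes)

definition cj :: "'a \<Rightarrow> 'a \<Rightarrow> 'a" where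
  "cj g h = inverse h * g * h"

definition cm :: "'a \<Rightarrow> 'a \<Rightarrow> bool" where
  "cm a b \<longleftrightarrow> a * b = b * a"

lemma cj_mult: "cj (a * b) h = cj a h * cj b h"
  by (simp add: cj_def mult.assoc)

lemma cj_cj: "cj (cj g h) k = cj g (h * k)"
  by (simp add: cj_def mult.assoc)

lemma cj_1 [simp]: "cj 1 h = 1" "cj g 1 = g"
  by (simp_all add: cj_def)

lemma cj_inverse: "cj (inverse g) h = inverse (cj g h)"
  by (simp add: cj_def mult.assoc)

lemma cj_power: "cj (g ^ n) h = cj g h ^ n"
  by (induction n) (simp_all add: cj_mult)

lemma cj_eq_iff [simp]: "cj a h = cj b h \<longleftrightarrow> a = b"
  by (simp add: cj_def mult.assoc)

lemma cj_eq_1_iff [simp]: "cj a h = 1 \<longleftrightarrow> a = 1"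
  using cj_eq_iff[of a h 1] by simp

lemma cj_move: "g * h = h * cj g h"
  by (simp add: cj_def mult.assoc)

lemma cj_eqI: "g * h = h * g' \<Longrightarrow> cj g h = g'"
  using cj_move left_cancel by metis

lemma cm_iff_cj: "cm a b \<longleftrightarrow> cj a b = a"
  by (metis cj_move cj_eqI cm_def)

lemma cm_sym: "cm a b \<Longrightarrow> cm b a"
  by (simp add: cm_def)

lemma cm_refl [simp]: "cm a a"
  by (simp add: cm_def)

lemma cm_1 [simp]: "cm 1 a" "cm a 1"
  by (simp_all add: cm_def)

lemma cm_mult: "cm a b \<Longrightarrow> cm a c \<Longrightarrow> cm a (b * c)"
  unfolding cm_def by (metis mult.assoc)

lemma cm_mult2: "cm b a \<Longrightarrow> cm c a \<Longrightarrow> cm (b * c) a"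
  using cm_mult cm_sym by blast

lemma cm_inverse: "cm a b \<Longrightarrow> cm a (inverse b)"
  unfolding cm_def by (metis left_inv_assoc mult.assoc mult_1_right right_inv)

lemma cm_inverse2: "cm a b \<Longrightarrow> cm (inverse a) b"
  using cm_inverse cm_sym by blast

lemma cm_power: "cm a b \<Longrightarrow> cm a (b ^ n)"
  by (induction n) (simp_all add: cm_mult)

lemma cm_cj: "cm a b \<Longrightarrow> cm (cj a h) (cj b h)"
  unfolding cm_def by (metis cj_mult)

lemma cm_cj_iff [simp]: "cm (cj a h) (cj b h) \<longleftrightarrow> cm a b"
  using cm_cj[of a b h] cm_cj[of "cj a h" "cj b h" "inverse h"] by (auto simp: cj_cj)

lemma cm_cj2: "cm a b \<Longrightarrow> cm a h \<Longrightarrow> cm a (cj b h)"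
  by (simp add: cj_def cm_mult cm_inverse)

lemma power_invol: "a * a = 1 \<Longrightarrow> inverse a = a"
  by (rule inv_unique)

end

section \<open>Permutations of a type and their finite symmetric groups\<close>

typedef 'a prm = "{f :: 'a \<Rightarrow> 'a. bij f}"
  morphisms app Prm by (rule exI[of _ id]) simp

setup_lifting type_definition_prm

lemma bij_on_extend: "bij_betw f S S \<Longrightarrow> bij (\<lambda>x. if x \<in> S then f x else x)"
proof -
  let ?g = "\<lambda>x. if x \<in> S then f x else x"
  assume "bij_betw f S S"
  then have "bij_betw ?g S S" by (subst bij_betw_cong[of S ?g f]) simp_all
  moreover have "bij_betw ?g (- S) (- S)" by (subst bij_betw_cong[of "- S" ?g id]) simp_all
  ultimately show ?thesis using bij_betw_combine[of ?g S S "- S" "- S"] by simp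
qed

lemma app_Prm_on:
  "bij_betw f S S \<Longrightarrow> app (Prm (\<lambda>x. if x \<in> S then f x else x)) = (\<lambda>x. if x \<in> S then f x else x)"
  using bij_on_extend[of f S] by (simp add: Prm_inverse)

instantiation prm :: (type) mgroup
begin

text \<open>Products act from left to right, so that conjugation \<open>inverse h * g * h\<close> relabels points by \<open>h\<close>.\<close>

lift_definition times_prm :: "'a prm \<Rightarrow> 'a prm \<Rightarrow> 'a prm" is "\<lambda>f g. g \<circ> f"
  by (simp add: bij_comp)

lift_definition one_prm :: "'a prm" is id by simp

lift_definition inverse_prm :: "'a prm \<Rightarrow> 'a prm" is "\<lambda>f. inv_into UNIV f"
  by (simp add: bij_imp_bij_inv)

definition divide_prm :: "'a prm \<Rightarrow> 'a prm \<Rightarrow> 'a prm" where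
  "divide_prm f g = f * inverse g"

instance
  by standard (transfer; simp add: fun_eq_iff bij_is_surj surj_f_inv_f)+

end

lemma app_mult [simp]: "app (f * g) x = app g (app f x)"
  by transfer simp

lemma app_one [simp]: "app 1 x = x"
  by transfer simp

lemma prm_eqI: "(\<And>x. app f x = app g x) \<Longrightarrow> f = g"
  by transfer (simp add: fun_eq_iff)

lemma app_inv [simp]: "app (inverse f) (app f x) = x" "app f (app (inverse f) x) = x"
  by (simp_all flip: app_mult)

lemma app_inj [simp]: "app f x = app f y \<longleftrightarrow> x = y"
  using app_inv(1) by metis

lemma app_inv_eq: "app (inverse f) x = y \<longleftrightarrow> x = app f y"
  using app_inv by metis

lift_definition tr :: "'a \<Rightarrow> 'a \<Rightarrow> 'a prm" is "\<lambda>x y. transpose x y"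
  by simp

lemma app_tr: "app (tr x y) z = transpose x y z"
  by transfer simp

lemma tr_sym: "tr x y = tr y x"
  by transfer (simp add: transpose_commute)

lemma tr_same [simp]: "tr x x = 1"
  by transfer simp

lemma tr_square [simp]: "tr x y * tr x y = 1" "tr x y * (tr x y * p) = p"
  by (rule prm_eqI, simp add: app_tr)+

lemma inverse_tr [simp]: "inverse (tr x y) = tr x y"
  by (rule inv_unique) simp

lemma cj_tr: "cj (tr x y) g = tr (app g x) (app g y)"
proof (rule prm_eqI)
  fix z
  show "app (cj (tr x y) g) z = app (tr (app g x) (app g y)) z"
    by (cases "z = app g x"; cases "z = app g y")
      (auto simp: cj_def app_tr transpose_def app_inv_eq)
qed

text \<open>Permutations of the whole type supported in \<open>A\<close>, so that the symmetric
  groups on overlapping sets lie in one common group.\<close>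

definition Sym :: "'a set \<Rightarrow> 'a prm set" where
  "Sym A = {p. \<forall>x. x \<notin> A \<longrightarrow> app p x = x}"

lemma Sym_one [simp]: "1 \<in> Sym A"
  by (simp add: Sym_def)

lemma Sym_mult: "p \<in> Sym A \<Longrightarrow> q \<in> Sym A \<Longrightarrow> p * q \<in> Sym A"
  by (simp add: Sym_def)

lemma Sym_inverse: "p \<in> Sym A \<Longrightarrow> inverse p \<in> Sym A"
  by (simp add: Sym_def app_inv_eq)

lemma Sym_cj: "p \<in> Sym A \<Longrightarrow> q \<in> Sym A \<Longrightarrow> cj p q \<in> Sym A"
  by (simp add: cj_def Sym_mult Sym_inverse)

lemma Sym_power: "p \<in> Sym A \<Longrightarrow> p ^ n \<in> Sym A"
  by (induction n) (simp_all add: Sym_mult)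

lemma Sym_tr: "x \<in> A \<Longrightarrow> y \<in> A \<Longrightarrow> tr x y \<in> Sym A"
  by (auto simp: Sym_def app_tr transpose_def)

lemma Sym_mono: "A \<subseteq> B \<Longrightarrow> Sym A \<subseteq> Sym B"
  by (auto simp: Sym_def)

lemma Sym_app_mem: "p \<in> Sym A \<Longrightarrow> app p x \<in> A \<longleftrightarrow> x \<in> A"
  using app_inj unfolding Sym_def by (metis (mono_tags, lifting) mem_Collect_eq)


definition trprods :: "'a set \<Rightarrow> 'a prm set" where
  "trprods A = {prod_list (map (\<lambda>(x, y). tr x y) ps) | ps. set ps \<subseteq> {(x, y). x \<in> A \<and> y \<in> A \<and> x \<noteq> y}}"

text \<open>As products act from left to right, the transposition brings \<open>app p j\<close> back
  to \<open>j\<close>, so the product fixes \<open>j\<close> as well.\<close>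

lemma Sym_insert_cases:
  assumes "p \<in> Sym (insert j A)"
  shows "p * tr j (app p j) \<in> Sym A"
proof -
  have "app (p * tr j (app p j)) x = x" if x: "x \<notin> A" for x
  proof (cases "x = j")
    case True
    then show ?thesis by (simp add: app_tr)
  next
    case False
    then have px: "app p x = x" using assms x by (simp add: Sym_def)
    then have "app p j \<noteq> x" using False app_inj by metis
    then show ?thesis using False px by (simp add: app_tr)
  qed
  then show ?thesis by (simp add: Sym_def)
qed

lemma Sym_induct [consumes 2, case_names one step]:
  assumes "finite A" "p \<in> Sym A"
    and one: "P 1"
    and step: "\<And>p x y. p \<in> Sym A \<Longrightarrow> x \<in> A \<Longrightarrow> y \<in> A \<Longrightarrow> x \<noteq> y \<Longrightarrow> P p \<Longrightarrow> P (p * tr x y)"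
  shows "P p"
proof -
  have "p \<in> Sym B \<Longrightarrow> B \<subseteq> A \<Longrightarrow> P p" if "finite B" for B
    using that
  proof (induction B arbitrary: p)
    case empty
    then have "p = 1" by (intro prm_eqI) (simp add: Sym_def)
    then show ?case using one by simp
  next
    case (insert j B)
    let ?q = "p * tr j (app p j)"
    have q: "?q \<in> Sym B" using insert.prems(1) by (rule Sym_insert_cases)
    have P: "P ?q" using insert q by simp
    have mem: "app p j \<in> insert j B" using Sym_app_mem[OF insert.prems(1), of j] by simp
    show ?case
    proof (cases "app p j = j")
      case True
      then show ?thesis using P by simp
    next
      case False
      have "?q \<in> Sym A" using q Sym_mono[of B A] insert.prems(2) by auto
      then have "P (?q * tr j (app p j))"
        using mem insert.prems(2) False P by - (rule step, auto)
      then show ?thesis by (simp add: mult.assoc)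
    qed
  qed
  then show ?thesis using assms by blast
qed

text \<open>A total function that is multiplicative on \<open>Sym A\<close> only; its other values
  are arbitrary, which avoids a separate type for each symmetric group.\<close>

definition hom_on :: "'a set \<Rightarrow> ('a prm \<Rightarrow> 'h::mgroup) \<Rightarrow> bool" where
  "hom_on A f \<longleftrightarrow> (\<forall>p\<in>Sym A. \<forall>q\<in>Sym A. f (p * q) = f p * f q)"

lemma hom_onD: "hom_on A f \<Longrightarrow> p \<in> Sym A \<Longrightarrow> q \<in> Sym A \<Longrightarrow> f (p * q) = f p * f q"
  by (simp add: hom_on_def)

lemma hom_on_one: "hom_on A f \<Longrightarrow> f 1 = 1"
  using hom_onD[of A f 1 1] by (metis Sym_one left_cancel mult_1_right)

lemma hom_on_inverse: "hom_on A f \<Longrightarrow> p \<in> Sym A \<Longrightarrow> f (inverse p) = inverse (f p)"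
  using hom_onD[of A f p "inverse p"] by (intro inv_unique[symmetric]) (simp add: Sym_inverse hom_on_one)

lemma hom_on_cj: "hom_on A f \<Longrightarrow> p \<in> Sym A \<Longrightarrow> q \<in> Sym A \<Longrightarrow> f (cj p q) = cj (f p) (f q)"
  by (simp add: cj_def hom_onD hom_on_inverse Sym_mult Sym_inverse)

lemma hom_on_power: "hom_on A f \<Longrightarrow> p \<in> Sym A \<Longrightarrow> f (p ^ n) = f p ^ n"
  by (induction n) (simp_all add: hom_onD hom_on_one Sym_power)

section \<open>Homomorphisms prescribed on transpositions\<close>

lemma hom_onI:
  assumes fin: "finite A" and one: "f 1 = 1"
    and tr: "\<And>p x y. p \<in> Sym A \<Longrightarrow> x \<in> A \<Longrightarrow> y \<in> A \<Longrightarrow> x \<noteq> y \<Longrightarrow> f (p * tr x y) = f p * f (tr x y)"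
  shows "hom_on A f"
  unfolding hom_on_def
proof (intro ballI)
  fix p q assume p: "p \<in> Sym A" and q: "q \<in> Sym A"
  show "f (p * q) = f p * f q"
    using fin q
  proof (induction rule: Sym_induct)
    case one
    then show ?case using \<open>f 1 = 1\<close> by simp
  next
    case (step q x y)
    have "f (p * (q * tr x y)) = f (p * q) * f (tr x y)"
      using tr[of "p * q" x y] step p by (simp add: Sym_mult mult.assoc)
    then show ?case using step tr[of q x y] by (simp add: mult.assoc)
  qed
qed

text \<open>Induction on \<open>A\<close>: an element \<open>p\<close> of
  \<open>Sym (insert j A)\<close> is an element of \<open>Sym A\<close> times
  \<open>tr j (app p j)\<close>, and this coset decomposition dictates the extension. By
  \<open>hom_onI\<close> it suffices to multiply by one transposition; the cases, according to
  whether it moves \<open>j\<close> and where \<open>p\<close> sends \<open>j\<close>, come down to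
  \<open>sq\<close> and \<open>conj\<close>.\<close>

lemma transposition_hom:
  fixes T :: "'a \<Rightarrow> 'a \<Rightarrow> 'h::mgroup"
  assumes fin: "finite A"
    and sym: "\<And>x y. x \<in> A \<Longrightarrow> y \<in> A \<Longrightarrow> x \<noteq> y \<Longrightarrow> T x y = T y x"
    and sq: "\<And>x y. x \<in> A \<Longrightarrow> y \<in> A \<Longrightarrow> x \<noteq> y \<Longrightarrow> T x y * T x y = 1"
    and conj: "\<And>r s x y. r \<in> A \<Longrightarrow> s \<in> A \<Longrightarrow> x \<in> A \<Longrightarrow> y \<in> A \<Longrightarrow> r \<noteq> s \<Longrightarrow> x \<noteq> y \<Longrightarrow>
        T r s * T x y * T r s = T (transpose r s x) (transpose r s y)"
  shows "\<exists>f. hom_on A f \<and> (\<forall>x\<in>A. \<forall>y\<in>A. x \<noteq> y \<longrightarrow> f (tr x y) = T x y)"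
  using assms
proof (induction A)
  case empty
  show ?case by (rule exI[of _ "\<lambda>_. 1"]) (simp add: hom_on_def)
next
  case (insert j A)
  have "\<exists>f. hom_on A f \<and> (\<forall>x\<in>A. \<forall>y\<in>A. x \<noteq> y \<longrightarrow> f (tr x y) = T x y)"
    using insert.prems by (intro insert.IH) auto
  then obtain f0 where f0: "hom_on A f0"
    and f0T: "\<And>x y. x \<in> A \<Longrightarrow> y \<in> A \<Longrightarrow> x \<noteq> y \<Longrightarrow> f0 (tr x y) = T x y"
    by blast
  note sym = insert.prems(1) and sq = insert.prems(2) and conj = insert.prems(3)
  define f where "f p = (if app p j = j then f0 p else f0 (p * tr j (app p j)) * T j (app p j))" for p
  have f1: "f 1 = 1" using hom_on_one[OF f0] by (simp add: f_def)
  have ftr: "f (p * tr x y) = f p * T x y"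
    if p: "p \<in> Sym (insert j A)" and x: "x \<in> insert j A" and y: "y \<in> insert j A" and xy: "x \<noteq> y"
    for p x y
  proof -
    define z where "z = app p j"
    have z: "z \<in> insert j A" unfolding z_def using Sym_app_mem[OF p, of j] by simp
    define p0 where "p0 = p * tr j z"
    have p0: "p0 \<in> Sym A" unfolding p0_def z_def using p by (rule Sym_insert_cases)
    have p_eq: "p = p0 * tr j z" by (simp add: p0_def mult.assoc)
    have fp: "f p = (if z = j then f0 p0 else f0 p0 * T j z)"
      by (simp add: f_def z_def p0_def)
    have *: "f (p * tr j s) = f p * T j s" if s: "s \<in> A" "s \<noteq> j" for s
    proof -
      consider "z = j" | "z = s" "z \<noteq> j" | "z \<noteq> j" "z \<noteq> s" by blast
      then show ?thesis
      proof cases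
        case 1
        then have "p = p0" by (simp add: p0_def)
        have "app (p * tr j s) j = s" using 1 by (simp add: app_tr flip: z_def)
        then have "f (p * tr j s) = f0 p0 * T j s"
          using s \<open>p = p0\<close> by (simp add: f_def mult.assoc)
        then show ?thesis using fp 1 by simp
      next
        case 2
        then have "app (p * tr j s) j = j" by (simp add: app_tr flip: z_def)
        then have "f (p * tr j s) = f0 p0" using 2 by (simp add: f_def p0_def)
        then show ?thesis using fp 2 sq[of j s] s by (simp add: mult.assoc)
      next
        case 3
        have zA: "z \<in> A" using z 3 by simp
        have a: "app (p * tr j s) j = z" using 3 by (simp add: app_tr flip: z_def)
        have "tr j z * tr j s * tr j z = tr z s"
          using cj_tr[of j s "tr j z"] 3 s by (simp add: cj_def app_tr)
        then have e: "p * tr j s * tr j z = p0 * tr z s"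
          by (simp add: p_eq mult.assoc)
        have "f (p * tr j s) = f0 (p0 * tr z s) * T j z"
          using a 3 e by (simp add: f_def)
        also have "f0 (p0 * tr z s) = f0 p0 * T z s"
          using hom_onD[OF f0 p0 Sym_tr[OF zA s(1)]] f0T[OF zA s(1)] 3 by simp
        finally have 1: "f (p * tr j s) = f0 p0 * (T z s * T j z)" by (simp add: mult.assoc)
        have "T j z * T z s * T j z = T j s"
          using conj[of j z z s] zA s 3 by simp
        then have "T j z * (T j z * (T z s * T j z)) = T j z * T j s"
          by (simp add: mult.assoc)
        moreover have "T j z * (T j z * h) = h" for h
          using sq[of j z] zA 3 by (simp flip: mult.assoc)
        ultimately have "T z s * T j z = T j z * T j s" by simp
        then show ?thesis using 1 fp 3 by (simp add: mult.assoc)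
      qed
    qed
    show ?thesis
    proof (cases "x = j \<or> y = j")
      case True
      then show ?thesis using *[of x] *[of y] x y xy tr_sym[of x y] sym[OF x y xy] by auto
    next
      case False
      then have xA: "x \<in> A" and yA: "y \<in> A" and xj: "x \<noteq> j" "y \<noteq> j" using x y by auto
      define z' where "z' = transpose x y z"
      have a: "app (p * tr x y) j = z'" by (simp add: app_tr z'_def flip: z_def)
      have z'j: "z' = j \<longleftrightarrow> z = j" using xj by (auto simp: z'_def transpose_def)
      have "tr x y * tr j z' = tr j z * tr x y"
        using cj_move[of "tr j z" "tr x y"] xj by (simp add: cj_tr app_tr z'_def)
      then have e: "p * tr x y * tr j z' = p0 * tr x y"
        by (simp add: p0_def mult.assoc)
      have ff: "f0 (p0 * tr x y) = f0 p0 * T x y"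
        using hom_onD[OF f0 p0 Sym_tr[OF xA yA]] f0T[OF xA yA xy] by simp
      show ?thesis
      proof (cases "z = j")
        case True
        then show ?thesis using a z'j ff fp by (simp add: f_def p0_def)
      next
        case False
        have "f (p * tr x y) = f0 p0 * T x y * T j z'"
          using a z'j e ff False by (simp add: f_def)
        moreover have "T j z' = T x y * T j z * T x y"
          using conj[OF x y insertI1 z xy] False xj by (simp add: z'_def)
        moreover have "T x y * (T x y * h) = h" for h
          using sq[OF x y xy] by (simp flip: mult.assoc)
        ultimately show ?thesis using fp False by (simp add: mult.assoc)
      qed
    qed
  qed
  have fT: "f (tr x y) = T x y" if "x \<in> insert j A" "y \<in> insert j A" "x \<noteq> y" for x y
    using ftr[of 1 x y] that f1 by simp
  have "hom_on (insert j A) f"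
    using insert.hyps f1 ftr fT by (intro hom_onI) auto
  then show ?case using fT by blast
qed

text \<open>The star with centre \<open>None\<close> determines the other transpositions as
  \<open>e i * e j * e i\<close>. It is enough to verify conjugation by the star transpositions
  themselves, since any other one is a product of three of them.\<close>

lemma star_hom:
  fixes e :: "'i \<Rightarrow> 'h::mgroup"
  assumes fin: "finite I"
    and sq: "\<And>i. i \<in> I \<Longrightarrow> e i * e i = 1"
    and braid: "\<And>i j. i \<in> I \<Longrightarrow> j \<in> I \<Longrightarrow> i \<noteq> j \<Longrightarrow> e i * e j * e i = e j * e i * e j"
    and comm: "\<And>i j l. i \<in> I \<Longrightarrow> j \<in> I \<Longrightarrow> l \<in> I \<Longrightarrow> i \<noteq> j \<Longrightarrow> i \<noteq> l \<Longrightarrow> j \<noteq> l \<Longrightarrow>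
        cm (e i * e j * e i) (e l)"
  shows "\<exists>f. hom_on (insert None (Some ` I)) f \<and> (\<forall>i\<in>I. f (tr None (Some i)) = e i)"
proof -
  define T where "T x y = (case (x, y) of (None, None) \<Rightarrow> 1 | (None, Some i) \<Rightarrow> e i
    | (Some i, None) \<Rightarrow> e i | (Some i, Some j) \<Rightarrow> e i * e j * e i)" for x y
  have T: "T None (Some i) = e i" "T (Some i) None = e i" "T (Some i) (Some j) = e i * e j * e i" for i j
    by (simp_all add: T_def)
  let ?A = "insert None (Some ` I)"
  have inv: "inverse (e i) = e i" if "i \<in> I" for i
    using sq[OF that] by (rule power_invol)
  have sq': "e i * (e i * h) = h" if "i \<in> I" for i h
    using sq[OF that] by (metis mult.assoc mult_1_left)
  have symT: "T x y = T y x" if "x \<in> ?A" "y \<in> ?A" "x \<noteq> y" for x y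
    using that by (auto simp: T intro!: braid)
  have sqT: "T x y * T x y = 1" if "x \<in> ?A" "y \<in> ?A" "x \<noteq> y" for x y
    using that by (auto simp: T sq sq' mult.assoc)
  have c1: "e r * T x y * e r = T (transpose None (Some r) x) (transpose None (Some r) y)"
    if r: "r \<in> I" and x: "x \<in> ?A" and y: "y \<in> ?A" and xy: "x \<noteq> y" for r x y
  proof (cases x)
    case None
    then obtain i where i: "y = Some i" "i \<in> I" using y xy by auto
    then show ?thesis using None r sq sq' by (cases "i = r") (auto simp: T mult.assoc)
  next
    case (Some i)
    then have iI: "i \<in> I" using x by auto
    show ?thesis
    proof (cases y)
      case None
      then show ?thesis using Some iI r sq sq' symT[of "Some i" "Some r"]
        by (cases "i = r") (auto simp: T mult.assoc)
    next
      case (Some j)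
      then have jI: "j \<in> I" using y by auto
      have ij: "i \<noteq> j" using Some \<open>x = Some i\<close> xy by auto
      consider "r = i" | "r = j" | "r \<noteq> i" "r \<noteq> j" by blast
      then show ?thesis
      proof cases
        case 1
        then show ?thesis using Some \<open>x = Some i\<close> ij iI sq sq'
          by (simp add: T mult.assoc)
      next
        case 2
        then show ?thesis using Some \<open>x = Some i\<close> ij iI jI sq sq' braid[OF iI jI ij]
          by (simp add: T mult.assoc)
      next
        case 3
        then show ?thesis using Some \<open>x = Some i\<close> comm[OF iI jI r ij] sq[OF r]
          by (simp add: T cm_def) (metis mult.assoc mult_1_right)
      qed
    qed
  qed
  have conj: "T r s * T x y * T r s = T (transpose r s x) (transpose r s y)"
    if r: "r \<in> ?A" and s: "s \<in> ?A" and x: "x \<in> ?A" and y: "y \<in> ?A" and rs: "r \<noteq> s" and xy: "x \<noteq> y"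
    for r s x y
  proof (cases r)
    case None
    then obtain l where "s = Some l" "l \<in> I" using s rs by auto
    then show ?thesis using None c1[OF _ x y xy, of l] by (simp add: T)
  next
    case (Some i)
    then have iI: "i \<in> I" using r by auto
    show ?thesis
    proof (cases s)
      case None
      then show ?thesis using c1[OF iI x y xy] Some by (simp add: T transpose_commute)
    next
      case (Some j)
      have jI: "j \<in> I" and ij: "i \<noteq> j" using s Some rs \<open>r = Some i\<close> by auto
      let ?t = "\<lambda>i. transpose None (Some i)"
      have mem: "?t i x \<in> ?A" if "i \<in> I" "x \<in> ?A" for i x using that by (auto simp: transpose_def)
      have "T r s * T x y * T r s = e i * (e j * (e i * T x y * e i) * e j) * e i"
        using Some \<open>r = Some i\<close> by (simp add: T mult.assoc)
      also have "\<dots> = T (?t i (?t j (?t i x))) (?t i (?t j (?t i y)))"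
        using c1 iI jI x y xy mem by (simp add: inj_eq[OF inj_on_transpose])
      also have "(\<lambda>x. ?t i (?t j (?t i x))) = transpose r s"
        using Some \<open>r = Some i\<close> ij by (auto simp: transpose_def fun_eq_iff)
      then have "T (?t i (?t j (?t i x))) (?t i (?t j (?t i y))) = T (transpose r s x) (transpose r s y)"
        by (simp add: fun_eq_iff)
      finally show ?thesis .
    qed
  qed
  from transposition_hom[of ?A T, OF _ symT sqT conj] fin
  obtain f where "hom_on ?A f" and f: "\<And>x y. x \<in> ?A \<Longrightarrow> y \<in> ?A \<Longrightarrow> x \<noteq> y \<Longrightarrow> f (tr x y) = T x y"
    by auto
  moreover have "f (tr None (Some i)) = e i" if "i \<in> I" for i
    using f[of None "Some i"] that by (simp add: T)
  ultimately show ?thesis by blast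
qed

section \<open>Finite fields of characteristic two and relations of SL(2,q)\<close>

text \<open>Field elements are written as binary polynomials in \<open>z\<close>.\<close>

primrec elt :: "'k::field \<Rightarrow> bool list \<Rightarrow> 'k" where
  "elt z [] = 0"
| "elt z (b # bs) = of_bool b + z * elt z bs"

lemma elt_append: "elt z (bs @ cs) = elt z bs + z ^ length bs * elt z cs"
  by (induction bs) (simp_all add: algebra_simps)

definition xorl :: "bool list \<Rightarrow> bool list \<Rightarrow> bool list" where
  "xorl = map2 (\<lambda>b c. b \<noteq> c)"

lemma xorl_simps [simp]:
  "xorl [] [] = []" "xorl (b # bs) (c # cs) = (b \<noteq> c) # xorl bs cs"
  "length (xorl bs cs) = min (length bs) (length cs)"
  by (simp_all add: xorl_def)

definition mobU :: "'k::field \<Rightarrow> 'k option \<Rightarrow> 'k option" where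
  "mobU x = map_option (\<lambda>v. v + x)"

definition mobA :: "'k::field \<Rightarrow> 'k option \<Rightarrow> 'k option" where
  "mobA z = map_option (\<lambda>v. v * z)"

definition mobW :: "'k::field option \<Rightarrow> 'k option" where
  "mobW p = (case p of None \<Rightarrow> Some 0 | Some v \<Rightarrow> if v = 0 then None else Some (1 / v))"

text \<open>\<open>F\<close> is the field with \<open>q = 2\<^sup>k\<close> elements and \<open>z\<close> a primitive element; \<open>y\<close> is chosen such that
  \<open>v \<mapsto> 1 / (v + y)\<close> is a \<open>(q + 1)\<close>-cycle on the projective line, whose point at infinity is \<open>None\<close>.\<close>

locale gf =
  fixes F :: "'k::field set" and z y :: 'k and k :: nat
  assumes char2: "(x::'k) + x = 0"
    and F_closed: "0 \<in> F" "1 \<in> F" "a \<in> F \<Longrightarrow> b \<in> F \<Longrightarrow> a + b \<in> F"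
      "a \<in> F \<Longrightarrow> b \<in> F \<Longrightarrow> a * b \<in> F" "a \<in> F \<Longrightarrow> 1 / a \<in> F"
    and finite_F: "finite F" and card_F: "card F = 2 ^ k" and k_ge: "2 \<le> k"
    and z_F: "z \<in> F" and z_gen: "a \<in> F \<Longrightarrow> a \<noteq> 0 \<Longrightarrow> \<exists>i. a = z ^ i"
    and z_ord: "z ^ i = 1 \<longleftrightarrow> (2 ^ k - 1) dvd i"
    and y_F: "y \<in> F" and y_nz: "y \<noteq> 0"
    and circle: "p \<in> insert None (Some ` F) \<Longrightarrow> \<exists>n. ((mobW \<circ> mobU y) ^^ n) None = p"
    and circle_ord: "p \<in> insert None (Some ` F) \<Longrightarrow> ((mobW \<circ> mobU y) ^^ (2 ^ k + 1)) p = p"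
begin

abbreviation P1 :: "'k option set" where
  "P1 \<equiv> insert None (Some ` F)"

lemma add_self [simp]: "(x::'k) + x = 0"
  by (rule char2)

lemma add_self_assoc [simp]: "(x::'k) + (x + v) = v"
  by (simp flip: add.assoc)

lemma q_ge: "(4::nat) \<le> 2 ^ k"
  using power_increasing[OF k_ge, of "2::nat"] by simp

lemma z_nz: "z \<noteq> 0"
proof
  assume "z = 0"
  then have "z ^ (2 ^ k - 1) = 0" using q_ge by (simp add: power_0_left)
  moreover have "z ^ (2 ^ k - 1) = 1" unfolding z_ord by simp
  ultimately show False by (metis zero_neq_one)
qed

lemma zpow_F: "z ^ i \<in> F"
  by (induction i) (simp_all add: F_closed z_F)

lemma pow_F: "x \<in> F \<Longrightarrow> x ^ i \<in> F"
  by (induction i) (simp_all add: F_closed)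

lemma elt_F: "elt z bs \<in> F"
  by (induction bs) (simp_all add: F_closed z_F)

lemma elt_xor: "length bs = length cs \<Longrightarrow> elt z (xorl bs cs) = elt z bs + elt z cs"
  by (induction bs cs rule: list_induct2) (auto simp: algebra_simps)

lemma elt_pad: "elt z (bs @ replicate n False) = elt z bs"
  by (induction n) (simp_all add: elt_append flip: replicate_append_same append_assoc)

lemma card_bools: "card {bs :: bool list. length bs = n} = 2 ^ n" "finite {bs :: bool list. length bs = n}"
  using card_lists_length_eq[of "UNIV :: bool set" n] finite_lists_length_eq[of "UNIV :: bool set" n]
  by simp_all

text \<open>If \<open>z ^ j\<close> were a polynomial in \<open>z\<close> of degree below
  \<open>j\<close>, then by reduction so would be every power of \<open>z\<close>, hence all of
  \<open>F\<close>, leaving at most \<open>2 ^ j\<close> elements. Thus the powers below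
  \<open>k\<close> form a basis of \<open>F\<close> over the field with two elements.\<close>

lemma zpow_notin:
  assumes "j < k"
  shows "z ^ j \<notin> elt z ` {bs. length bs = j}"
proof
  let ?V = "elt z ` {bs. length bs = j}"
  assume "z ^ j \<in> ?V"
  then obtain fs where fs: "length fs = j" "elt z fs = z ^ j" by auto
  have reduce: "elt z bs \<in> ?V" if "length bs = Suc j" for bs
  proof -
    obtain cs b where bs: "bs = cs @ [b]" using \<open>length bs = Suc j\<close>
      by (metis length_Suc_conv_rev)
    then have cs: "length cs = j" using \<open>length bs = Suc j\<close> by simp
    have "elt z bs = (if b then elt z (xorl cs fs) else elt z cs)"
      using fs cs by (simp add: bs elt_append elt_xor)
    moreover have "length (xorl cs fs) = j" using fs cs by simp
    ultimately show ?thesis using cs by (cases b) auto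
  qed
  have j0: "j \<noteq> 0" using fs by (cases j) auto
  have "z ^ i \<in> ?V" for i
  proof (induction i)
    case 0
    have "elt z (True # replicate (j - 1) False) = 1"
      using elt_pad[of "[True]" "j - 1"] by simp
    moreover have "length (True # replicate (j - 1) False) = j" using j0 by simp
    ultimately show ?case by (intro image_eqI[of _ _ "True # replicate (j - 1) False"]) simp_all
  next
    case (Suc i)
    then obtain bs where "length bs = j" "elt z bs = z ^ i" by auto
    then show ?case using reduce[of "False # bs"] by simp
  qed
  moreover have "0 \<in> ?V" using elt_pad[of "[]" j] by (intro image_eqI[of _ _ "replicate j False"]) auto
  ultimately have "F \<subseteq> ?V" using z_gen by blast
  then have "card F \<le> card ?V" by (intro card_mono finite_imageI card_bools)
  also have "\<dots> \<le> 2 ^ j" using card_image_le[OF card_bools(2)] card_bools(1) by metis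
  finally have "k \<le> j" by (simp add: card_F)
  then show False using assms by simp
qed

lemma elt_inj: "inj_on (elt z) {bs. length bs = k}"
proof -
  have "inj_on (elt z) {bs. length bs = j}" if "j \<le> k" for j
    using that
  proof (induction j)
    case 0
    then show ?case by (auto intro: inj_onI)
  next
    case (Suc j)
    then have IH: "inj_on (elt z) {bs. length bs = j}" by simp
    show ?case
    proof (rule inj_onI, clarify)
      fix bs cs assume len: "length bs = Suc j" "length cs = Suc j" and eq: "elt z bs = elt z cs"
      obtain bs' b where bs: "bs = bs' @ [b]" "length bs' = j" using len
        by (metis length_Suc_conv_rev)
      obtain cs' c where cs: "cs = cs' @ [c]" "length cs' = j" using len
        by (metis length_Suc_conv_rev)
      have e: "elt z bs' + z ^ j * of_bool b = elt z cs' + z ^ j * of_bool c"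
        using eq by (simp add: bs cs elt_append)
      show "bs = cs"
      proof (cases "b = c")
        case True
        then have "elt z bs' = elt z cs'" using e by simp
        then show ?thesis using IH bs cs True by (auto dest: inj_onD)
      next
        case False
        then have "z ^ j = elt z bs' + elt z cs'"
        proof -
          have *: "w = x + v" if "x + w = v" for x v w :: 'k
            using add_self_assoc[of x w] that by simp
          show ?thesis
          proof (cases b)
            case True
            then show ?thesis using e False *[of "elt z bs'" "z ^ j" "elt z cs'"] by simp
          next
            case b: False
            then have "elt z cs' + z ^ j = elt z bs'" using e False by simp
            then show ?thesis using *[of "elt z cs'" "z ^ j" "elt z bs'"] by (simp add: add.commute)
          qed
        qed
        then have "z ^ j = elt z (xorl bs' cs')"
          using bs cs by (simp add: elt_xor)
        moreover have "length (xorl bs' cs') = j" using bs cs by simp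
        ultimately show ?thesis using zpow_notin[of j] Suc.prems by auto
      qed
    qed
  qed
  then show ?thesis by simp
qed

lemma elt_surj: "elt z ` {bs. length bs = k} = F"
proof (rule card_subset_eq[OF finite_F])
  show "elt z ` {bs. length bs = k} \<subseteq> F" using elt_F by auto
  show "card (elt z ` {bs. length bs = k}) = card F"
    using card_image[OF elt_inj] by (simp add: card_bools card_F)
qed

definition bits :: "'k \<Rightarrow> bool list" where
  "bits x = (SOME bs. length bs = k \<and> elt z bs = x)"

lemma bits:
  assumes "x \<in> F"
  shows "length (bits x) = k \<and> elt z (bits x) = x"
proof -
  have "x \<in> elt z ` {bs. length bs = k}" using assms elt_surj by simp
  then have "\<exists>bs. length bs = k \<and> elt z bs = x" by auto
  then show ?thesis unfolding bits_def by (rule someI_ex)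
qed

lemma pow_q: "x \<in> F \<Longrightarrow> x ^ (2 ^ k) = x"
proof (cases "x = 0")
  case True
  then show ?thesis by simp
next
  case False
  assume "x \<in> F"
  then obtain i where i: "x = z ^ i" using z_gen False by blast
  have "x ^ (2 ^ k - 1) = 1" unfolding i power_mult[symmetric] by (simp add: z_ord)
  then have "x * x ^ (2 ^ k - 1) = x" by simp
  then show ?thesis by (simp flip: power_Suc)
qed

text \<open>Inverse square root: \<open>x \<mapsto> x\<^sup>q\<^sup>/\<^sup>2\<close> inverts squaring on the field.\<close>

definition isqrt :: "'k \<Rightarrow> 'k" where
  "isqrt x = (1 / x) ^ (2 ^ (k - 1))"

lemma isqrt: "x \<in> F \<Longrightarrow> x \<noteq> 0 \<Longrightarrow> isqrt x \<in> F \<and> isqrt x \<noteq> 0 \<and> isqrt x * isqrt x = 1 / x"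
proof -
  assume x: "x \<in> F" "x \<noteq> 0"
  have "isqrt x * isqrt x = (1 / x) ^ (2 ^ (k - 1) + 2 ^ (k - 1))"
    unfolding isqrt_def by (rule power_add[symmetric])
  also have "(2::nat) ^ (k - 1) + 2 ^ (k - 1) = 2 ^ k"
    using k_ge by (metis mult_2 power_Suc Suc_pred' zero_less_numeral less_le_trans)
  finally have "isqrt x * isqrt x = 1 / x" using x by (simp only: pow_q F_closed)
  then show ?thesis using x unfolding isqrt_def by (simp only: pow_F F_closed) auto
qed

lemma z_ne_1: "z \<noteq> 1"
proof
  assume "z = 1"
  then have "2 ^ k - 1 dvd (1::nat)" using z_ord[of 1] by simp
  then show False using q_ge by simp
qed

lemma z1: "1 + z \<in> F" "1 + z \<noteq> 0"
proof -
  show "1 + z \<in> F" by (simp add: F_closed z_F)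
  show "1 + z \<noteq> 0" using z_ne_1 by (metis add_self_assoc add.right_neutral)
qed

end

text \<open>Horner form of the product of the conjugates \<open>cj u (a ^ i)\<close> over the set
  bits \<open>i\<close>. Neighbouring powers of \<open>a\<close> are shared, so the corresponding
  word is linear and not quadratic in the number of bits.\<close>

primrec Ul :: "'h::mgroup \<Rightarrow> 'h \<Rightarrow> bool list \<Rightarrow> 'h" where
  "Ul u a [] = 1"
| "Ul u a (b # bs) = (if b then u else 1) * cj (Ul u a bs) a"

context gf begin

definition U :: "'h::mgroup \<Rightarrow> 'h \<Rightarrow> 'k \<Rightarrow> 'h" where
  "U u a x = Ul u a (bits x)"

text \<open>In \<open>SL\<^sub>2\<close> the word below is the diagonal matrix acting on the projective line as
  multiplication by \<open>r\<^sup>-\<^sup>2\<close>.\<close>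

definition Hd :: "'h::mgroup \<Rightarrow> 'h \<Rightarrow> 'h \<Rightarrow> 'k \<Rightarrow> 'h" where
  "Hd u a w r = w * U u a (1 / r) * w * U u a r * w * U u a (1 / r)"

text \<open>The letters \<open>u\<close>, \<open>a\<close>, \<open>w\<close> stand for the maps \<open>v + 1\<close>, \<open>v * z\<close>, \<open>1 / v\<close>. The fifth and sixth relation bring in
  the multiplication by \<open>1 + z\<close>: conjugating by it turns \<open>cm u (cj u (a ^ j))\<close> into the same relation for \<open>j + 1\<close>,
  so that boundedly many relations suffice.\<close>

definition SL2_rel :: "'h::mgroup \<Rightarrow> 'h \<Rightarrow> 'h \<Rightarrow> bool" where
  "SL2_rel u a w \<longleftrightarrow> u * u = 1 \<and> w * w = 1 \<and> (u * w) ^ 3 = 1 \<and> cj a w = inverse a \<and>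
     cj u (Hd u a w (isqrt (1 + z))) = u * cj u a \<and> cm a (Hd u a w (isqrt (1 + z))) \<and>
     cj u (a ^ k) = U u a (z ^ k) \<and> a = Hd u a w (isqrt z)"

end

section \<open>Consequences of the relations of SL(2, q) in an arbitrary group\<close>

locale sl2 = gf +
  fixes u a w :: "'h::mgroup"
  assumes SL2: "SL2_rel u a w"
begin

lemma uu: "u * u = 1" and ww: "w * w = 1" and uw3: "(u * w) ^ 3 = 1" and aw: "cj a w = inverse a"
  and ua_k: "cj u (a ^ k) = U u a (z ^ k)"
  using SL2 by (simp_all add: SL2_rel_def)

lemma inv_u: "inverse u = u" and inv_w: "inverse w = w"
  using uu ww power_invol by blast+

lemma u_commute: "cm u (cj u (a ^ j))"
proof -
  define b where "b = Hd u a w (isqrt (1 + z))"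
  have b: "cj u b = u * cj u a" and ab: "cm a b" using SL2 by (simp_all add: SL2_rel_def b_def)
  have "cj u a * cj u a = 1" using uu by (simp flip: cj_mult)
  \<comment> \<open>The product is a conjugate of \<open>u\<close>, hence squares to 1 like its two
    factors, and therefore the factors commute.\<close>
  have "(u * cj u a) * (u * cj u a) = 1" using uu by (simp add: cj_mult[symmetric] flip: b)
  then have "inverse (u * cj u a) = u * cj u a" by (rule inv_unique)
  then have c1: "cm u (cj u a)" by (simp add: cm_def inv_u flip: cj_inverse)
  have "cm u (cj u (a ^ Suc j))" for j
  proof (induction j rule: less_induct)
    case (less j)
    show ?case
    proof (cases j)
      case 0
      then show ?thesis using c1 by simp
    next
      case (Suc i)
      define v where "v n = cj u (a ^ n)" for n
      have shift: "cj (v n) a = v (Suc n)" for n by (simp add: v_def cj_cj power_commutes)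
      have c: "cm (v 0) (v n)" if "n \<le> j" for n
        using that less.IH[of "n - 1"] by (cases n) (simp_all add: v_def)
      have c': "cm (v 1) (v (Suc n))" if "n \<le> j" for n
        using cm_cj[OF c[OF that], of a] by (simp add: shift)
      have vb: "cj (v n) b = v n * v (Suc n)" for n
      proof -
        have "cj (v n) b = cj u (b * a ^ n)"
          using cm_power[OF cm_sym[OF ab], of n] by (simp add: v_def cj_cj cm_def)
        also have "\<dots> = v n * v (Suc n)" by (simp add: b cj_cj cj_mult v_def flip: cj_cj)
        finally show ?thesis .
      qed
      \<comment> \<open>Conjugation of \<open>cm (v 0) (v j)\<close> by \<open>b\<close>. Of the
        four pairs that arise, \<open>v 0, v j\<close> and \<open>v 1, v j\<close> and
        \<open>v 1, v (Suc j)\<close> are known to commute, and cancelling them leaves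
        \<open>v 0, v (Suc j)\<close>.\<close>
      have "cm (v 0 * v 1) (v j * v (Suc j))"
        using cm_cj[OF c[of j], of b] by (simp add: vb)
      moreover have "cm (v 1) (v j)" using c'[of i] Suc by simp
      ultimately have "cm (v 0) (v (Suc j))"
        using c[of j] c'[of j] unfolding cm_def by (metis (no_types) order_refl mult.assoc left_cancel right_cancel)
      then show ?thesis by (simp add: v_def)
    qed
  qed
  then show ?thesis by (cases j) simp_all
qed

end

context sl2 begin

abbreviation V :: "'a \<Rightarrow> 'h" where "V \<equiv> U u a"

lemma u_commute': "cm (cj u (a ^ i)) (cj u (a ^ j))"
proof -
  have *: "cm (cj u (a ^ i)) (cj u (a ^ (i + n)))" for i n
  proof -
    have "cj u (a ^ (i + n)) = cj (cj u (a ^ n)) (a ^ i)"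
      by (simp add: cj_cj add.commute flip: power_add)
    then show ?thesis using u_commute by simp
  qed
  then show ?thesis using *[of i "j - i"] cm_sym[OF *[of j "i - j"]] by (cases "i \<le> j") simp_all
qed

lemma cj_Ul: "cj (Ul u a (b # bs)) (a ^ i) = (if b then cj u (a ^ i) else 1) * cj (Ul u a bs) (a ^ Suc i)"
  by (simp add: cj_mult cj_cj)

lemma Ul_commute1: "cm (cj u (a ^ j)) (cj (Ul u a bs) (a ^ i))"
proof (induction bs arbitrary: i)
  case (Cons b bs)
  then show ?case unfolding cj_Ul by (intro cm_mult) (simp_all add: u_commute' del: power_Suc)
qed simp

lemma Ul_xor: "length bs = length cs \<Longrightarrow> Ul u a (xorl bs cs) = Ul u a bs * Ul u a cs"
proof (induction bs cs rule: list_induct2)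
  case (Cons b bs c cs)
  have "cm u (cj (Ul u a bs) a)" using Ul_commute1[of 0 bs 1] by simp
  then have *: "cj (Ul u a bs) a * u = u * cj (Ul u a bs) a" by (simp add: cm_def)
  have uu': "u * (u * h) = h" for h using uu by (simp flip: mult.assoc)
  show ?case
    using Cons * uu'
    by (cases b; cases c) (auto simp: cj_mult mult.assoc, simp_all flip: mult.assoc add: *)
qed simp

lemma Ul_append: "Ul u a (bs @ cs) = Ul u a bs * cj (Ul u a cs) (a ^ length bs)"
  by (induction bs) (simp_all add: cj_mult cj_cj power_commutes mult.assoc)

lemma Ul_pad: "Ul u a (bs @ replicate n False) = Ul u a bs"
proof -
  have "Ul u a (replicate n False) = 1" by (induction n) simp_all
  then show ?thesis by (simp add: Ul_append)
qed

text \<open>Prefixing a bit to \<open>k\<close> bits overflows by at most one place, and the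
  relation \<open>ua_k\<close> replaces the overflowing factor by the bits of \<open>z ^ k\<close>.
  Hence \<open>Ul\<close> depends only on the field element, and \<open>V\<close> is a homomorphism
  from the additive group of \<open>F\<close>.\<close>

lemma Ul_reduce: "\<exists>cs. length cs = k \<and> elt z cs = elt z bs \<and> Ul u a cs = Ul u a bs"
proof (induction bs)
  case Nil
  show ?case using elt_pad[of "[]" k] Ul_pad[of "[]" k]
    by (intro exI[of _ "replicate k False"]) simp
next
  case (Cons b bs)
  then obtain cs where cs: "length cs = k" "elt z cs = elt z bs" "Ul u a cs = Ul u a bs" by blast
  have k0: "length (b # cs) = Suc k" using cs by simp
  then obtain ds c where ds: "b # cs = ds @ [c]" by (metis length_Suc_conv_rev)
  then have lds: "length ds = k" using k0 by simp
  have e: "elt z (b # bs) = elt z (ds @ [c])" "Ul u a (b # bs) = Ul u a (ds @ [c])"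
    unfolding ds[symmetric] using cs by simp_all
  show ?case
  proof (cases c)
    case True
    define fs where "fs = bits (z ^ k)"
    have fs: "length fs = k" "elt z fs = z ^ k" unfolding fs_def using bits zpow_F by auto
    have "Ul u a fs = cj u (a ^ k)" using ua_k by (simp add: U_def fs_def)
    then show ?thesis using fs lds e True
      by (intro exI[of _ "xorl ds fs"]) (simp add: elt_xor Ul_xor elt_append Ul_append)
  next
    case False
    then show ?thesis using lds e by (intro exI[of _ ds]) (simp add: elt_append Ul_append)
  qed
qed

lemma Ul_eq_U: "Ul u a bs = V (elt z bs)"
proof -
  obtain cs where cs: "length cs = k" "elt z cs = elt z bs" "Ul u a cs = Ul u a bs"
    using Ul_reduce by blast
  have "bits (elt z bs) = cs" using bits[OF elt_F, of bs] cs elt_inj by (simp add: inj_on_def)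
  then show ?thesis using cs by (simp add: U_def)
qed

lemma U_0: "V 0 = 1" using Ul_eq_U[of "[]"] by simp

lemma U_1: "V 1 = u" using Ul_eq_U[of "[True]"] by simp

lemma U_add: "x \<in> F \<Longrightarrow> x' \<in> F \<Longrightarrow> V (x + x') = V x * V x'"
proof -
  assume x: "x \<in> F" "x' \<in> F"
  note b = bits[OF x(1)] bits[OF x(2)]
  have "V x * V x' = Ul u a (xorl (bits x) (bits x'))" using b by (simp add: Ul_xor U_def)
  then show ?thesis using b by (simp add: Ul_eq_U elt_xor)
qed

lemma U_sq: "x \<in> F \<Longrightarrow> V x * V x = 1"
  using U_add[of x x] by (simp add: U_0)

lemma U_sq_assoc: "x \<in> F \<Longrightarrow> V x * (V x * h) = h"
  using U_sq[of x] by (simp flip: mult.assoc)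

lemma inv_U: "x \<in> F \<Longrightarrow> inverse (V x) = V x"
  by (simp add: U_sq power_invol)

lemma U_cm: "x \<in> F \<Longrightarrow> x' \<in> F \<Longrightarrow> cm (V x) (V x')"
  by (simp add: cm_def add.commute flip: U_add)

lemma U_cj_a: "x \<in> F \<Longrightarrow> cj (V x) a = V (z * x)"
  using Ul_eq_U[of "False # bits x"] bits[of x] by (simp add: U_def)

lemma U_cj: "x \<in> F \<Longrightarrow> cj (V x) (a ^ i) = V (z ^ i * x)"
proof (induction i)
  case (Suc i)
  have "cj (V x) (a ^ Suc i) = cj (cj (V x) (a ^ i)) a" by (simp add: cj_cj power_commutes)
  then show ?case using Suc by (simp add: U_cj_a F_closed zpow_F mult.assoc)
qed simp

lemma u_cj: "cj u (a ^ i) = V (z ^ i)"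
  using U_cj[of 1 i] by (simp add: F_closed U_1)

lemma U_inv_cj: "x \<in> F \<Longrightarrow> cj (V x) (inverse (a ^ i)) = V (x / z ^ i)"
proof -
  assume x: "x \<in> F"
  have "x * (1 / z ^ i) \<in> F" using x by (simp only: F_closed zpow_F)
  then have "cj (V (x / z ^ i)) (a ^ i) = V x" by (simp add: U_cj z_nz)
  then show ?thesis by (simp add: cj_cj flip: \<open>_ = V x\<close>)
qed

lemma wa_pow: "a ^ i * w = w * inverse (a ^ i)"
  using cj_move[of "a ^ i" w] by (simp add: cj_power aw inv_power)

lemma wuw: "w * u * w = u * w * u"
proof -
  have "(u * w * u) * (w * u * w) = 1" using uw3 by (simp add: power3_eq_cube mult.assoc)
  then have "inverse (u * w * u) = w * u * w" by (rule inv_unique)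
  then show ?thesis by (simp add: inv_u inv_w mult.assoc)
qed

lemma inv_F: "x \<in> F \<Longrightarrow> 1 / x \<in> F"
  by (simp add: F_closed)

text \<open>The rank one Bruhat relation. For \<open>i = 0\<close> it is
  \<open>w * u * w = u * w * u\<close>, and conjugating \<open>u\<close> by \<open>a ^ i\<close>,
  which \<open>w\<close> inverts, yields the general case.\<close>

lemma wUw: 
  assumes "x = z ^ i"
  shows "w * V x * w = V (1 / x) * w * inverse (a ^ i) * inverse (a ^ i) * V (1 / x)"
proof -
  let ?A = "a ^ i"
  have V: "V x = inverse ?A * u * ?A" using assms u_cj[of i] by (simp add: cj_def)
  have x: "1 / x \<in> F" by (simp add: assms inv_F zpow_F)
  have u: "u = cj (V (1 / x)) ?A" using U_cj[OF x, of i] z_nz by (simp add: assms U_1)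
  have 1: "?A * u = V (1 / x) * ?A" "u * inverse ?A = inverse ?A * V (1 / x)"
    by (subst u, simp add: cj_def mult.assoc)+
  have 2: "w * inverse ?A = ?A * w" using wa_pow[of i] by simp
  have "w * V x * w = (w * inverse ?A) * u * (?A * w)" by (simp add: V mult.assoc)
  also have "\<dots> = (?A * w) * u * (w * inverse ?A)" by (simp only: 2)
  also have "\<dots> = ?A * (w * u * w) * inverse ?A" by (simp add: mult.assoc)
  also have "\<dots> = (?A * u) * w * (u * inverse ?A)" unfolding wuw by (simp add: mult.assoc)
  also have "\<dots> = V (1 / x) * ((?A * w) * inverse ?A) * V (1 / x)" unfolding 1 by (simp add: mult.assoc)
  finally show ?thesis by (simp add: wa_pow mult.assoc)
qed

end

text \<open>\<open>star e\<close> is the orbit of \<open>e\<close> under the projective line action, \<open>e\<close> itself sitting at infinity.\<close>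

context gf begin

definition star :: "'h::mgroup \<Rightarrow> 'h \<Rightarrow> 'h \<Rightarrow> 'h \<Rightarrow> 'k option \<Rightarrow> 'h" where
  "star u a w e p = (case p of None \<Rightarrow> e | Some x \<Rightarrow> cj e (w * U u a x))"

lemma star_simps [simp]: "star u a w e None = e" "star u a w e (Some x) = cj e (w * U u a x)"
  by (simp_all add: star_def)

lemma mob_P1: "x \<in> F \<Longrightarrow> p \<in> P1 \<Longrightarrow> mobU x p \<in> P1" "p \<in> P1 \<Longrightarrow> mobA z p \<in> P1" "p \<in> P1 \<Longrightarrow> mobW p \<in> P1"
  by (auto simp: mobU_def mobA_def mobW_def F_closed z_F split: if_splits)

end

context sl2 begin

context
  fixes e :: 'h
  assumes eu: "cm e u" and ea: "cm e a"
begin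

lemma eU: "x \<in> F \<Longrightarrow> cj e (V x) = e"
proof -
  have "cm e (Ul u a bs)" for bs
    by (induction bs) (auto intro!: cm_mult cm_cj2 eu ea)
  then show ?thesis by (simp add: U_def cm_iff_cj)
qed

lemma star_U: "x \<in> F \<Longrightarrow> p \<in> P1 \<Longrightarrow> cj (star u a w e p) (V x) = star u a w e (mobU x p)"
  by (auto simp: mobU_def cj_cj U_add eU mult.assoc)

lemma star_u: "p \<in> P1 \<Longrightarrow> cj (star u a w e p) u = star u a w e (mobU 1 p)"
  using star_U[of 1 p] by (simp add: F_closed U_1)

lemma star_a: "p \<in> P1 \<Longrightarrow> cj (star u a w e p) a = star u a w e (mobA z p)"
proof (cases p)
  case None
  then show ?thesis using ea by (simp add: mobA_def cm_iff_cj)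
next
  case (Some x)
  assume "p \<in> P1"
  then have x: "x \<in> F" using Some by auto
  have "V x * a = a * V (z * x)" using cj_move[of "V x" a] x by (simp add: U_cj_a)
  moreover have "w * a = inverse a * w" using wa_pow[of 1] by (metis power_one_right left_inv_assoc mult.assoc right_inv mult_1_right)
  ultimately have "w * V x * a = inverse a * (w * V (z * x))" by (simp add: mult.assoc) (simp flip: mult.assoc)
  moreover have "cj e (inverse a) = e" using cm_inverse[OF ea] by (simp add: cm_iff_cj)
  ultimately have "cj (cj e (w * V x)) a = cj e (w * V (z * x))"
    by (simp only: cj_cj) (simp add: cj_cj flip: cj_cj[of e "inverse a"])
  then show ?thesis using Some by (simp add: mobA_def mult.commute)
qed

text \<open>By \<open>wUw\<close>, the product \<open>w * V x * w\<close> equals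
  \<open>w * V (1 / x)\<close> up to a left factor made of a translation and a power of
  \<open>a\<close>; such a factor commutes with \<open>e\<close>.\<close>

lemma star_w: "p \<in> P1 \<Longrightarrow> cj (star u a w e p) w = star u a w e (mobW p)"
proof (cases p)
  case None
  then show ?thesis by (simp add: mobW_def U_0)
next
  case (Some x)
  assume "p \<in> P1"
  then have x: "x \<in> F" using Some by auto
  show ?thesis
  proof (cases "x = 0")
    case True
    then show ?thesis using Some by (simp add: mobW_def U_0 cj_cj ww)
  next
    case False
    then obtain i where i: "x = z ^ i" using z_gen x by blast
    let ?A = "a ^ i"
    have "w * V x * w = V (1 / x) * w * inverse ?A * inverse ?A * V (1 / x)" using wUw[OF i] .
    also have "\<dots> = V (1 / x) * (?A * ?A) * (w * V (1 / x))"
      using wa_pow[of i] by (simp add: mult.assoc) (simp add: mult.assoc[symmetric])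
    finally have "w * V x * w = V (1 / x) * (?A * ?A) * (w * V (1 / x))" .
    moreover have "cj e (V (1 / x) * (?A * ?A)) = e"
    proof -
      have "cm e (V (1 / x))" using eU[OF inv_F[OF x]] by (simp add: cm_iff_cj)
      then have "cm e (V (1 / x) * (?A * ?A))" using ea by (intro cm_mult cm_power)
      then show ?thesis by (simp add: cm_iff_cj)
    qed
    ultimately have "cj (cj e (w * V x)) w = cj e (w * V (1 / x))"
      by (simp only: cj_cj) (simp flip: cj_cj)
    then show ?thesis using Some False by (simp add: mobW_def)
  qed
qed

end

\<comment> \<open>The end of the star action; next come diagonal elements, Bruhat forms and
  collapse\<close>
end

context sl2 begin

text \<open>\<open>t\<close> is the multiplier of the diagonal element \<open>A\<close>; the representation by \<open>a\<close> need not be faithful.\<close>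

definition diag :: "'h \<Rightarrow> 'a \<Rightarrow> bool" where
  "diag A t \<longleftrightarrow> (\<exists>i j. A = a ^ i * inverse (a ^ j) \<and> t = z ^ i / z ^ j)"

lemma apow_cm: "cm (a ^ i) (inverse (a ^ j))"
  by (intro cm_inverse) (simp add: cm_def add.commute flip: power_add)

lemma diag_1: "diag 1 1"
  unfolding diag_def by (rule exI[of _ 0], rule exI[of _ 0]) simp

lemma diag_mult: "diag A t \<Longrightarrow> diag B s \<Longrightarrow> diag (A * B) (t * s)"
proof -
  assume "diag A t" "diag B s"
  then obtain i j i' j' where A: "A = a ^ i * inverse (a ^ j)" "t = z ^ i / z ^ j"
    and B: "B = a ^ i' * inverse (a ^ j')" "s = z ^ i' / z ^ j'" by (auto simp: diag_def)
  have "A * B = a ^ i * (inverse (a ^ j) * a ^ i') * inverse (a ^ j')" by (simp add: A B mult.assoc)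
  also have "inverse (a ^ j) * a ^ i' = a ^ i' * inverse (a ^ j)" using apow_cm by (simp add: cm_def)
  finally have "A * B = a ^ (i + i') * inverse (a ^ (j' + j))" by (simp add: power_add mult.assoc)
  moreover have "t * s = z ^ (i + i') / z ^ (j' + j)" by (simp add: A B power_add)
  ultimately show ?thesis unfolding diag_def by blast
qed

lemma diag_inverse: "diag A t \<Longrightarrow> diag (inverse A) (1 / t)"
proof -
  assume "diag A t"
  then obtain i j where "A = a ^ i * inverse (a ^ j)" "t = z ^ i / z ^ j" by (auto simp: diag_def)
  then have "inverse A = a ^ j * inverse (a ^ i)" "1 / t = z ^ j / z ^ i" by simp_all
  then show ?thesis unfolding diag_def by blast
qed

lemma diag_pow: "diag (a ^ i) (z ^ i)"
  unfolding diag_def by (rule exI[of _ i], rule exI[of _ 0]) simp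

lemma diag_F: "diag A t \<Longrightarrow> t \<in> F \<and> t \<noteq> 0"
proof -
  assume "diag A t"
  then obtain i j where t: "t = z ^ i * (1 / z ^ j)" by (auto simp: diag_def)
  then show ?thesis using F_closed(4)[OF zpow_F F_closed(5)[OF zpow_F]] z_nz by simp
qed

lemma diag_U: "diag A t \<Longrightarrow> x \<in> F \<Longrightarrow> cj (V x) A = V (t * x)"
proof -
  assume "diag A t" and x: "x \<in> F"
  then obtain i j where A: "A = a ^ i * inverse (a ^ j)" "t = z ^ i / z ^ j" by (auto simp: diag_def)
  have zx: "z ^ i * x \<in> F" using x by (intro F_closed(4) zpow_F)
  have "cj (V x) A = cj (cj (V x) (a ^ i)) (inverse (a ^ j))" by (simp only: A cj_cj)
  also have "\<dots> = V (z ^ i * x / z ^ j)" by (simp only: U_cj[OF x] U_inv_cj[OF zx])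
  finally show ?thesis by (simp add: A)
qed

lemma diag_w: "diag A t \<Longrightarrow> A * w = w * inverse A"
proof -
  assume "diag A t"
  then obtain i j where A: "A = a ^ i * inverse (a ^ j)" by (auto simp: diag_def)
  have "cj A w = inverse (a ^ i) * a ^ j"
    by (simp add: A cj_mult cj_inverse cj_power aw flip: inv_power)
  also have "\<dots> = a ^ j * inverse (a ^ i)" using apow_cm by (simp add: cm_def)
  finally have "cj A w = inverse A" by (simp add: A)
  then show ?thesis using cj_move[of A w] by simp
qed

text \<open>Multiplier 1 means that \<open>A\<close> commutes with \<open>u\<close>, while
  \<open>w\<close> always inverts \<open>A\<close>. So \<open>u * w\<close> inverts
  \<open>A\<close>, and so does its cube, which is 1.\<close>

lemma diag_one: 
  assumes "diag A 1"
  shows "A * A = 1"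
proof -
  have "cm A u"
    by (rule cm_sym) (use diag_U[OF assms, of 1] in \<open>simp add: F_closed U_1 cm_iff_cj\<close>)
  then have u: "cj A u = A" by (simp add: cm_iff_cj)
  have w: "cj A w = inverse A" using diag_w[OF assms] by (rule cj_eqI)
  have uw: "cj A (u * w) = inverse A" by (simp add: u w flip: cj_cj)
  have "cj A ((u * w) ^ 3) = inverse A"
    by (simp only: power3_eq_cube cj_cj[symmetric, of _ "u * w"] cj_cj[symmetric, of _ "u * w * (u * w)"] uw cj_inverse inv_inv)
  then have "A = inverse A" by (simp add: uw3)
  then show ?thesis using right_inv[of A] by simp
qed

definition bruhat :: "'h \<Rightarrow> bool" where
  "bruhat g \<longleftrightarrow> (\<exists>x\<in>F. \<exists>A t. diag A t \<and> (g = V x * A \<or> (\<exists>c\<in>F. g = V x * w * A * V c)))"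

text \<open>Normal forms survive because the two cells absorb \<open>V b * w\<close>. Diagonal
  elements pass through translations by scaling them and through \<open>w\<close> by inversion. In
  the big cell the translations merge to \<open>V (c + b)\<close>: if this is trivial the two copies
  of \<open>w\<close> cancel, otherwise \<open>wUw\<close> opens up
  \<open>w * V (c + b) * w\<close>.\<close>

lemma bruhat_step:
  assumes "bruhat g" "b \<in> F"
  shows "bruhat (g * (V b * w))"
proof -
  obtain x A t where x: "x \<in> F" and A: "diag A t"
    and g: "g = V x * A \<or> (\<exists>c\<in>F. g = V x * w * A * V c)" using assms by (auto simp: bruhat_def)
  note t = diag_F[OF A]
  have Aw: "A * w = w * inverse A" by (rule diag_w[OF A])
  then have iAw: "inverse A * w = w * A" using diag_w[OF diag_inverse[OF A]] by simp
  from g show ?thesis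
  proof
    assume g: "g = V x * A"
    have bt: "b * (1 / t) \<in> F" using F_closed(4)[OF assms(2) F_closed(5)] t by blast
    have "V (b / t) * A = A * V b" using cj_move[of "V (b / t)" A] diag_U[OF A bt] t by simp
    then have "g * (V b * w) = V x * V (b / t) * (A * w)" by (simp add: g mult.assoc) (simp flip: mult.assoc)
    also have "\<dots> = V (x + b / t) * w * inverse A * V 0" using x bt by (simp add: U_add U_0 Aw mult.assoc)
    finally show ?thesis unfolding bruhat_def using diag_inverse[OF A] F_closed(1) F_closed(3)[OF x bt]
      by auto
  next
    assume "\<exists>c\<in>F. g = V x * w * A * V c"
    then obtain c where c: "c \<in> F" and g: "g = V x * w * A * V c" by blast
    have cb: "c + b \<in> F" using c assms by (simp add: F_closed)
    have *: "g * (V b * w) = V x * w * A * V (c + b) * w"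
      using c assms by (simp add: g U_add mult.assoc)
    show ?thesis
    proof (cases "c + b = 0")
      case True
      then have "g * (V b * w) = V x * (w * (A * w))" using * by (simp add: U_0 mult.assoc)
      also have "\<dots> = V x * inverse A" using ww by (simp add: Aw flip: mult.assoc)
      finally show ?thesis unfolding bruhat_def using diag_inverse[OF A] x by blast
    next
      case False
      then obtain j where j: "c + b = z ^ j" using z_gen cb by blast
      let ?d = "c + b" and ?D = "inverse (a ^ j) * inverse (a ^ j)"
      have D: "diag ?D (1 / ?d * (1 / ?d))" unfolding j by (intro diag_mult diag_inverse diag_pow)
      have id: "1 / ?d \<in> F" using cb by (rule F_closed)
      have td: "t * (1 / ?d) \<in> F" using F_closed(4) t id by blast
      have wU: "w * V ?d * w = V (1 / ?d) * w * ?D * V (1 / ?d)" using wUw[OF j] by (simp add: mult.assoc)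
      have "V (t * (1 / ?d)) * inverse A = inverse A * V (1 / ?d)"
        using cj_move[of "V (t * (1 / ?d))" "inverse A"] diag_U[OF diag_inverse[OF A] td] t by simp
      note m = this
      have "g * (V b * w) = V x * w * (A * w) * (w * V ?d * w)"
        using * ww by (simp add: mult.assoc) (simp flip: mult.assoc)
      also have "\<dots> = V x * (w * w) * (inverse A * V (1 / ?d)) * w * ?D * V (1 / ?d)"
        unfolding Aw wU by (simp add: mult.assoc)
      also have "\<dots> = V x * V (t * (1 / ?d)) * (inverse A * w) * ?D * V (1 / ?d)"
        unfolding ww m[symmetric] by (simp add: mult.assoc)
      also have "\<dots> = V (x + t * (1 / ?d)) * w * (A * ?D) * V (1 / ?d)"
        unfolding iAw using x td by (simp add: U_add mult.assoc)
      finally show ?thesis unfolding bruhat_def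
        using diag_mult[OF A D] F_closed(3)[OF x td] id by blast
    qed
  qed
qed

lemma bruhat_power: "b \<in> F \<Longrightarrow> bruhat ((V b * w) ^ j)"
proof (induction j)
  case 0
  then show ?case unfolding bruhat_def using diag_1 F_closed(1) by (auto simp: U_0 intro!: bexI[of _ 0])
next
  case (Suc j)
  then show ?case using bruhat_step[of "(V b * w) ^ j" b] by (simp only: power_Suc2)
qed

lemma U_collapse:
  assumes "x \<in> F" "x \<noteq> 0" "V x = 1"
  shows "u = 1"
proof -
  obtain i where "x = z ^ i" using z_gen assms by blast
  then have "cj u (a ^ i) = 1" using assms(3) by (simp add: u_cj)
  then show ?thesis by simp
qed

text \<open>The fourth power says that \<open>V b\<close> commutes with its conjugate by
  \<open>w\<close>. Comparison with \<open>wUw\<close> shows that this conjugate is also a conjugate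
  of \<open>V b\<close> by a diagonal element, hence a translation. So \<open>w\<close> is a
  translation times a diagonal element, which turns \<open>w * u * w\<close> into a translation and
  finally forces \<open>w = u\<close>.\<close>

lemma collapse:
  assumes "b \<in> F" "b \<noteq> 0" "(V b * w) ^ 4 = 1"
  shows "u = 1 \<and> a = 1 \<and> w = 1"
proof -
  obtain i where i: "b = z ^ i" using z_gen assms by blast
  let ?X = "V b" and ?P = "V (1 / b)" and ?D = "inverse (a ^ i) * inverse (a ^ i)"
  define Y where "Y = w * ?X * w"
  have ib: "1 / b \<in> F" using assms by (rule_tac F_closed)
  have D: "diag ?D (1 / b * (1 / b))" unfolding i by (intro diag_mult diag_inverse diag_pow)
  have iD: "diag (inverse ?D) (b * b)" using diag_inverse[OF D] by simp
  have bb: "b * b \<in> F" "b * b * b \<in> F" using assms by (simp_all add: F_closed)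
  have XX: "?X * ?X = 1" using U_sq assms by blast
  have "?X * w * (?X * w) * (?X * w * (?X * w)) = 1"
    using assms(3) by (simp add: power4_eq_xxxx mult.assoc)
  then have "inverse (?X * w * (?X * w)) = ?X * w * (?X * w)" by (rule inv_unique)
  then have XY: "cm ?X Y" using assms(1) by (simp add: cm_def Y_def inv_w inv_U mult.assoc)
  have Y: "Y = ?P * (w * ?D) * ?P" unfolding Y_def using wUw[OF i] by (simp add: mult.assoc)
  then have "w * ?D = ?P * Y * ?P" using U_sq[OF ib] U_sq_assoc[OF ib] by (simp add: mult.assoc)
  then have "cm ?X (w * ?D)" using XY U_cm[OF assms(1) ib] by (simp add: cm_mult)
  then have "cj (cj ?X w) ?D = ?X" by (simp add: cm_iff_cj cj_cj)
  \<comment> \<open>Now the conjugate of \<open>?X\<close> by \<open>w\<close> is reached from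
    \<open>?X\<close> by a diagonal element alone, so \<open>diag_U\<close> computes it: the
    multiplier \<open>b * b\<close> gives \<open>V (b * b * b)\<close>.\<close>
  then have "cj Y ?D = ?X" by (simp add: Y_def cj_def inv_w mult.assoc)
  then have "cj ?X (inverse ?D) = cj Y (?D * inverse ?D)" by (simp only: cj_cj[symmetric])
  then have "Y = cj ?X (inverse ?D)" by (simp only: right_inv cj_1)
  then have YU: "Y = V (b * b * b)" using diag_U[OF iD assms(1)] by simp
  have "w * ?D = V (b * b * b)"
    unfolding \<open>w * ?D = ?P * Y * ?P\<close> YU
    using U_cm[OF ib bb(2)] U_sq_assoc[OF ib] U_sq[OF ib] by (simp add: cm_def mult.assoc)
  moreover have "w * ?D * inverse ?D = w" by (simp only: mult.assoc[of w ?D] right_inv mult_1_right)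
  ultimately have "w = V (b * b * b) * inverse ?D" by simp
  moreover have "cj u (V (b * b * b)) = u"
    using U_cm[OF F_closed(2) bb(2)] by (simp add: U_1 cm_iff_cj)
  ultimately have "cj u w = cj u (inverse ?D)" by (simp only: cj_cj[symmetric])
  also have "\<dots> = V (b * b)" using diag_U[OF iD F_closed(2)] by (simp add: U_1)
  finally have "w * u * w = V (b * b)" by (simp add: cj_def inv_w)
  then have uwu: "u * w * u = V (b * b)" by (simp add: wuw)
  then have "u * (u * w * u) * u = u * V (b * b) * u" by simp
  moreover have uu': "u * (u * h) = h" for h using uu by (simp flip: mult.assoc)
  ultimately have "w = u * V (b * b) * u" using uu by (simp add: mult.assoc)
  moreover have uV: "u * V (b * b) = V (b * b) * u"
    using U_cm[OF F_closed(2) bb(1)] by (simp add: U_1 cm_def)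
  ultimately have w: "w = V (b * b)" using uu by (simp add: mult.assoc)
  then have "w * (u * w) = w * 1" using \<open>w * u * w = V (b * b)\<close> by (simp add: mult.assoc)
  then have "inverse u = w" by (intro inv_unique) (simp only: left_cancel)
  then have wu: "w = u" by (simp add: inv_u)
  \<comment> \<open>With \<open>w = u\<close> the letter \<open>a\<close> is inverted by
    \<open>u\<close>, so \<open>a * a\<close> is a product of \<open>u\<close> and a conjugate of
    \<open>u\<close> that commutes with \<open>u\<close>. Thus \<open>a * a\<close> centralises
    \<open>u\<close>, that is, multiplication by \<open>z ^ 2\<close> fixes the translation by 1,
    and \<open>V (1 + z ^ 2) = 1\<close>.\<close>
  have "inverse a = u * a * u" using aw by (simp add: wu cj_def inv_u)
  then have "a * (u * a * u) = 1" by (metis right_inv)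
  then have "(a * u * inverse a) * (a * a) * u = 1" by (simp add: mult.assoc)
  then have "inverse ((a * u * inverse a) * (a * a)) = u" by (rule inv_unique)
  then have "(a * u * inverse a) * (a * a) = u" using inv_inv[of "(a * u * inverse a) * (a * a)"] inv_u by simp
  then have "inverse (a * u * inverse a) * ((a * u * inverse a) * (a * a)) = inverse (a * u * inverse a) * u"
    by (simp only:)
  then have aa: "a * a = inverse (a * u * inverse a) * u" by (simp only: left_inv_assoc)
  have "cm (cj (cj u (inverse a)) a) (cj u a)" using u_commute[of 1] by (simp add: cj_cj)
  then have "cm (cj u (inverse a)) u" by (simp only: cm_cj_iff)
  then have "cm u (cj u (inverse a))" by (rule cm_sym)
  then have "cm u (a * u * inverse a)" by (simp add: cj_def)
  then have "cm u (a * a)" unfolding aa by (rule cm_mult[OF cm_inverse cm_refl])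
  then have "cj u (a ^ 2) = u" by (simp add: cm_iff_cj power2_eq_square)
  then have "V (z ^ 2) = V 1" by (simp add: u_cj U_1)
  then have "V (1 + z ^ 2) = 1" using U_add[OF F_closed(2) zpow_F[of 2]] U_sq[OF F_closed(2)] by simp
  moreover have "1 + z ^ 2 = (1 + z) * (1 + z)" by (simp add: ring_distribs power2_eq_square add.assoc)
  ultimately have "u = 1" using U_collapse[of "(1 + z) * (1 + z)"] z1 by (simp add: F_closed)
  moreover have "Ul 1 a bs = 1" for bs by (induction bs) simp_all
  then have "U 1 a x = 1" for x by (simp add: U_def)
  ultimately show ?thesis using wu SL2 by (simp add: SL2_rel_def Hd_def)
qed

lemma collapse_a:
  assumes "a = 1" shows "u = 1 \<and> w = 1"
proof -
  have "cj u (a ^ 1) = u" by (simp add: assms)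
  then have "V z = V 1" using u_cj[of 1] by (simp only: U_1 power_one_right)
  then have "V (1 + z) = 1" using U_add[OF F_closed(2) z_F] U_sq[OF F_closed(2)] by simp
  then have "u = 1" using U_collapse z1 by blast
  moreover have "w = 1" using uw3 ww \<open>u = 1\<close> by (simp add: power3_eq_cube)
  ultimately show ?thesis by simp
qed

end

section \<open>Pairs of groups and the permutations of the projective line\<close>

instantiation prod :: (mgroup, mgroup) mgroup
begin

definition "x * y = (fst x * fst y, snd x * snd y)"
definition "1 = (1, 1)"
definition "inverse x = (inverse (fst x), inverse (snd x))"
definition "(x :: 'a \<times> 'b) div y = x * inverse y"

instance
  by standard (simp_all add: times_prod_def one_prod_def inverse_prod_def mult.assoc)

end

lemma prod_mgroup [simp]:
  "(a, b) * (c, d) = (a * c, b * d)" "inverse (a, b) = (inverse a, inverse b)"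
  by (simp_all add: times_prod_def inverse_prod_def)

lemma power_pair: "(a, b) ^ n = (a ^ n, b ^ n)"
  by (induction n) (simp_all add: one_prod_def)

lemma cj_pair: "cj (a, b) (c, d) = (cj a c, cj b d)"
  by (simp add: cj_def)

lemma Ul_pair: "Ul (u, u') (a, a') bs = (Ul u a bs, Ul u' a' bs)"
  by (induction bs) (simp_all add: one_prod_def cj_pair)

lemma Ul_cj: "Ul (cj u h) (cj a h) bs = cj (Ul u a bs) h"
  by (induction bs) (simp_all add: cj_mult cj_cj cj_move[of a h, symmetric])

context gf begin

text \<open>Lets one Bruhat reduction run in an abstract group and in permutations at once: the
  second coordinate then reveals which normal form has been reached in the first.\<close>

lemma SL2_rel_pair: "SL2_rel u a w \<Longrightarrow> SL2_rel u' a' w' \<Longrightarrow> SL2_rel (u, u') (a, a') (w, w')"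
  by (simp add: SL2_rel_def Hd_def U_def Ul_pair cj_pair power_pair cm_def one_prod_def)

lemma U_conj: "U (cj u h) (cj a h) x = cj (U u a x) h"
  by (simp add: U_def Ul_cj)

lemma SL2_rel_cj: "SL2_rel u a w \<Longrightarrow> SL2_rel (cj u h) (cj a h) (cj w h)"
proof -
  assume r: "SL2_rel u a w"
  have Hd: "Hd (cj u h) (cj a h) (cj w h) x = cj (Hd u a w x) h" for x
    by (simp add: Hd_def U_conj cj_mult)
  have c: "cj (cj g h) (cj g' h) = cj (cj g g') h" for g g'
    by (simp add: cj_cj cj_move[of g' h, symmetric])
  show ?thesis using r unfolding SL2_rel_def Hd U_conj c cj_power[symmetric] cj_mult[symmetric] cj_inverse[symmetric]
    by simp
qed

lemma sum_zero_iff: "(x::'k) + v = 0 \<longleftrightarrow> x = v"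
  by (metis add_self add_self_assoc add.right_neutral)

lemma mob_id: "mobU 0 = id" "mobA 1 = id"
  by (simp_all add: mobU_def mobA_def fun_eq_iff option.map_ident)

text \<open>The outer \<open>None\<close> is the additional centre, fixed by all these permutations,
  and \<open>Some None\<close> is infinity. Values of \<open>f\<close> outside \<open>P1\<close> are
  replaced by the identity, as the type \<open>'k\<close> may be larger than
  \<open>F\<close>.\<close>

definition onP :: "('k option \<Rightarrow> 'k option) \<Rightarrow> 'k option option prm" where
  "onP f = Prm (map_option (\<lambda>p. if p \<in> P1 then f p else p))"

lemma app_onP:
  assumes "bij_betw f P1 P1"
  shows "app (onP f) None = None" "app (onP f) (Some p) = Some (if p \<in> P1 then f p else p)"
proof -
  let ?g = "\<lambda>p. if p \<in> P1 then f p else p"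
  have g: "bij ?g" using assms by (rule bij_on_extend)
  have "bij (map_option ?g)"
    by (rule o_bij[of "map_option (inv_into UNIV ?g)"])
      (simp_all only: fun_eq_iff comp_apply option.map_comp comp_def id_apply option.map_ident simp_thms
        inv_f_f[OF bij_is_inj[OF g]] surj_f_inv_f[OF bij_is_surj[OF g]])
  then have "app (onP f) = map_option ?g" unfolding onP_def by (simp add: Prm_inverse)
  then show "app (onP f) None = None" "app (onP f) (Some p) = Some (?g p)" by simp_all
qed

lemma bij_P1: "(\<And>p. p \<in> P1 \<Longrightarrow> f p \<in> P1) \<Longrightarrow> (\<And>p. p \<in> P1 \<Longrightarrow> g p \<in> P1) \<Longrightarrow>
    (\<And>p. p \<in> P1 \<Longrightarrow> g (f p) = p) \<Longrightarrow> (\<And>p. p \<in> P1 \<Longrightarrow> f (g p) = p) \<Longrightarrow> bij_betw f P1 P1"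
  by (rule bij_betw_byWitness[of _ g]) auto

lemma mob_bij: "x \<in> F \<Longrightarrow> bij_betw (mobU x) P1 P1" "t \<in> F \<Longrightarrow> t \<noteq> 0 \<Longrightarrow> bij_betw (mobA t) P1 P1"
  "bij_betw mobW P1 P1"
proof -
  show "x \<in> F \<Longrightarrow> bij_betw (mobU x) P1 P1"
    by (rule bij_P1[of _ "mobU x"]) (auto simp: mobU_def F_closed add.assoc)
  have "p \<in> F \<Longrightarrow> t \<in> F \<Longrightarrow> p / t \<in> F" for p t using F_closed(4)[OF _ F_closed(5), of p t] by simp
  then show "t \<in> F \<Longrightarrow> t \<noteq> 0 \<Longrightarrow> bij_betw (mobA t) P1 P1"
    by (intro bij_P1[of _ "mobA (1 / t)"]) (auto simp: mobA_def F_closed)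
  show "bij_betw mobW P1 P1"
    by (rule bij_P1[of _ mobW]) (auto simp: mobW_def F_closed split: if_splits)
qed

lemma onP_mult: "bij_betw f P1 P1 \<Longrightarrow> bij_betw g P1 P1 \<Longrightarrow> onP f * onP g = onP (g \<circ> f)"
proof (rule prm_eqI)
  fix x assume fg: "bij_betw f P1 P1" "bij_betw g P1 P1"
  then have gf: "bij_betw (g \<circ> f) P1 P1" by (rule bij_betw_trans)
  have fP: "f p \<in> P1" if "p \<in> P1" for p using bij_betwE[OF fg(1)] that by (rule bspec)
  show "app (onP f * onP g) x = app (onP (g \<circ> f)) x"
  proof (cases x)
    case None
    then show ?thesis by (simp only: app_mult app_onP[OF fg(1)] app_onP[OF fg(2)] app_onP[OF gf])
  next
    case (Some p)
    then show ?thesis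
      by (cases "p \<in> P1")
        (simp_all only: app_mult app_onP[OF fg(1)] app_onP[OF fg(2)] app_onP[OF gf] fP if_True if_False comp_apply)
  qed
qed

lemma onP_eq: "(\<And>p. p \<in> P1 \<Longrightarrow> f p = g p) \<Longrightarrow> onP f = onP g"
  unfolding onP_def by (intro arg_cong[of _ _ Prm] arg_cong[of _ _ map_option]) auto

lemma onP_id: "(\<And>p. p \<in> P1 \<Longrightarrow> f p = p) \<Longrightarrow> onP f = 1"
proof -
  assume "\<And>p. p \<in> P1 \<Longrightarrow> f p = p"
  then have f: "onP f = onP id" by (intro onP_eq) simp
  have "app (onP id) x = x" for x
    using app_onP[of id] by (cases x) (simp_all add: bij_betw_id)
  then show ?thesis unfolding f by (intro prm_eqI) simp
qed

lemma onP_Sym: "bij_betw f P1 P1 \<Longrightarrow> onP f \<in> Sym (Some ` P1)"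
proof -
  assume f: "bij_betw f P1 P1"
  have "app (onP f) x = x" if "x \<notin> Some ` P1" for x
    using that by (cases x) (auto simp: app_onP[OF f])
  then show ?thesis by (simp add: Sym_def)
qed

abbreviation pu where "pu \<equiv> onP (mobU 1)"
abbreviation pa where "pa \<equiv> onP (mobA z)"
abbreviation pw where "pw \<equiv> onP mobW"

lemmas mob_bij' = mob_bij(1)[OF F_closed(2)] mob_bij(2)[OF z_F z_nz] mob_bij(3)

lemma cj_onP:
  assumes "x \<in> F" "t \<in> F" "t \<noteq> 0"
  shows "cj (onP (mobU x)) (onP (mobA t)) = onP (mobU (t * x))"
proof (rule cj_eqI)
  have "t * x \<in> F" using assms by (simp add: F_closed)
  then show "onP (mobU x) * onP (mobA t) = onP (mobA t) * onP (mobU (t * x))"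
    using assms by (simp add: onP_mult mob_bij)
      (rule onP_eq, auto simp: mobU_def mobA_def algebra_simps)
qed

lemma onP_mobU_mult: "x \<in> F \<Longrightarrow> x' \<in> F \<Longrightarrow> onP (mobU x) * onP (mobU x') = onP (mobU (x + x'))"
  by (simp add: onP_mult mob_bij) (rule onP_eq, auto simp: mobU_def algebra_simps)

lemma Ul_onP: "Ul pu pa bs = onP (mobU (elt z bs))"
proof (induction bs)
  case Nil
  then show ?case by (simp add: mob_id onP_id)
next
  case (Cons b bs)
  have F: "z * elt z bs \<in> F" by (intro F_closed z_F elt_F)
  have "(if b then pu else 1) = onP (mobU (of_bool b))"
    by (simp add: mob_id onP_id)
  then show ?case using Cons F
    by (simp add: cj_onP elt_F z_F z_nz onP_mobU_mult F_closed)
qed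

lemma U_onP: "x \<in> F \<Longrightarrow> U pu pa x = onP (mobU x)"
  using bits[of x] by (simp add: U_def Ul_onP)

lemma pa_power: "pa ^ i = onP (mobA (z ^ i))"
proof (induction i)
  case 0
  then show ?case by (simp add: mob_id onP_id)
next
  case (Suc i)
  then show ?case
    by (simp add: onP_mult mob_bij zpow_F z_F z_nz F_closed) (rule onP_eq, auto simp: mobA_def)
qed

lemma Hd_onP:
  assumes r: "r \<in> F" "r \<noteq> 0"
  shows "Hd pu pa pw r = onP (mobA (1 / (r * r)))"
proof -
  have ir: "1 / r \<in> F" using r by (rule_tac F_closed)
  have f: "mobU (1 / r) (mobW (mobU r (mobW (mobU (1 / r) (mobW p))))) = mobA (1 / (r * r)) p" for p
  proof (cases p)
    case None
    then show ?thesis using r by (simp add: mobU_def mobW_def mobA_def)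
  next
    case (Some v)
    consider "v = 0" | "v = r" | "v \<noteq> 0" "v \<noteq> r" by blast
    then show ?thesis
    proof cases
      case 3
      then have nz: "r + v \<noteq> 0" by (simp add: sum_zero_iff)
      have h1: "1 / v + 1 / r = (r + v) / (v * r)" using 3 r by (simp add: field_simps)
      have h2: "v * r / (r + v) + r = r * r / (r + v)" using nz by (simp add: field_simps)
      have h3: "(r + v) / (r * r) + 1 / r = v / (r * r)" using r by (simp add: field_simps)
      show ?thesis using Some 3 r nz by (simp add: mobU_def mobW_def mobA_def h1 h2 h3)
    next
      case 1
      then show ?thesis using Some r by (simp add: mobU_def mobW_def mobA_def)
    next
      case 2
      then show ?thesis using Some r by (simp add: mobU_def mobW_def mobA_def)
    qed
  qed
  show ?thesis unfolding Hd_def using r ir f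
    by (simp add: U_onP onP_mult mob_bij bij_betw_trans[of _ P1 P1]) (rule onP_eq, simp)
qed

lemma pa_inverse: "inverse pa = onP (mobA (1 / z))"
proof (rule inv_unique)
  have "1 / z \<in> F" using z_F by (rule F_closed)
  then show "pa * onP (mobA (1 / z)) = 1"
    using z_nz z_F by (simp add: onP_mult mob_bij) (rule onP_id, auto simp: mobA_def)
qed

lemma SL2_perms: "SL2_rel pu pa pw"
proof -
  note [simp] = onP_mult mob_bij' mob_bij bij_betw_trans[of _ P1 P1]
  have iz: "1 / z \<in> F" using z_F by (rule F_closed)
  have H: "Hd pu pa pw (isqrt x) = onP (mobA x)" if "x \<in> F" "x \<noteq> 0" for x
    using Hd_onP[of "isqrt x"] isqrt[OF that] by simp
  have 1: "pu * pu = 1" by (simp add: F_closed) (rule onP_id, auto simp: mobU_def add.assoc)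
  have 2: "pw * pw = 1" by simp (rule onP_id, auto simp: mobW_def)
  have 3: "(pu * pw) ^ 3 = 1"
  proof -
    have "mobW (mobU 1 (mobW (mobU 1 (mobW (mobU 1 p))))) = p" for p :: "'k option"
    proof (cases p)
      case (Some v)
      consider "v = 0" | "v = 1" | "v \<noteq> 0" "v \<noteq> 1" by blast
      then show ?thesis
      proof cases
        case 3
        then have nz: "v + 1 \<noteq> 0" by (simp add: sum_zero_iff)
        have "1 / (v + 1) + 1 = v / (v + 1)" using nz by (simp add: field_simps)
        moreover have "(v + 1) / v + 1 = 1 / v" using 3 by (simp add: field_simps)
        ultimately show ?thesis using 3 nz Some by (simp add: mobU_def mobW_def)
      next
        case 1
        then show ?thesis using Some by (simp add: mobU_def mobW_def)
      next
        case 2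
        then show ?thesis using Some by (simp add: mobU_def mobW_def)
      qed
    qed (simp add: mobU_def mobW_def)
    then show ?thesis by (simp add: power3_eq_cube F_closed) (rule onP_id, simp)
  qed
  have 4: "cj pa pw = inverse pa"
    by (rule cj_eqI, unfold pa_inverse, simp add: iz z_F z_nz)
      (rule onP_eq, auto simp: mobA_def mobW_def z_nz)
  have 5: "cj pu (Hd pu pa pw (isqrt (1 + z))) = pu * cj pu pa"
    using z1 by (simp add: H cj_onP F_closed z_F z_nz onP_mobU_mult del: onP_mult)
  have 6: "cm pa (Hd pu pa pw (isqrt (1 + z)))"
    using z1 by (simp add: H cm_def z_F z_nz) (rule onP_eq, auto simp: mobA_def)
  have 7: "cj pu (pa ^ k) = U pu pa (z ^ k)"
    by (simp add: pa_power U_onP zpow_F cj_onP F_closed z_nz)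
  have 8: "pa = Hd pu pa pw (isqrt z)" by (simp add: H z_F z_nz)
  show ?thesis unfolding SL2_rel_def using 1 2 3 4 5 6 7 8 by blast
qed

end

section \<open>Evaluation of words and the relators of the base presentation\<close>

definition wev :: "('x \<Rightarrow> 'h::mgroup) \<Rightarrow> 'x word \<Rightarrow> 'h" where
  "wev h v = prod_list (map (\<lambda>(x, b). if b then h x else inverse (h x)) v)"

definition winv :: "'x word \<Rightarrow> 'x word" where
  "winv v = rev (map (\<lambda>(x, b). (x, \<not> b)) v)"

lemma wev_simps [simp]:
  "wev h [] = 1" "wev h ((x, b) # v) = (if b then h x else inverse (h x)) * wev h v"
  "wev h (v @ v2) = wev h v * wev h v2"
  by (simp_all add: wev_def)

lemma winv_Cons: "winv ((x, b) # v) = winv v @ [(x, \<not> b)]"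
  by (simp add: winv_def)

lemma wev_winv [simp]: "wev h (winv v) = inverse (wev h v)"
  by (induction v) (auto simp: winv_Cons winv_def[of "[]"])

lemma length_winv [simp]: "length (winv v) = length v"
  by (simp add: winv_def)

lemma wev_replicate [simp]: "wev h (replicate n (x, b)) = (if b then h x else inverse (h x)) ^ n"
  by (induction n) simp_all

lemma words_simps [simp]:
  "[] \<in> words X" "(x, b) # v \<in> words X \<longleftrightarrow> x \<in> X \<and> v \<in> words X"
  "v @ v2 \<in> words X \<longleftrightarrow> v \<in> words X \<and> v2 \<in> words X"
  "winv v \<in> words X \<longleftrightarrow> v \<in> words X"
  "replicate n (x, b) \<in> words X \<longleftrightarrow> n = 0 \<or> x \<in> X"
  by (auto simp: words_def winv_def in_lists_conv_set split_beta image_iff)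

lemma wev_cong: "v \<in> words X \<Longrightarrow> (\<And>x. x \<in> X \<Longrightarrow> h x = h' x) \<Longrightarrow> wev h v = wev h' v"
  by (induction v) auto

lemma wev_Sym:
  assumes "v \<in> words X" "\<And>x. x \<in> X \<Longrightarrow> ev x \<in> Sym A"
  shows "wev ev v \<in> Sym A"
  using assms by (induction v) (auto intro!: Sym_mult Sym_inverse)

lemma wev_hom:
  assumes "v \<in> words X" "\<And>x. x \<in> X \<Longrightarrow> ev x \<in> Sym A" "hom_on A \<psi>"
  shows "wev (\<lambda>x. \<psi> (ev x)) v = \<psi> (wev ev v)"
  using assms(1)
proof (induction v)
  case Nil
  then show ?case using hom_on_one[OF assms(3)] by simp
next
  case (Cons l v)
  then show ?case using assms wev_Sym[of v X ev A]
    by (cases l) (auto simp: hom_onD hom_on_inverse Sym_inverse)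
qed

text \<open>So if \<open>h\<close> and \<open>ev\<close> both satisfy a set of relators, then the discrepancies between \<open>h\<close> and
  \<open>\<psi> \<circ> ev\<close> satisfy it too, and it remains to see that this solution of the relators is trivial.\<close>

lemma wev_discrepancy:
  assumes v: "v \<in> words X" and ev: "\<And>x. x \<in> X \<Longrightarrow> ev x \<in> Sym A" and hom: "hom_on A \<psi>"
    and cent: "\<And>x q. x \<in> X \<Longrightarrow> q \<in> Sym A \<Longrightarrow> cm (\<psi> q) (h x * inverse (\<psi> (ev x)))"
  shows "wev (\<lambda>x. h x * inverse (\<psi> (ev x))) v = wev h v * inverse (\<psi> (wev ev v))"
  using v
proof (induction v)
  case Nil
  then show ?case using hom_on_one[OF hom] by simp
next
  case (Cons l v)
  obtain x b where l: "l = (x, b)" by (cases l)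
  let ?c = "\<lambda>x. h x * inverse (\<psi> (ev x))"
  have x: "x \<in> X" and v: "v \<in> words X" using Cons.prems l by auto
  have Sv: "wev ev v \<in> Sym A" using wev_Sym[of v X ev A] v ev by blast
  define g where "g = \<psi> (ev x)"
  define r where "r = \<psi> (wev ev v)"
  define c where "c = wev ?c v"
  have IH: "wev h v = c * r" using Cons.IH v by (simp add: c_def r_def mult.assoc)
  have cr: "cm q' c" if "\<And>x. x \<in> X \<Longrightarrow> cm q' (?c x)" for q'
  proof -
    have "cm q' (wev ?c v2)" if "v2 \<in> words X" for v2
      using that by (induction v2) (auto intro!: cm_mult cm_inverse \<open>\<And>x. x \<in> X \<Longrightarrow> cm q' (?c x)\<close> simp del: inv_mult)
    then show ?thesis using v by (simp add: c_def)
  qed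
  \<comment> \<open>The discrepancy of the tail is a product of central factors for the image of
    \<open>\<psi>\<close>, so \<open>g\<close> can be moved across it; this makes discrepancies
    multiplicative along the word.\<close>
  have gc: "cm g c" unfolding g_def by (rule cr) (use cent ev x in blast)
  then have gc: "c * inverse g = inverse g * c" using cm_inverse2[of g c] by (simp add: cm_def)
  show ?case
  proof (cases b)
    case True
    have "wev h (l # v) * inverse (\<psi> (wev ev (l # v))) = h x * c * r * inverse (g * r)"
      using l True IH hom_onD[OF hom ev[OF x] Sv] by (simp add: g_def r_def mult.assoc)
    also have "\<dots> = h x * (c * inverse g)" by (simp add: mult.assoc)
    also have "\<dots> = h x * inverse g * c" by (simp only: gc mult.assoc)
    also have "\<dots> = wev ?c (l # v)" using l True by (simp add: c_def g_def)
    finally show ?thesis by (simp only:)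
  next
    case False
    have cg: "cm g (?c x)" unfolding g_def using cent[OF x] ev x by blast
    have hx: "h x = ?c x * g" by (simp add: g_def mult.assoc)
    have "wev h (l # v) * inverse (\<psi> (wev ev (l # v))) = inverse (h x) * c * r * inverse (inverse g * r)"
      using l False IH hom_onD[OF hom Sym_inverse[OF ev[OF x]] Sv] hom_on_inverse[OF hom ev[OF x]]
      by (simp add: g_def r_def mult.assoc)
    also have "\<dots> = inverse (h x) * (c * g)" by (simp add: mult.assoc)
    also have "c * g = g * c" using gc by (metis mult.assoc left_inv_assoc right_inv mult_1_right)
    also have "inverse (h x) * (g * c) = inverse (?c x) * c"
    proof -
      have "inverse (?c x) = inverse (h x) * g"
        using cg hx by (metis cm_def inv_mult left_inv_assoc mult.assoc inv_inv)
      then show ?thesis by (simp add: mult.assoc)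
    qed
    finally show ?thesis using l False by (simp add: c_def)
  qed
qed

lemma mult_inverse_eq_1_iff: "g * inverse h = 1 \<longleftrightarrow> g = (h :: 'h::mgroup)"
  using right_cancel[of g "inverse h" h] by simp

definition comm_word :: "nat word \<Rightarrow> nat word \<Rightarrow> nat word" where
  "comm_word v v2 = v @ v2 @ winv (v2 @ v)"

lemma wev_comm_word [simp]: "wev h (comm_word v v2) = 1 \<longleftrightarrow> cm (wev h v) (wev h v2)"
  using mult_inverse_eq_1_iff[of "wev h v * wev h v2" "wev h v2 * wev h v"]
  by (simp add: comm_word_def cm_def mult.assoc)

primrec wUl :: "nat \<Rightarrow> nat \<Rightarrow> bool list \<Rightarrow> nat word" where
  "wUl u a [] = []"
| "wUl u a (b # bs) = (if b then [(u, True)] else []) @ [(a, False)] @ wUl u a bs @ [(a, True)]"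

lemma wev_wUl [simp]: "wev h (wUl u a bs) = Ul (h u) (h a) bs"
  by (induction bs) (simp_all add: cj_def mult.assoc)

lemma length_wUl: "length (wUl u a bs) \<le> 3 * length bs"
  by (induction bs) simp_all

lemma words_wUl: "u \<in> X \<Longrightarrow> a \<in> X \<Longrightarrow> wUl u a bs \<in> words X"
  by (induction bs) simp_all

context gf begin

definition wU :: "nat \<Rightarrow> nat \<Rightarrow> 'k \<Rightarrow> nat word" where
  "wU u a x = wUl u a (bits x)"

definition wHd :: "nat \<Rightarrow> nat \<Rightarrow> nat \<Rightarrow> 'k \<Rightarrow> nat word" where
  "wHd u a w r = [(w, True)] @ wU u a (1 / r) @ [(w, True)] @ wU u a r @ [(w, True)] @ wU u a (1 / r)"

lemma wev_wU [simp]: "wev h (wU u a x) = U (h u) (h a) x"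
  by (simp add: wU_def U_def)

lemma wev_wHd [simp]: "wev h (wHd u a w r) = Hd (h u) (h a) (h w) r"
  by (simp add: wHd_def Hd_def mult.assoc)

definition SL2_words :: "nat \<Rightarrow> nat \<Rightarrow> nat \<Rightarrow> nat word list" where
  "SL2_words u a w =
    (let H = wHd u a w (isqrt (1 + z)) in
     [[(u, True), (u, True)],
      [(w, True), (w, True)],
      [(u, True), (w, True), (u, True), (w, True), (u, True), (w, True)],
      [(w, False), (a, True), (w, True), (a, True)],
      winv H @ [(u, True)] @ H @ winv [(u, True), (a, False), (u, True), (a, True)],
      [(a, True)] @ H @ winv (H @ [(a, True)]),
      replicate k (a, False) @ [(u, True)] @ replicate k (a, True) @ winv (wU u a (z ^ k)),
      [(a, True)] @ winv (wHd u a w (isqrt z))])"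

lemma SL2_words: "(\<forall>r\<in>set (SL2_words u a w). wev h r = 1) \<longleftrightarrow> SL2_rel (h u) (h a) (h w)"
proof -
  have "inverse (h w) * (h a * (h w * h a)) = 1 \<longleftrightarrow> cj (h a) (h w) = inverse (h a)"
    using mult_inverse_eq_1_iff[of "cj (h a) (h w)" "inverse (h a)"] by (simp add: cj_def mult.assoc)
  moreover have "wev h (winv H @ [(u, True)] @ H @ winv [(u, True), (a, False), (u, True), (a, True)]) = 1
      \<longleftrightarrow> cj (h u) (wev h H) = h u * cj (h u) (h a)" for H
    using mult_inverse_eq_1_iff[of "cj (h u) (wev h H)" "h u * cj (h u) (h a)"]
    by (simp add: cj_def mult.assoc winv_Cons winv_def[of "[]"])
  moreover have "wev h ([(a, True)] @ H @ winv (H @ [(a, True)])) = 1 \<longleftrightarrow> cm (h a) (wev h H)" for H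
    using mult_inverse_eq_1_iff[of "h a * wev h H" "wev h H * h a"]
    by (simp add: cm_def mult.assoc)
  moreover have "wev h (replicate k (a, False) @ [(u, True)] @ replicate k (a, True) @ winv H) = 1
      \<longleftrightarrow> cj (h u) (h a ^ k) = wev h H" for H
    using mult_inverse_eq_1_iff[of "cj (h u) (h a ^ k)" "wev h H"] by (simp add: cj_def mult.assoc inv_power)
  moreover have "wev h ([(a, True)] @ winv H) = 1 \<longleftrightarrow> h a = wev h H" for H
    using mult_inverse_eq_1_iff[of "h a" "wev h H"] by simp
  ultimately show ?thesis
    unfolding SL2_words_def SL2_rel_def Let_def
    by (simp del: wev_simps(3) wev_winv append.simps)
       (simp add: power3_eq_cube mult.assoc)
qed

text \<open>Letters: 0 is the transposition \<open>e\<close>, then 1, 2, 3 and 4, 5, 6 are the generators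
  \<open>u, a, w\<close> of the two copies of \<open>SL\<^sub>2\<close>.\<close>

definition base_rel :: "'h::mgroup \<Rightarrow> 'h \<Rightarrow> 'h \<Rightarrow> 'h \<Rightarrow> 'h \<Rightarrow> 'h \<Rightarrow> 'h \<Rightarrow> bool" where
  "base_rel e u a w u' a' w' \<longleftrightarrow> SL2_rel u a w \<and> SL2_rel u' a' w' \<and> e * e = 1 \<and>
     cm e u \<and> cm e a \<and> cm e u' \<and> cm e a' \<and>
     (let E0 = cj e w; E1 = cj e (w * u) in
        e * E0 * e = E0 * e * E0 \<and> cm (e * E0 * e) E1 \<and>
        U u' a' y * w' = a * ((E1 * e * E1) * (E0 * e * E0)))"

definition base_words :: "nat word list" where
  "base_words = SL2_words 1 2 3 @ SL2_words 4 5 6 @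
    (let e = [(0, True)]; E0 = [(3, False), (0, True), (3, True)];
         E1 = [(1, False), (3, False), (0, True), (3, True), (1, True)] in
     [e @ e, comm_word e [(1, True)], comm_word e [(2, True)], comm_word e [(4, True)], comm_word e [(5, True)],
      e @ E0 @ e @ winv (E0 @ e @ E0),
      comm_word (e @ E0 @ e) E1,
      wU 4 5 y @ [(6, True)] @ winv ([(2, True)] @ E1 @ e @ E1 @ E0 @ e @ E0)])"

lemma length_base_words: "length base_words = 24"
  by (simp add: base_words_def SL2_words_def Let_def)

lemma base_words:
  "(\<forall>r\<in>set base_words. wev h r = 1) \<longleftrightarrow> base_rel (h 0) (h 1) (h 2) (h 3) (h 4) (h 5) (h 6)"
proof -
  have 1: "wev h (v @ winv v2) = 1 \<longleftrightarrow> wev h v = wev h v2" for v v2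
    using mult_inverse_eq_1_iff[of "wev h v" "wev h v2"] by simp
  have 2: "wev h [(3, False), (0, True), (3, True)] = cj (h 0) (h 3)"
    "wev h [(1, False), (3, False), (0, True), (3, True), (1, True)] = cj (h 0) (h 3 * h 1)"
    by (simp_all add: cj_def mult.assoc)
  define E0 E1 where "E0 = [(3::nat, False), (0, True), (3, True)]"
    and "E1 = [(1::nat, False), (3, False), (0, True), (3, True), (1, True)]"
  have 3: "wev h E0 = cj (h 0) (h 3)" "wev h E1 = cj (h 0) (h 3 * h 1)"
    using 2 by (simp_all add: E0_def E1_def)
  have 4: "wev h ([(0, True)] @ E0 @ [(0, True)] @ winv (E0 @ [(0, True)] @ E0)) = 1 \<longleftrightarrow>
      h 0 * wev h E0 * h 0 = wev h E0 * h 0 * wev h E0"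
    using 1[of "[(0, True)] @ E0 @ [(0, True)]" "E0 @ [(0, True)] @ E0"] by (simp add: mult.assoc)
  have 5: "wev h (wU 4 5 y @ [(6, True)] @ winv ([(2, True)] @ E1 @ [(0, True)] @ E1 @ E0 @ [(0, True)] @ E0)) = 1 \<longleftrightarrow>
      U (h 4) (h 5) y * h 6 = h 2 * ((wev h E1 * h 0 * wev h E1) * (wev h E0 * h 0 * wev h E0))"
    using 1[of "wU 4 5 y @ [(6, True)]" "[(2, True)] @ E1 @ [(0, True)] @ E1 @ E0 @ [(0, True)] @ E0"]
    by (simp add: mult.assoc)
  have 6: "wev h (comm_word ([(0, True)] @ E0 @ [(0, True)]) E1) = 1 \<longleftrightarrow> cm (h 0 * wev h E0 * h 0) (wev h E1)"
    by (simp add: mult.assoc)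
  have c: "wev h (comm_word [(i, True)] [(j, True)]) = 1 \<longleftrightarrow> cm (h i) (h j)" for i j by simp
  have e: "wev h ([(0, True)] @ [(0, True)]) = h 0 * h 0" by simp
  show ?thesis
    unfolding base_words_def base_rel_def Let_def set_append ball_Un SL2_words
      E0_def[symmetric] E1_def[symmetric] list.set ball_simps 4 5 6 c e 3
    by blast
qed

end

section \<open>The base presentation on \<open>q + 2\<close> points\<close>

text \<open>A pigeonhole argument: the first \<open>Q\<close> iterates already cover the
  \<open>Q\<close> points of \<open>S\<close>, so they are distinct, and period \<open>Q\<close>
  does the rest.\<close>

lemma orbit_mod_iff:
  assumes "finite S" "card S = Q" "0 < Q" "(f ^^ Q) x = x" "\<And>p. p \<in> S \<Longrightarrow> \<exists>n. (f ^^ n) x = p"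
  shows "(f ^^ i) x = (f ^^ j) x \<longleftrightarrow> i mod Q = j mod Q"
proof -
  have m: "(f ^^ (i mod Q)) x = (f ^^ i) x" for i
    using assms(4) by (rule funpow_mod_eq)
  let ?g = "\<lambda>i. (f ^^ i) x"
  have "S \<subseteq> ?g ` {..<Q}"
  proof
    fix p assume "p \<in> S"
    then obtain n where "(f ^^ n) x = p" using assms(5) by blast
    then have "p = ?g (n mod Q)" using m by simp
    then show "p \<in> ?g ` {..<Q}" using assms(3) by auto
  qed
  then have "card S \<le> card (?g ` {..<Q})" by (intro card_mono) auto
  then have "card (?g ` {..<Q}) = card {..<Q}"
    using card_image_le[of "{..<Q}" ?g] assms(2) by simp
  then have "inj_on ?g {..<Q}" by (intro eq_card_imp_inj_on) auto
  then have "?g (i mod Q) = ?g (j mod Q) \<longleftrightarrow> i mod Q = j mod Q"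
    using assms(3) by (auto dest: inj_onD)
  then show ?thesis by (simp only: m)
qed

lemma tr_conj3: "a \<noteq> b \<Longrightarrow> a \<noteq> c \<Longrightarrow> b \<noteq> c \<Longrightarrow> tr a b * tr a c * tr a b = tr b c"
  using cj_tr[of a c "tr a b"] by (simp add: cj_def app_tr)

section \<open>Two cycles of length q + 1 on the projective line\<close>

context gf begin

lemma finite_P1: "finite P1"
  using finite_F by simp

lemma card_P1: "card P1 = 2 ^ k + 1"
proof -
  have "card (Some ` F) = 2 ^ k" by (simp add: card_image card_F)
  then show ?thesis using finite_F by (subst card_insert_disjoint) auto
qed

definition sM :: "'k option \<Rightarrow> 'k option" where
  "sM = mobW \<circ> mobU y"

text \<open>The 3-cycle that sends infinity to 1, 1 to 0 and 0 to infinity.\<close>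

definition w0 :: "'k option \<Rightarrow> 'k option" where
  "w0 = transpose (Some 0) None \<circ> transpose (Some 1) None"

text \<open>Splices 0 and infinity into the cycle of nonzero elements under multiplication by
  \<open>z\<close>: the result runs through infinity, \<open>1\<close>, \<open>z\<close>, up to
  \<open>z ^ (2 ^ k - 2)\<close>, then \<open>0\<close>, and back to infinity.\<close>

definition zM :: "'k option \<Rightarrow> 'k option" where
  "zM = w0 \<circ> mobA z"

lemma transpose_bij: "p \<in> A \<Longrightarrow> q \<in> A \<Longrightarrow> bij_betw (transpose p q) A A"
  by (intro bij_betw_byWitness[of _ "transpose p q"]) (auto simp: transpose_def)

lemma sM_bij: "bij_betw sM P1 P1"
  unfolding sM_def by (rule bij_betw_trans[OF mob_bij(1)[OF y_F] mob_bij(3)])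

lemma w0_bij: "bij_betw w0 P1 P1"
  unfolding w0_def by (rule bij_betw_trans[OF transpose_bij transpose_bij]) (auto simp: F_closed)

lemma zM_bij: "bij_betw zM P1 P1"
  unfolding zM_def by (rule bij_betw_trans[OF mob_bij'(2) w0_bij])

lemma w0_simps [simp]: "w0 None = Some 1" "w0 (Some 1) = Some 0" "w0 (Some 0) = None"
  "v \<noteq> 0 \<Longrightarrow> v \<noteq> 1 \<Longrightarrow> w0 (Some v) = Some v"
  by (simp_all add: w0_def transpose_def)

lemma zM_pow: "n < 2 ^ k - 1 \<Longrightarrow> (zM ^^ Suc n) None = Some (z ^ n)"
proof (induction n)
  case 0
  show ?case by (simp add: zM_def mobA_def)
next
  case (Suc n)
  have "\<not> (2 ^ k - 1) dvd Suc n" using Suc.prems by (auto dest: dvd_imp_le)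
  then have "z ^ Suc n \<noteq> 1" using z_ord by blast
  moreover have "z ^ Suc n \<noteq> 0" using z_nz by simp
  ultimately have w: "w0 (Some (z ^ Suc n)) = Some (z ^ Suc n)" by (intro w0_simps)
  have 1: "(zM ^^ Suc n) None = Some (z ^ n)" using Suc by simp
  have "(zM ^^ Suc (Suc n)) None = zM ((zM ^^ Suc n) None)" by simp
  also have "\<dots> = w0 (Some (z ^ Suc n))"
    unfolding 1 by (simp add: zM_def mobA_def mult.commute)
  finally show ?case by (simp only: w)
qed

lemma zM_0: "(zM ^^ (2 ^ k)) None = Some 0"
proof -
  have q: "2 ^ k = Suc (Suc (2 ^ k - 2))" using q_ge by simp
  have "(zM ^^ (2 ^ k)) None = zM (Some (z ^ (2 ^ k - 2)))"
    by (subst q) (use zM_pow[of "2 ^ k - 2"] q_ge in simp)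
  also have "mobA z (Some (z ^ (2 ^ k - 2))) = Some (z ^ Suc (2 ^ k - 2))"
    by (simp add: mobA_def mult.commute)
  then have "zM (Some (z ^ (2 ^ k - 2))) = w0 (Some (z ^ Suc (2 ^ k - 2)))" by (simp add: zM_def)
  also have "Suc (2 ^ k - 2) = 2 ^ k - 1" using q_ge by simp
  also have "z ^ (2 ^ k - 1) = 1" by (simp only: z_ord dvd_refl)
  finally show ?thesis by simp
qed

lemma zM_Q: "(zM ^^ (2 ^ k + 1)) None = None"
  by (simp add: zM_0) (simp add: zM_def mobA_def)

lemma zM_orbit: "p \<in> P1 \<Longrightarrow> \<exists>n. (zM ^^ n) None = p"
proof -
  assume p: "p \<in> P1"
  consider "p = None" | "p = Some 0" | v where "p = Some v" "v \<in> F" "v \<noteq> 0" using p by auto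
  then show ?thesis
  proof cases
    case 1
    then show ?thesis by (intro exI[of _ 0]) simp
  next
    case 2
    then show ?thesis using zM_0 by blast
  next
    case 3
    then obtain i where i: "v = z ^ i" using z_gen by blast
    let ?m = "2 ^ k - 1 :: nat"
    have z1: "z ^ ?m = 1" by (simp only: z_ord dvd_refl)
    have "z ^ i = z ^ (?m * (i div ?m) + i mod ?m)" by simp
    also have "\<dots> = z ^ (i mod ?m)" by (simp only: power_add power_mult z1 power_one mult_1_left)
    finally have "v = z ^ (i mod ?m)" using i by simp
    moreover have "i mod ?m < ?m" using q_ge by (intro mod_less_divisor) simp
    ultimately show ?thesis using zM_pow[of "i mod ?m"] 3 by blast
  qed
qed

lemma zM_mod: "(zM ^^ i) None = (zM ^^ j) None \<longleftrightarrow> i mod (2 ^ k + 1) = j mod (2 ^ k + 1)"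
  by (rule orbit_mod_iff[OF finite_P1 card_P1 _ zM_Q zM_orbit]) simp_all

lemma sM_orbit: "p \<in> P1 \<Longrightarrow> \<exists>n. (sM ^^ n) None = p"
  unfolding sM_def by (rule circle)

lemma sM_mod: "(sM ^^ i) None = (sM ^^ j) None \<longleftrightarrow> i mod (2 ^ k + 1) = j mod (2 ^ k + 1)"
  by (rule orbit_mod_iff[OF finite_P1 card_P1 _ _ sM_orbit]) (use circle_ord[of None] in \<open>simp_all add: sM_def\<close>)

lemma funpow_P1: "bij_betw f P1 P1 \<Longrightarrow> p \<in> P1 \<Longrightarrow> (f ^^ n) p \<in> P1"
  by (induction n) (use bij_betwE in \<open>fastforce simp del: insert_iff\<close>)+

text \<open>Aligns the torus of order \<open>q + 1\<close> of the second copy with the cycle \<open>zM\<close>, a local modification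
  of the torus of order \<open>q - 1\<close> of the first copy.\<close>

definition kap :: "'k option \<Rightarrow> 'k option" where
  "kap p = (zM ^^ (SOME n. (sM ^^ n) None = p)) None"

lemma kap_pow: "kap ((sM ^^ n) None) = (zM ^^ n) None"
proof -
  have "(sM ^^ (SOME m. (sM ^^ m) None = (sM ^^ n) None)) None = (sM ^^ n) None"
    by (rule someI) simp
  then show ?thesis unfolding kap_def by (simp add: sM_mod zM_mod)
qed

lemma kap_None [simp]: "kap None = None"
  using kap_pow[of 0] by simp

lemma kap_bij: "bij_betw kap P1 P1"
proof -
  have in_P1: "kap p \<in> P1" if "p \<in> P1" for p
    unfolding kap_def by (rule funpow_P1[OF zM_bij]) simp
  have "P1 \<subseteq> kap ` P1"
  proof
    fix p assume "p \<in> P1"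
    then obtain n where "(zM ^^ n) None = p" using zM_orbit by blast
    then have "p = kap ((sM ^^ n) None)" by (simp add: kap_pow)
    moreover have "(sM ^^ n) None \<in> P1" by (rule funpow_P1[OF sM_bij]) simp
    ultimately show "p \<in> kap ` P1" by (rule image_eqI)
  qed
  moreover have "kap ` P1 \<subseteq> P1" by (rule image_subsetI) (rule in_P1)
  ultimately have "kap ` P1 = P1" by (rule equalityI[rotated])
  moreover from this have "inj_on kap P1" by (intro eq_card_imp_inj_on[OF finite_P1]) (simp only:)
  ultimately show ?thesis by (simp only: bij_betw_def)
qed

lemma kap_sM: "p \<in> P1 \<Longrightarrow> kap (sM p) = zM (kap p)"
proof -
  assume "p \<in> P1"
  then obtain n where n: "(sM ^^ n) None = p" using sM_orbit by blast
  then show ?thesis using kap_pow[of n] kap_pow[of "Suc n"] by simp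
qed

abbreviation pe where "pe \<equiv> tr None (Some (None :: 'k option))"
abbreviation pK where "pK \<equiv> onP kap"

lemma onP_w0: "tr (Some None) (Some (Some 1)) * tr (Some None) (Some (Some 0)) = onP w0"
proof (rule prm_eqI)
  fix x :: "'k option option"
  show "app (tr (Some None) (Some (Some 1)) * tr (Some None) (Some (Some 0))) x = app (onP w0) x"
  proof (cases x)
    case None
    then show ?thesis by (simp add: app_tr app_onP[OF w0_bij] transpose_def)
  next
    case (Some p)
    show ?thesis
    proof (cases "p \<in> P1")
      case True
      have "transpose (Some None) (Some (Some 0)) (transpose (Some None) (Some (Some 1)) (Some p)) = Some (w0 p)"
        by (auto simp: w0_def transpose_def)
      then show ?thesis using Some True by (simp only: app_mult app_tr app_onP[OF w0_bij] if_True)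
    next
      case False
      then have "p \<noteq> None" "p \<noteq> Some 0" "p \<noteq> Some 1" by (auto simp: F_closed)
      then have "transpose (Some None) (Some (Some 0)) (transpose (Some None) (Some (Some 1)) (Some p)) = Some p"
        by (simp add: transpose_def)
      then show ?thesis using Some False by (simp only: app_mult app_tr app_onP[OF w0_bij] if_False)
    qed
  qed
qed

lemma onP_z: "pa * onP w0 = onP zM"
  unfolding zM_def by (rule onP_mult[OF mob_bij'(2) w0_bij])

lemma second_torus: "U (cj pu pK) (cj pa pK) y * cj pw pK = onP zM"
proof -
  have "U pu pa y * pw = onP sM"
    using y_F by (simp add: U_onP sM_def onP_mult mob_bij)
  then have "U (cj pu pK) (cj pa pK) y * cj pw pK = cj (onP sM) pK"
    by (simp only: U_conj cj_mult[symmetric])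
  also have "\<dots> = onP zM"
  proof (rule cj_eqI)
    show "onP sM * pK = pK * onP zM"
      unfolding onP_mult[OF sM_bij kap_bij] onP_mult[OF kap_bij zM_bij]
      by (rule onP_eq) (simp only: comp_apply kap_sM)
  qed
  finally show ?thesis .
qed

lemma app_pK [simp]: "app pK None = None" "app pK (Some None) = Some None"
  "app (inverse pK) None = None" "app (inverse pK) (Some None) = Some None"
proof -
  show 1: "app pK None = None" "app pK (Some None) = Some None"
    by (simp_all add: app_onP[OF kap_bij])
  then show "app (inverse pK) None = None" "app (inverse pK) (Some None) = Some None"
    by (simp_all add: app_inv_eq)
qed

lemma base_perms: "base_rel pe pu pa pw (cj pu pK) (cj pa pK) (cj pw pK)"
proof -
  have E0: "cj pe pw = tr None (Some (Some 0))"
    by (simp add: cj_tr app_onP[OF mob_bij(3)] mobW_def)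
  have "cj pe (pw * pu) = cj (cj pe pw) pu" by (simp only: cj_cj)
  also have "\<dots> = tr None (Some (Some 1))"
    unfolding E0 by (simp add: cj_tr app_onP[OF mob_bij'(1)] F_closed) (simp add: mobU_def)
  finally have E1: "cj pe (pw * pu) = tr None (Some (Some 1))" .
  have fix1: "cm pe pu" "cm pe pa"
    by (simp_all add: cm_iff_cj cj_tr app_onP[OF mob_bij'(1)] app_onP[OF mob_bij'(2)])
      (simp_all add: mobU_def mobA_def)
  have "cj pe pK = pe" by (simp add: cj_tr)
  then have fix2: "cm pe (cj pu pK)" "cm pe (cj pa pK)"
    using cm_cj[OF fix1(1), of pK] cm_cj[OF fix1(2), of pK] by simp_all
  have c3: "pe * tr None (Some (Some v)) * pe = tr (Some None) (Some (Some v))" for v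
    by (rule tr_conj3) simp_all
  have c4: "tr None (Some (Some v)) * pe * tr None (Some (Some v)) = tr (Some None) (Some (Some v))" for v
    by (subst tr_sym[of "Some None"]) (rule tr_conj3, simp_all)
  have "cm (tr (Some None) (Some (Some 0))) (tr None (Some (Some (1::'k))))"
    by (simp add: cm_iff_cj cj_tr app_tr)
  then show ?thesis unfolding base_rel_def Let_def E0 E1 c3 c4
    using SL2_perms SL2_rel_cj[OF SL2_perms] fix1 fix2
    by (simp add: second_torus onP_w0 onP_z)
qed

text \<open>From the base triple, powers of \<open>mobA z\<close> carry the third point through all
  nonzero elements and translations move the second point. A finite first point is reached from
  infinity by \<open>mobW\<close> and a translation, both of which are involutions.\<close>

lemma triple_transitive:
  assumes base: "Q None (Some 0) (Some 1)"
    and Us: "\<And>x p q r. x \<in> F \<Longrightarrow> p \<in> P1 \<Longrightarrow> q \<in> P1 \<Longrightarrow> r \<in> P1 \<Longrightarrow> Q p q r \<Longrightarrow> Q (mobU x p) (mobU x q) (mobU x r)"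
    and As: "\<And>p q r. p \<in> P1 \<Longrightarrow> q \<in> P1 \<Longrightarrow> r \<in> P1 \<Longrightarrow> Q p q r \<Longrightarrow> Q (mobA z p) (mobA z q) (mobA z r)"
    and Ws: "\<And>p q r. p \<in> P1 \<Longrightarrow> q \<in> P1 \<Longrightarrow> r \<in> P1 \<Longrightarrow> Q p q r \<Longrightarrow> Q (mobW p) (mobW q) (mobW r)"
    and p: "p \<in> P1" and q: "q \<in> P1" and r: "r \<in> P1" and d: "p \<noteq> q" "p \<noteq> r" "q \<noteq> r"
  shows "Q p q r"
proof -
  have A: "Q None (Some 0) (Some (z ^ i))" for i
  proof (induction i)
    case 0
    then show ?case using base by simp
  next
    case (Suc i)
    then show ?case using As[of None "Some 0" "Some (z ^ i)"] F_closed zpow_F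
      by (simp add: mobA_def mult.commute)
  qed
  have B: "Q None (Some v) (Some v')" if "v \<in> F" "v' \<in> F" "v \<noteq> v'" for v v'
  proof -
    have "v + v' \<noteq> 0" "v + v' \<in> F" using that by (simp_all add: sum_zero_iff F_closed)
    then obtain i where i: "v + v' = z ^ i" using z_gen by blast
    then have "z ^ i + v = v'" using add_self_assoc[of v v'] by (metis add.commute)
    then show ?thesis using Us[OF that(1) _ _ _ A[of i]] F_closed zpow_F by (simp add: mobU_def)
  qed
  have C: "Q None q r" if "q \<in> P1" "r \<in> P1" "q \<noteq> None" "r \<noteq> None" "q \<noteq> r" for q r
    using that B by auto
  show ?thesis
  proof (cases p)
    case None
    then show ?thesis using C q r d by blast
  next
    case (Some v)
    then have v: "v \<in> F" using p by auto
    define q' r' where "q' = mobW (mobU v q)" and "r' = mobW (mobU v r)"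
    have WW: "mobW (mobW p) = p" for p :: "'k option" by (cases p) (auto simp: mobW_def)
    have UU: "mobU v (mobU v p) = p" for p by (cases p) (auto simp: mobU_def add.assoc)
    have mem: "q' \<in> P1" "r' \<in> P1"
      unfolding q'_def r'_def by (intro mob_P1(3) mob_P1(1)[OF v] q r)+
    have "q' \<noteq> None" "r' \<noteq> None" "q' \<noteq> r'"
    proof -
      have "mobW p = None \<longleftrightarrow> p = Some 0" for p :: "'k option" by (cases p) (auto simp: mobW_def)
      moreover have "mobU v p = Some 0 \<longleftrightarrow> p = Some v" for p
        by (cases p) (auto simp: mobU_def sum_zero_iff)
      ultimately show "q' \<noteq> None" "r' \<noteq> None" unfolding q'_def r'_def using d Some by auto
      have "mobU v (mobW q') = q" "mobU v (mobW r') = r" unfolding q'_def r'_def by (simp_all only: WW UU)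
      then show "q' \<noteq> r'" using d by auto
    qed
    then have "Q (mobW None) (mobW q') (mobW r')" by (intro Ws[OF insertI1 mem C[OF mem]])
    then have "Q (mobU v (mobW None)) (mobU v (mobW q')) (mobU v (mobW r'))"
      by (rule Us[OF v mob_P1(3)[OF insertI1] mob_P1(3)[OF mem(1)] mob_P1(3)[OF mem(2)]])
    moreover have "mobU v (mobW None) = Some v" by (simp add: mobU_def mobW_def)
    ultimately show ?thesis unfolding q'_def r'_def using Some by (simp only: WW UU)
  qed
qed

text \<open>Let \<open>s\<close> be the common element. As a power of \<open>a\<close>,
  \<open>s ^ (q - 1)\<close> has multiplier 1, so it squares to 1. As an element of the second copy,
  \<open>s ^ (q + 1)\<close> has a Bruhat form, computed together with the action on the projective
  line; there it acts trivially, so the form is diagonal with multiplier 1 and squares to 1 too.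
  Since \<open>2 (q + 1) = 2 (q - 1) + 4\<close>, the element falls under
  \<open>collapse\<close>.\<close>

lemma shared_torus_trivial:
  assumes "SL2_rel u a w" "SL2_rel u' a' w'" and eq: "U u' a' y * w' = (a :: 'h::mgroup)"
  shows "u = 1 \<and> a = 1 \<and> w = 1 \<and> u' = 1 \<and> a' = 1 \<and> w' = 1"
proof -
  interpret T: sl2 F z y k u a w by unfold_locales (rule assms(1))
  interpret T': sl2 F z y k u' a' w' by unfold_locales (rule assms(2))
  interpret P: sl2 F z y k "(u', pu)" "(a', pa)" "(w', pw)"
    by unfold_locales (rule SL2_rel_pair[OF assms(2) SL2_perms])
  have Upair: "U (u', pu) (a', pa) x = (U u' a' x, U pu pa x)" for x
    by (simp add: U_def Ul_pair)
  let ?s = "U u' a' y * w'" and ?q = "2 ^ k :: nat"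
  have "z ^ (?q - 1) = 1" by (simp only: z_ord dvd_refl)
  then have "a ^ (?q - 1) * a ^ (?q - 1) = 1"
    using T.diag_one[of "a ^ (?q - 1)"] T.diag_pow[of "?q - 1"] by simp
  moreover have "2 * ?q - 2 = (?q - 1) + (?q - 1)" by simp
  ultimately have s1: "?s ^ (2 * ?q - 2) = 1" by (simp only: eq power_add)
  have sp: "(U pu pa y * pw) ^ n = onP (sM ^^ n)" for n
  proof (induction n)
    case 0
    show ?case by (simp add: onP_id)
  next
    case (Suc n)
    have b: "bij_betw (sM ^^ n) P1 P1"
    proof (induction n)
      case 0
      show ?case unfolding funpow.simps by (rule bij_betw_id)
    next
      case (Suc n)
      show ?case unfolding funpow.simps by (rule bij_betw_trans[OF Suc sM_bij])
    qed
    have "U pu pa y * pw = onP sM" using y_F by (simp add: U_onP sM_def onP_mult mob_bij)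
    then show ?case using Suc by (simp only: power_Suc2 onP_mult[OF b sM_bij] funpow.simps)
  qed
  have "onP (sM ^^ (?q + 1)) = 1"
    by (rule onP_id) (use circle_ord in \<open>simp only: sM_def\<close>)
  then have sp1: "(U pu pa y * pw) ^ (?q + 1) = 1" by (simp only: sp)
  have "P.bruhat ((U (u', pu) (a', pa) y * (w', pw)) ^ (?q + 1))"
    by (rule P.bruhat_power[OF y_F])
  then obtain x A t where x: "x \<in> F" and A: "P.diag A t"
    and cases: "(?s ^ (?q + 1), 1) = U (u', pu) (a', pa) x * A \<or>
      (\<exists>c\<in>F. (?s ^ (?q + 1), 1) = U (u', pu) (a', pa) x * (w', pw) * A * U (u', pu) (a', pa) c)"
    unfolding P.bruhat_def Upair prod_mgroup power_pair sp1 by blast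
  obtain i j where Aij: "A = (a', pa) ^ i * inverse ((a', pa) ^ j)" and t: "t = z ^ i / z ^ j"
    using A by (auto simp: P.diag_def)
  define A1 A2 where "A1 = a' ^ i * inverse (a' ^ j)" and "A2 = pa ^ i * inverse (pa ^ j)"
  have AA: "A = (A1, A2)" unfolding Aij A1_def A2_def by (simp only: power_pair prod_mgroup)
  have t0: "t \<in> F" "t \<noteq> 0" using P.diag_F[OF A] by auto
  have A2: "A2 = onP (mobA t)"
  proof -
    have "onP (mobA t) * pa ^ j = pa ^ i"
      unfolding pa_power onP_mult[OF mob_bij(2)[OF t0] mob_bij(2)[OF zpow_F power_not_zero[OF z_nz]]]
      by (rule onP_eq) (auto simp: mobA_def t z_nz)
    then have "pa ^ i * inverse (pa ^ j) = onP (mobA t) * pa ^ j * inverse (pa ^ j)" by (simp only:)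
    then show ?thesis by (simp add: A2_def mult.assoc)
  qed
  note app = app_onP(2)[OF mob_bij(1)[OF x]] app_onP(2)[OF mob_bij(2)[OF t0]] app_onP(2)[OF mob_bij(3)]
  from cases have "x = 0 \<and> t = 1 \<and> ?s ^ (?q + 1) = U u' a' x * A1"
  proof
    assume "(?s ^ (?q + 1), 1) = U (u', pu) (a', pa) x * A"
    \<comment> \<open>Testing the trivial second coordinate at the points 0 and 1 gives
      \<open>x = 0\<close> and \<open>t = 1\<close>, and the same parameters occur in the first
      coordinate.\<close>
    then have h: "?s ^ (?q + 1) = U u' a' x * A1" and p: "1 = onP (mobU x) * onP (mobA t)"
      unfolding Upair AA prod_mgroup by (auto simp: U_onP[OF x] A2)
    have "mobA t (mobU x (Some v)) = Some v" if "v \<in> F" for v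
    proof -
      have 1: "Some v \<in> P1" "mobU x (Some v) \<in> P1"
        using that mob_P1(1)[OF x] by blast+
      have "app 1 (Some (Some v)) = Some (mobA t (mobU x (Some v)))"
        unfolding p by (simp only: app_mult app 1 if_True)
      then show ?thesis by simp
    qed
    from this[of 0] this[of 1] have "x * t = 0" "(1 + x) * t = 1"
      using F_closed by (simp_all add: mobA_def mobU_def)
    then show ?thesis using h t0 by simp
  next
    assume "\<exists>c\<in>F. (?s ^ (?q + 1), 1) = U (u', pu) (a', pa) x * (w', pw) * A * U (u', pu) (a', pa) c"
    then obtain c where c: "c \<in> F" and p: "1 = onP (mobU x) * pw * onP (mobA t) * onP (mobU c)"
      unfolding Upair AA prod_mgroup by (auto simp: U_onP[OF x] U_onP A2)
    \<comment> \<open>A form from the big cell would move infinity to the finite point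
      \<open>c\<close>, whereas the second coordinate is the identity.\<close>
    have 1: "mobU x None = None" "mobW None = Some (0::'k)" "mobA t (Some 0) = Some 0" "mobU c (Some 0) = Some c"
      by (simp_all add: mobU_def mobA_def mobW_def)
    have 2: "None \<in> P1" "Some 0 \<in> P1" using F_closed(1) by blast+
    have "app 1 (Some None) = Some (Some c)"
      unfolding p by (simp only: app_mult app app_onP(2)[OF mob_bij(1)[OF c]] 1 2 if_True)
    then show ?thesis by simp
  qed
  then have "T'.diag (?s ^ (?q + 1)) 1"
    using t by (auto simp: T'.U_0 T'.diag_def A1_def)
  then have "?s ^ (?q + 1) * ?s ^ (?q + 1) = 1" by (rule T'.diag_one)
  moreover have "(2 * ?q - 2) + 4 = (?q + 1) + (?q + 1)" using q_ge by simp
  ultimately have "?s ^ ((2 * ?q - 2) + 4) = 1" by (simp only: power_add)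
  then have "?s ^ 4 = 1" by (simp only: power_add s1 mult_1_left)
  then have T': "u' = 1 \<and> a' = 1 \<and> w' = 1" by (rule T'.collapse[OF y_F y_nz])
  have "Ul 1 (1::'h) bs = 1" for bs by (induction bs) simp_all
  then have "a = 1" using eq T' by (simp add: U_def)
  then show ?thesis using T' T.collapse_a by blast
qed

definition base_ev :: "nat \<Rightarrow> 'k option option prm" where
  "base_ev i = [pe, pu, pa, pw, cj pu pK, cj pa pK, cj pw pK] ! i"

lemma base_ev_simps [simp]: "base_ev 0 = pe" "base_ev 1 = pu" "base_ev (Suc 0) = pu" "base_ev 2 = pa" "base_ev 3 = pw"
  "base_ev 4 = cj pu pK" "base_ev 5 = cj pa pK" "base_ev 6 = cj pw pK"
  by (simp_all add: base_ev_def)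

abbreviation Pts :: "'k option option set" where
  "Pts \<equiv> insert None (Some ` P1)"

lemma onP_Sym_Pts: "bij_betw f P1 P1 \<Longrightarrow> onP f \<in> Sym Pts"
  using onP_Sym[of f] Sym_mono[OF subset_insertI] by (rule subsetD[rotated])

lemma base_ev_Sym: "i < 7 \<Longrightarrow> base_ev i \<in> Sym Pts"
proof -
  note m = mob_bij'[THEN onP_Sym_Pts] kap_bij[THEN onP_Sym_Pts]
  have e: "pe \<in> Sym Pts" by (intro Sym_tr insertI1 insertI2 imageI)
  assume "i < 7"
  then have "i \<in> {0, 1, 2, 3, 4, 5, 6}" by auto
  then show ?thesis using m e Sym_cj[OF m(1) m(4)] Sym_cj[OF m(2) m(4)] Sym_cj[OF m(3) m(4)]
    by (elim insertE) (simp_all only: base_ev_simps empty_iff)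
qed

lemma base_ev_rel: "r \<in> set base_words \<Longrightarrow> wev base_ev r = 1"
  using base_words[of base_ev] base_perms by simp

lemma base_words_words: "r \<in> set base_words \<Longrightarrow> r \<in> words {..<7}"
proof -
  have U: "wU u a x \<in> words {..<7}" if "u < 7" "a < 7" for u a x
    using that by (simp add: wU_def words_wUl)
  then have H: "wHd u a w x \<in> words {..<7}" if "u < 7" "a < 7" "w < 7" for u a w x
    using that by (simp add: wHd_def)
  show "r \<in> set base_words \<Longrightarrow> r \<in> words {..<7}"
    unfolding base_words_def SL2_words_def Let_def comm_word_def
    by (auto simp: U H)
qed

text \<open>The star relations are preserved by conjugation, and the letters permute the star like
  the projective maps, so \<open>triple_transitive\<close> carries the single instance in
  \<open>base_rel\<close> to all triples.\<close>

lemma star_relations: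
  assumes rel: "base_rel e u a w u' a' w'"
  defines "E \<equiv> star u a w (e :: 'h::mgroup)"
  shows "\<exists>\<psi>. hom_on Pts \<psi> \<and> (\<forall>p\<in>P1. \<psi> (tr None (Some p)) = E p)"
proof -
  interpret T: sl2 F z y k u a w by unfold_locales (use rel in \<open>simp add: base_rel_def\<close>)
  have eu: "cm e u" and ea: "cm e a" and ee: "e * e = 1" using rel by (simp_all add: base_rel_def)
  have E01: "E None = e" "E (Some 0) = cj e w" "E (Some 1) = cj e (w * u)"
    by (simp_all add: E_def T.U_0 T.U_1)
  have EU: "cj (E p) (T.V x) = E (mobU x p)" if "x \<in> F" "p \<in> P1" for x p
    unfolding E_def by (rule T.star_U[OF eu ea that])
  have Ea: "cj (E p) a = E (mobA z p)" if "p \<in> P1" for p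
    unfolding E_def by (rule T.star_a[OF eu ea that])
  have Ew: "cj (E p) w = E (mobW p)" if "p \<in> P1" for p
    unfolding E_def by (rule T.star_w[OF eu ea that])
  define Q where "Q p q r \<longleftrightarrow> E p * E q * E p = E q * E p * E q \<and> cm (E p * E q * E p) (E r)" for p q r
  have base: "Q None (Some 0) (Some 1)"
    using rel unfolding Q_def E01 base_rel_def Let_def by blast
  have inv: "Q p' q' r'" if "Q p q r" "cj (E p) g = E p'" "cj (E q) g = E q'" "cj (E r) g = E r'" for p q r p' q' r' g
    using that(1) unfolding Q_def that(2-4)[symmetric] cj_mult[symmetric] cj_eq_iff cm_cj_iff by blast
  have Q: "Q p q r" if "p \<in> P1" "q \<in> P1" "r \<in> P1" "p \<noteq> q" "p \<noteq> r" "q \<noteq> r" for p q r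
  proof (rule triple_transitive[of Q, OF base _ _ _ that])
    show "Q (mobU x p) (mobU x q) (mobU x r)" if "x \<in> F" "p \<in> P1" "q \<in> P1" "r \<in> P1" "Q p q r" for x p q r
      by (rule inv[OF that(5) EU[OF that(1,2)] EU[OF that(1,3)] EU[OF that(1,4)]])
    show "Q (mobA z p) (mobA z q) (mobA z r)" if "p \<in> P1" "q \<in> P1" "r \<in> P1" "Q p q r" for p q r
      by (rule inv[OF that(4) Ea[OF that(1)] Ea[OF that(2)] Ea[OF that(3)]])
    show "Q (mobW p) (mobW q) (mobW r)" if "p \<in> P1" "q \<in> P1" "r \<in> P1" "Q p q r" for p q r
      by (rule inv[OF that(4) Ew[OF that(1)] Ew[OF that(2)] Ew[OF that(3)]])
  qed
  show ?thesis
  proof (rule star_hom[OF finite_P1])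
    show "E p * E p = 1" for p
      using ee unfolding E_def star_def by (simp split: option.split flip: cj_mult)
    show "E p * E q * E p = E q * E p * E q" if "p \<in> P1" "q \<in> P1" "p \<noteq> q" for p q
    proof -
      \<comment> \<open>\<open>Q\<close> ties the braid relation to a triple, so a third point has
        to be supplied; among three points one is distinct from \<open>p\<close> and
        \<open>q\<close>.\<close>
      have "\<exists>r\<in>{None, Some 0, Some (1::'k)}. r \<noteq> p \<and> r \<noteq> q" by auto
      moreover have "{None, Some 0, Some (1::'k)} \<subseteq> P1" using F_closed by auto
      ultimately obtain r where "r \<in> P1" "r \<noteq> p" "r \<noteq> q" by blast
      then have "Q p q r" using that by (intro Q) auto
      then show ?thesis by (simp add: Q_def)
    qed
    show "cm (E p * E q * E p) (E r)" if "p \<in> P1" "q \<in> P1" "r \<in> P1" "p \<noteq> q" "p \<noteq> r" "q \<noteq> r" for p q r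
      using Q[OF that] unfolding Q_def by blast
  qed
qed

text \<open>The homomorphism \<open>\<psi>\<close> is built from the star of \<open>e\<close> alone.
  A letter and the image of its permutation conjugate this star in the same way, and the star
  generates the image of \<open>\<psi>\<close>, so their quotient centralises the image;
  \<open>wev_discrepancy\<close> then applies, and \<open>shared_torus_trivial\<close> removes the
  quotients.\<close>

lemma base_universal:
  fixes h :: "nat \<Rightarrow> 'h::mgroup"
  assumes h: "\<And>r. r \<in> set base_words \<Longrightarrow> wev h r = 1"
  shows "\<exists>\<psi>. hom_on Pts \<psi> \<and> (\<forall>i<7. \<psi> (base_ev i) = h i)"
proof -
  define e u a w u' a' w' where "e = h 0" and "u = h 1" and "a = h 2" and "w = h 3"
    and "u' = h 4" and "a' = h 5" and "w' = h 6"
  note hdefs = this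
  have rel: "base_rel e u a w u' a' w'" unfolding hdefs using h base_words[of h] by blast
  define E where "E = star u a w e"
  define E' where "E' = star u' a' w' e"
  obtain \<psi> where \<psi>: "hom_on Pts \<psi>" and \<psi>E: "\<And>p. p \<in> P1 \<Longrightarrow> \<psi> (tr None (Some p)) = E p"
    using star_relations[OF rel] unfolding E_def by blast
  interpret T: sl2 F z y k u a w by unfold_locales (use rel in \<open>simp add: base_rel_def\<close>)
  interpret T': sl2 F z y k u' a' w' by unfold_locales (use rel in \<open>simp add: base_rel_def\<close>)
  have eu: "cm e u" "cm e a" "cm e u'" "cm e a'" using rel by (simp_all add: base_rel_def)
  have None_P1: "None \<in> P1" by (rule insertI1)
  have trS: "tr None (Some p) \<in> Sym Pts" if "p \<in> P1" for p
    by (rule Sym_tr[OF insertI1 insertI2[OF imageI[OF that]]])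
  have hom3: "\<psi> (P * R * P) = \<psi> P * \<psi> R * \<psi> P" if "P \<in> Sym Pts" "R \<in> Sym Pts" for P R
    by (simp only: hom_onD[OF \<psi> Sym_mult[OF that] that(1)] hom_onD[OF \<psi> that])
  have \<psi>cj: "cj (E p) (\<psi> P) = E p'"
    if "p \<in> P1" "P \<in> Sym Pts" "app P None = None" "app P (Some p) = Some p'" "p' \<in> P1" for p P p'
    using hom_on_cj[OF \<psi> trS[OF that(1)] that(2)] that \<psi>E by (simp only: cj_tr)
  have Ea: "cj (E p) a = E (mobA z p)" if "p \<in> P1" for p
    unfolding E_def by (rule T.star_a[OF eu(1,2) that])
  define om where "om = (E (Some 1) * e * E (Some 1)) * (E (Some 0) * e * E (Some 0))"
  have SF: "Some 0 \<in> P1" "Some 1 \<in> P1" using F_closed by auto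
  have om: "om = \<psi> (onP w0)"
  proof -
    have *: "E p * e * E p = \<psi> (tr (Some None) (Some p))" if "p \<in> P1" "p \<noteq> None" for p
    proof -
      have "tr (Some None) (Some p) = tr None (Some p) * tr None (Some None) * tr None (Some p)"
        using that by (subst tr_sym[of "Some None"]) (rule tr_conj3[symmetric], simp_all)
      moreover have "E None = e" by (simp add: E_def)
      ultimately show ?thesis
        using hom3[OF trS[OF that(1)] trS[OF None_P1]] by (simp only: \<psi>E[OF that(1)] \<psi>E[OF None_P1])
    qed
    have "\<psi> (onP w0) = \<psi> (tr (Some None) (Some (Some 1))) * \<psi> (tr (Some None) (Some (Some 0)))"
      unfolding onP_w0[symmetric]
      by (rule hom_onD[OF \<psi> Sym_tr[OF insertI2[OF imageI[OF None_P1]] insertI2[OF imageI[OF SF(2)]]]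
            Sym_tr[OF insertI2[OF imageI[OF None_P1]] insertI2[OF imageI[OF SF(1)]]]])
    then show ?thesis unfolding om_def by (simp only: *[OF SF(1)] *[OF SF(2)] option.distinct not_False_eq_True)
  qed
  have ident: "T'.V y * w' = a * om"
    using rel unfolding base_rel_def om_def Let_def E_def by (simp add: T.U_0 T.U_1)
  have Ew0: "cj (E p) om = E (w0 p)" if "p \<in> P1" for p
    unfolding om
  proof (rule \<psi>cj[OF that onP_Sym_Pts[OF w0_bij] app_onP(1)[OF w0_bij]])
    show "app (onP w0) (Some p) = Some (w0 p)" using that by (simp only: app_onP[OF w0_bij] if_True)
    show "w0 p \<in> P1" using bij_betwE[OF w0_bij] that by (rule bspec)
  qed
  have EzM: "cj (E p) (a * om) = E (zM p)" if "p \<in> P1" for p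
    by (simp only: cj_cj[symmetric] Ea[OF that] Ew0[OF mob_P1(2)[OF that]] zM_def comp_apply)
  have EzM_pow: "cj e ((a * om) ^ n) = E ((zM ^^ n) None)" for n
  proof (induction n)
    case 0
    then show ?case by (simp add: E_def)
  next
    case (Suc n)
    have "cj e ((a * om) ^ Suc n) = cj (cj e ((a * om) ^ n)) (a * om)"
      by (simp only: power_Suc2 cj_cj)
    then show ?case using Suc EzM[OF funpow_P1[OF zM_bij None_P1, of n]] by (simp only: funpow.simps comp_apply)
  qed
  have E'sM: "cj (E' p) (T'.V y * w') = E' (sM p)" if "p \<in> P1" for p
    using that T'.star_U[OF eu(3,4) y_F that] T'.star_w[OF eu(3,4) mob_P1(1)[OF y_F that]]
    by (simp add: E'_def sM_def flip: cj_cj)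
  have E'_pow: "cj e ((T'.V y * w') ^ n) = E' ((sM ^^ n) None)" for n
  proof (induction n)
    case 0
    then show ?case by (simp add: E'_def)
  next
    case (Suc n)
    have "cj e ((T'.V y * w') ^ Suc n) = cj (cj e ((T'.V y * w') ^ n)) (T'.V y * w')"
      by (simp only: power_Suc2 cj_cj)
    then show ?case using Suc E'sM[OF funpow_P1[OF sM_bij None_P1, of n]] by (simp only: funpow.simps comp_apply)
  qed
  \<comment> \<open>Each star is the orbit of \<open>e\<close> under one cyclic element, acting as
    \<open>sM\<close> on the indices of \<open>E'\<close> and as \<open>zM\<close> on those of
    \<open>E\<close>. The last base relation says that the two elements coincide, and
    \<open>kap\<close> matches the indices.\<close>
  have E'E: "E' p = E (kap p)" if "p \<in> P1" for p
  proof -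
    from sM_orbit[OF that] obtain n where n: "(sM ^^ n) None = p" ..
    show ?thesis using E'_pow[of n] EzM_pow[of n] unfolding ident n kap_pow[of n, unfolded n] by simp
  qed
  have acts: "cm (\<psi> q) (g * inverse (\<psi> P))"
    if q: "q \<in> Sym Pts" and P: "P \<in> Sym Pts" "app P None = None"
      and g: "\<And>p. p \<in> P1 \<Longrightarrow> \<exists>p'\<in>P1. app P (Some p) = Some p' \<and> cj (E p) g = E p'" for q g P
  proof -
    \<comment> \<open>It is enough to centralise the star transpositions, since they generate the
      image of \<open>\<psi>\<close>.\<close>
    have c1: "cm (E p) (g * inverse (\<psi> P))" if p: "p \<in> P1" for p
    proof -
      obtain p' where p': "p' \<in> P1" "app P (Some p) = Some p'" "cj (E p) g = E p'" using g[OF p] by blast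
      have "cj (E p) g = cj (E p) (\<psi> P)" using \<psi>cj[OF p P p'(2,1)] p'(3) by simp
      then have "cj (E p) (g * inverse (\<psi> P)) = cj (cj (E p) (\<psi> P)) (inverse (\<psi> P))"
        by (simp only: cj_cj[symmetric])
      then show ?thesis by (simp add: cm_iff_cj cj_cj)
    qed
    have c2: "cm (\<psi> (tr r s)) (g * inverse (\<psi> P))" if "r \<in> Pts" "s \<in> Pts" "r \<noteq> s" for r s
    proof -
      have *: "cm (\<psi> (tr None (Some p))) (g * inverse (\<psi> P))" if "p \<in> P1" for p
        using c1[OF that] \<psi>E[OF that] by simp
      note rs = that
      show ?thesis
      proof (cases "r = None \<or> s = None")
        case True
        then obtain p where p: "p \<in> P1" "r = None \<and> s = Some p \<or> s = None \<and> r = Some p"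
          using rs by blast
        have "tr r s = tr None (Some p)" using p(2)
        proof
          assume "s = None \<and> r = Some p"
          then show ?thesis using tr_sym[of "Some p" None] by simp
        qed simp
        then show ?thesis by (simp only: *[OF p(1)])
      next
        case False
        then obtain p p' where pp: "r = Some p" "s = Some p'" "p \<in> P1" "p' \<in> P1" "p \<noteq> p'"
          using rs by blast
        have "tr r s = tr None (Some p) * tr None (Some p') * tr None (Some p)"
          unfolding pp(1,2) by (rule tr_conj3[symmetric]) (use pp in auto)
        then have "\<psi> (tr r s) = \<psi> (tr None (Some p)) * \<psi> (tr None (Some p')) * \<psi> (tr None (Some p))"
          by (simp only: hom3[OF trS[OF pp(3)] trS[OF pp(4)]])
        then show ?thesis using *[OF pp(3)] *[OF pp(4)] by (simp only: cm_mult2)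
      qed
    qed
    have "finite Pts" using finite_P1 by simp
    then show ?thesis using q
    proof (induction rule: Sym_induct)
      case one
      then show ?case using hom_on_one[OF \<psi>] by simp
    next
      case (step p r s)
      then show ?case using c2[OF step(2-4)] hom_onD[OF \<psi> step(1) Sym_tr[OF step(2,3)]] by (simp only: cm_mult2)
    qed
  qed
  have T_acts: "cm (\<psi> q) (g * inverse (\<psi> (onP m)))"
    if q: "q \<in> Sym Pts" and m: "bij_betw m P1 P1" and g: "\<And>p. p \<in> P1 \<Longrightarrow> cj (E p) g = E (m p)" for q g m
  proof (rule acts[OF q onP_Sym_Pts[OF m]])
    show "app (onP m) None = None" by (rule app_onP[OF m])
    show "\<exists>p'\<in>P1. app (onP m) (Some p) = Some p' \<and> cj (E p) g = E p'" if p: "p \<in> P1" for p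
    proof (rule bexI[of _ "m p"])
      show "app (onP m) (Some p) = Some (m p) \<and> cj (E p) g = E (m p)"
        using p by (simp only: app_onP[OF m] if_True g simp_thms)
      show "m p \<in> P1" using bij_betwE[OF m] p by (rule bspec)
    qed
  qed
  have T'_acts: "cm (\<psi> q) (g * inverse (\<psi> (cj (onP m) pK)))"
    if "q \<in> Sym Pts" and m: "bij_betw m P1 P1" and g: "\<And>p. p \<in> P1 \<Longrightarrow> cj (E' p) g = E' (m p)" for q g m
  proof (rule acts[OF that(1)])
    show "cj (onP m) pK \<in> Sym Pts" by (rule Sym_cj[OF onP_Sym_Pts[OF m] onP_Sym_Pts[OF kap_bij]])
    show "app (cj (onP m) pK) None = None" by (simp add: cj_def app_onP[OF m])
    show "\<exists>p'\<in>P1. app (cj (onP m) pK) (Some p) = Some p' \<and> cj (E p) g = E p'" if p: "p \<in> P1" for p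
    proof -
      have "p \<in> kap ` P1" using p kap_bij by (simp only: bij_betw_def)
      then obtain r where r: "p = kap r" "r \<in> P1" by (rule imageE)
      have mr: "m r \<in> P1" using bij_betwE[OF m] r(2) by (rule bspec)
      have kmr: "kap (m r) \<in> P1" using bij_betwE[OF kap_bij] mr by (rule bspec)
      have "app (inverse pK) (Some p) = Some r"
        unfolding app_inv_eq using r by (simp only: app_onP[OF kap_bij] if_True)
      then have "app (cj (onP m) pK) (Some p) = Some (kap (m r))"
        using r mr by (simp only: cj_def app_mult app_onP[OF kap_bij] app_onP[OF m] if_True)
      moreover have "cj (E p) g = E (kap (m r))"
        using g[OF r(2)] by (simp only: r(1) E'E[OF r(2), symmetric] E'E[OF mr, symmetric])
      ultimately show ?thesis using kmr by blast
    qed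
  qed
  have cent: "cm (\<psi> q) (h i * inverse (\<psi> (base_ev i)))" if "i < 7" "q \<in> Sym Pts" for i q
  proof -
    have "i \<in> {0, 1, 2, 3, 4, 5, 6}" using that by auto
    then consider "i = 0" | "i = 1" | "i = 2" | "i = 3" | "i = 4" | "i = 5" | "i = 6" by blast
    then show ?thesis
    proof cases
      case 1
      then show ?thesis using \<psi>E[OF None_P1] by (simp add: E_def e_def)
    next
      case 2
      have "cm (\<psi> q) (u * inverse (\<psi> pu))"
        by (rule T_acts[OF that(2) mob_bij'(1)]) (unfold E_def, rule T.star_u[OF eu(1,2)])
      then show ?thesis using 2 by (simp add: u_def)
    next
      case 3
      have "cm (\<psi> q) (a * inverse (\<psi> pa))"
        by (rule T_acts[OF that(2) mob_bij'(2)]) (unfold E_def, rule T.star_a[OF eu(1,2)])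
      then show ?thesis using 3 by (simp add: a_def)
    next
      case 4
      have "cm (\<psi> q) (w * inverse (\<psi> pw))"
        by (rule T_acts[OF that(2) mob_bij'(3)]) (unfold E_def, rule T.star_w[OF eu(1,2)])
      then show ?thesis using 4 by (simp add: w_def)
    next
      case 5
      have "cm (\<psi> q) (u' * inverse (\<psi> (cj pu pK)))"
        by (rule T'_acts[OF that(2) mob_bij'(1)]) (unfold E'_def, rule T'.star_u[OF eu(3,4)])
      then show ?thesis using 5 by (simp add: u'_def)
    next
      case 6
      have "cm (\<psi> q) (a' * inverse (\<psi> (cj pa pK)))"
        by (rule T'_acts[OF that(2) mob_bij'(2)]) (unfold E'_def, rule T'.star_a[OF eu(3,4)])
      then show ?thesis using 6 by (simp add: a'_def)
    next
      case 7
      have "cm (\<psi> q) (w' * inverse (\<psi> (cj pw pK)))"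
        by (rule T'_acts[OF that(2) mob_bij'(3)]) (unfold E'_def, rule T'.star_w[OF eu(3,4)])
      then show ?thesis using 7 by (simp add: w'_def)
    qed
  qed
  define c where "c i = h i * inverse (\<psi> (base_ev i))" for i
  have "wev c r = 1" if r: "r \<in> set base_words" for r
  proof -
    have "wev c r = wev h r * inverse (\<psi> (wev base_ev r))"
      unfolding c_def
      by (rule wev_discrepancy[OF base_words_words[OF r] _ \<psi>]) (use base_ev_Sym cent in auto)
    then show ?thesis using h[OF r] base_ev_rel[OF r] hom_on_one[OF \<psi>] by simp
  qed
  then have rc: "base_rel (c 0) (c 1) (c 2) (c 3) (c 4) (c 5) (c 6)" using base_words by blast
  \<comment> \<open>\<open>\<psi>\<close> hits \<open>e\<close> exactly, so the relations among the
    quotients lose all transpositions and the last one becomes a mere identification of the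
    tori.\<close>
  have c0: "c 0 = 1" using \<psi>E[OF None_P1] by (simp add: c_def E_def e_def)
  have "U (c 4) (c 5) y * c 6 = c 2"
    using rc unfolding base_rel_def c0 Let_def by simp
  then have "c 1 = 1 \<and> c 2 = 1 \<and> c 3 = 1 \<and> c 4 = 1 \<and> c 5 = 1 \<and> c 6 = 1"
    using rc unfolding base_rel_def by (intro shared_torus_trivial) blast+
  then have "c i = 1" if "i < 7" for i
  proof -
    have "i \<in> {0, 1, 2, 3, 4, 5, 6}" using that by auto
    then show ?thesis using c0 \<open>c 1 = 1 \<and> _\<close> by (elim insertE) simp_all
  qed
  then have "\<psi> (base_ev i) = h i" if "i < 7" for i
    using that mult_inverse_eq_1_iff[of "h i" "\<psi> (base_ev i)"] by (simp add: c_def)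
  then show ?thesis using \<psi> by blast
qed

end

section \<open>Existence of the field\<close>

text \<open>In characteristic 2 an odd \<open>N\<close> is 1 in the field, so the derivative of
  \<open>X ^ N - 1\<close> vanishes only at 0, which is not a root. Hence the \<open>N\<close>
  linear factors are distinct.\<close>

lemma card_roots_of_unity:
  assumes char2: "\<And>x::'a::alg_closed_field. x + x = 0" and N: "odd N"
  shows "card {x::'a. x ^ N = 1} = N"
proof -
  define p :: "'a poly" where "p = Polynomial.monom 1 N - 1"
  have px: "poly p x = x ^ N - 1" for x by (simp add: p_def poly_monom)
  have N0: "N \<noteq> 0" using N odd_pos[of N] by simp
  have deg: "degree p = N"
    using degree_add_eq_left[of "- 1" "Polynomial.monom (1::'a) N"] N0 by (simp add: p_def degree_monom_eq)
  then have p0: "p \<noteq> 0" using N0 by auto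
  obtain A where A: "size A = N" "p = smult (lead_coeff p) (\<Prod>x\<in>#A. [:-x, 1:])"
    using alg_closed_imp_factorization[OF p0] deg by auto
  have roots: "x \<in># A \<longleftrightarrow> x ^ N = 1" for x
  proof -
    have "poly p x = 0 \<longleftrightarrow> x \<in># A"
      by (subst A(2)) (use p0 in \<open>auto simp: poly_prod_mset prod_mset_zero_iff image_iff\<close>)
    then show ?thesis by (simp add: px)
  qed
  have "count A x = 1" if x: "x \<in># A" for x
  proof (rule ccontr)
    assume "count A x \<noteq> 1"
    obtain B where B: "A = add_mset x B" using x by (rule mset_add)
    then have "x \<in># B" using \<open>count A x \<noteq> 1\<close> by (simp flip: count_greater_zero_iff)
    then obtain D where D: "B = add_mset x D" by (rule mset_add)
    define r where "r = smult (lead_coeff p) (\<Prod>x\<in>#D. [:-x, 1:])"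
    have "p = [:-x, 1:] * ([:-x, 1:] * r)"
      unfolding r_def by (subst A(2)) (simp only: B D image_mset_add_mset prod_mset.add_mset mult_smult_right)
    then have r: "p = [:-x, 1:] * ([:-x, 1:] * r)" .
    have "poly (pderiv p) x = 0" unfolding r pderiv_mult by simp
    moreover have "poly (pderiv p) x = of_nat N * x ^ (N - 1)"
      by (simp add: p_def pderiv_diff pderiv_monom poly_monom)
    moreover have "of_nat N = (1::'a)"
    proof -
      obtain i where "N = 2 * i + 1" using N by (rule oddE)
      then show ?thesis using char2[of "of_nat i"] by (simp flip: mult_2)
    qed
    ultimately have "x = 0" by simp
    then show False using x roots[of x] N0 by (simp add: power_0_left)
  qed
  then have "size A = card (set_mset A)" by (simp add: size_multiset_overloaded_eq)
  moreover have "set_mset A = {x. x ^ N = 1}" using roots by blast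
  ultimately show ?thesis using A(1) by simp
qed

lemma frobenius2:
  assumes char2: "\<And>x::'a::field. x + x = 0"
  shows "(x + v) ^ (2 ^ m) = x ^ (2 ^ m) + (v::'a) ^ (2 ^ m)"
proof (induction m)
  case 0
  then show ?case by simp
next
  case (Suc m)
  have sq: "(x + v)\<^sup>2 = x\<^sup>2 + v\<^sup>2" for x v :: 'a
  proof -
    have "(x + v)\<^sup>2 = x\<^sup>2 + v\<^sup>2 + (x * v + x * v)" by (simp only: power2_eq_square ring_distribs ac_simps)
    then show ?thesis by (simp only: char2 add_0_right)
  qed
  show ?case unfolding power_Suc2 power_mult Suc sq ..
qed

text \<open>By Frobenius the solutions of \<open>x ^ (2 ^ n) = x\<close> form a finite subfield, so
  its multiplicative group is cyclic; \<open>card_roots_of_unity\<close> supplies the exact order of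
  a generator.\<close>

lemma primitive_root:
  assumes char2: "\<And>x::'a::alg_closed_field. x + x = 0" and n: "0 < n"
  shows "\<exists>g::'a. (\<forall>x. x ^ (2 ^ n - 1) = 1 \<longleftrightarrow> (\<exists>i. x = g ^ i)) \<and> (\<forall>i. g ^ i = 1 \<longleftrightarrow> (2 ^ n - 1) dvd i)"
proof -
  let ?N = "2 ^ n - 1 :: nat"
  have N0: "0 < ?N" using one_less_power[of "2::nat" n] n by simp
  have q: "2 ^ n = Suc ?N" by simp
  define E :: "'a set" where "E = {x. x ^ (2 ^ n) = x}"
  have E: "x \<in> E \<longleftrightarrow> x = 0 \<or> x ^ ?N = 1" for x
  proof -
    have "x \<in> E \<longleftrightarrow> x * x ^ ?N = x" unfolding E_def mem_Collect_eq by (subst q) (simp only: power_Suc)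
    then show ?thesis by (simp only: mult_cancel_left2)
  qed
  have cardU: "card {x::'a. x ^ ?N = 1} = ?N"
    by (rule card_roots_of_unity[OF char2]) (use n in simp)
  have finU: "finite {x::'a. x ^ ?N = 1}" using cardU N0 by (intro card_ge_0_finite) simp
  have "E = insert 0 {x. x ^ ?N = 1}" using E by blast
  then have finE: "finite E" using finU by simp
  let ?R = "ring_of_type_algebra :: 'a ring"
  have fld: "field ?R" by (rule field_from_type_algebra)
  have sub: "subring E ?R"
  proof (rule ring.subringI[OF field.is_ring[OF fld]])
    show "E \<subseteq> carrier ?R" by (simp add: ring_of_type_algebra_def)
    show "\<one>\<^bsub>?R\<^esub> \<in> E" by (simp add: ring_of_type_algebra_def E_def)
    show "\<ominus>\<^bsub>?R\<^esub> h \<in> E" if "h \<in> E" for h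
    proof -
      have "\<ominus>\<^bsub>?R\<^esub> h = h"
        by (rule abelian_group.minus_equality[OF ring.is_abelian_group[OF field.is_ring[OF fld]]])
          (simp_all add: ring_of_type_algebra_def char2)
      then show ?thesis using that by simp
    qed
    show "h1 \<otimes>\<^bsub>?R\<^esub> h2 \<in> E" "h1 \<oplus>\<^bsub>?R\<^esub> h2 \<in> E" if "h1 \<in> E" "h2 \<in> E" for h1 h2
      using that by (simp_all add: ring_of_type_algebra_def E_def power_mult_distrib frobenius2[OF char2])
  qed
  have "subfield E ?R"
  proof (rule field.subfieldI'[OF fld sub])
    fix h assume h: "h \<in> E - {\<zero>\<^bsub>?R\<^esub>}"
    then have h: "h \<noteq> 0" "h \<in> E" by (auto simp: ring_of_type_algebra_def)
    have "inv\<^bsub>?R\<^esub> h = inverse h"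
      by (rule monoid.inv_char[OF ring.is_monoid[OF field.is_ring[OF fld]]])
        (use h in \<open>simp_all add: ring_of_type_algebra_def\<close>)
    then show "inv\<^bsub>?R\<^esub> h \<in> E" using h by (simp add: E_def power_inverse)
  qed
  then have fE: "field (?R\<lparr>carrier := E\<rparr>)"
    by (rule ring.subfield_iff(2)[OF field.is_ring[OF fld]])
  let ?M = "Multiplicative_Group.mult_of (?R\<lparr>carrier := E\<rparr>)"
  have carr: "carrier ?M = E - {0}" by (simp add: Multiplicative_Group.mult_of_def ring_of_type_algebra_def)
  have pow: "(a [^]\<^bsub>?R\<lparr>carrier := E\<rparr>\<^esub> (i::nat)) = a ^ i" for a i
    by (induction i) (simp_all add: nat_pow_def ring_of_type_algebra_def mult.commute)
  have "finite (carrier (?R\<lparr>carrier := E\<rparr>))" using finE by simp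
  then have "\<exists>a\<in>E - {0}. E - {0} = {a ^ i |i::nat. i \<in> UNIV}"
    using field.finite_field_mult_group_has_gen[OF fE] unfolding carr pow by blast
  then obtain g where g: "g \<in> E - {0}" "E - {0} = {g ^ i |i::nat. i \<in> UNIV}" by blast
  have gN: "g ^ ?N = 1" using g(1) E by blast
  have U: "x ^ ?N = 1 \<longleftrightarrow> (\<exists>i. x = g ^ i)" for x
  proof -
    have "x ^ ?N = 1 \<longleftrightarrow> x \<in> E - {0}" using E[of x] N0 by (auto simp: power_0_left)
    then show ?thesis using g(2) by auto
  qed
  have mod: "g ^ (i mod ?N) = g ^ i" for i
  proof -
    have "g ^ i = g ^ (?N * (i div ?N) + i mod ?N)" by simp
    then show ?thesis by (simp only: power_add power_mult gN power_one mult_1_left)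
  qed
  have img: "{x. x ^ ?N = 1} = (\<lambda>i. g ^ i) ` {..<?N}"
  proof (rule Set.set_eqI)
    fix x
    have "(\<exists>i. x = g ^ i) \<longleftrightarrow> x \<in> (\<lambda>i. g ^ i) ` {..<?N}"
    proof
      assume "\<exists>i. x = g ^ i"
      then obtain i where "x = g ^ (i mod ?N)" using mod by metis
      then show "x \<in> (\<lambda>i. g ^ i) ` {..<?N}" using N0 by (intro image_eqI) auto
    qed auto
    then show "x \<in> {x. x ^ ?N = 1} \<longleftrightarrow> x \<in> (\<lambda>i. g ^ i) ` {..<?N}" using U by simp
  qed
  have inj: "inj_on (\<lambda>i. g ^ i) {..<?N}"
    by (rule eq_card_imp_inj_on) (use cardU img in simp_all)
  have "g ^ i = 1 \<longleftrightarrow> ?N dvd i" for i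
  proof -
    have "g ^ (i mod ?N) = g ^ 0 \<longleftrightarrow> i mod ?N = 0"
      using inj N0 by (intro inj_on_eq_iff[of _ "{..<?N}"]) auto
    then show ?thesis by (simp only: mod dvd_eq_mod_eq_0 power_0)
  qed
  then show ?thesis using U by blast
qed

text \<open>Let \<open>g\<close> generate the multiplicative group of the field with
  \<open>q ^ 2\<close> elements. Its power \<open>z\<close> generates that of the subfield
  \<open>F\<close>, while \<open>w\<close> has order \<open>q + 1\<close> and satisfies
  \<open>w ^ q = 1 / w\<close>, so its trace \<open>y = w + 1 / w\<close> lies in \<open>F\<close>.
  The map \<open>v \<mapsto> 1 / (v + y)\<close> has a matrix of determinant 1 and trace
  \<open>y\<close>, hence with eigenvalues \<open>w\<close> and \<open>1 / w\<close>.\<close>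

theorem gf_exists:
  assumes char2: "\<And>x::'a::alg_closed_field. x + x = 0" and k: "2 \<le> k"
  shows "\<exists>(F::'a set) z y. gf F z y k"
proof -
  define Q :: nat where "Q = 2 ^ k"
  have Q4: "4 \<le> Q" using power_increasing[OF k, of "2::nat"] by (simp add: Q_def)
  have Qe: "even Q" using k by (simp add: Q_def)
  have QQ: "2 ^ (2 * k) - 1 = (Q + 1) * (Q - 1)"
    using Q4 by (simp add: Q_def power_mult power2_eq_square algebra_simps mult_2 power_add)
  obtain g :: 'a where gU: "\<And>x. x ^ ((Q + 1) * (Q - 1)) = 1 \<longleftrightarrow> (\<exists>i. x = g ^ i)"
    and g1: "\<And>i. g ^ i = 1 \<longleftrightarrow> (Q + 1) * (Q - 1) dvd i"
    using primitive_root[OF char2, of "2 * k"] k unfolding QQ by auto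
  have g0: "g \<noteq> 0"
  proof
    assume "g = 0"
    moreover have "(Q + 1) * (Q - 1) \<noteq> 0" using Q4 by simp
    ultimately have "g ^ ((Q + 1) * (Q - 1)) = 0" by (simp only: power_0_left if_False)
    moreover have "g ^ ((Q + 1) * (Q - 1)) = 1" by (simp only: g1 dvd_refl)
    ultimately show False by (simp only: one_neq_zero)
  qed
  have min: "- x = x" for x :: 'a using char2[of x] by (simp add: eq_neg_iff_add_eq_0 neg_eq_iff_add_eq_0)
  have addself: "x + (x + v) = v" for x v :: 'a using char2[of x] by (simp flip: add.assoc)
  have sum0: "x + v = 0 \<longleftrightarrow> x = v" for x v :: 'a by (metis char2 addself add.right_neutral)
  have frob: "(x + v) ^ Q = x ^ Q + v ^ Q" for x v :: 'a
    unfolding Q_def by (rule frobenius2[OF char2])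
  define F :: "'a set" where "F = {x. x ^ Q = x}"
  define z where "z = g ^ (Q + 1)"
  define w where "w = g ^ (Q - 1)"
  define y where "y = w + 1 / w"
  have w0: "w \<noteq> 0" using g0 by (simp add: w_def)
  have zord: "z ^ i = 1 \<longleftrightarrow> (Q - 1) dvd i" for i
    unfolding z_def power_mult[symmetric] g1 nat_mult_dvd_cancel_disj by simp
  have word: "w ^ i = 1 \<longleftrightarrow> (Q + 1) dvd i" for i
    unfolding w_def power_mult[symmetric] g1 mult.commute[of "Q + 1"] nat_mult_dvd_cancel_disj
    using Q4 by simp
  have QS: "x ^ Q = x * x ^ (Q - 1)" for x :: 'a using Q4 by (simp flip: power_Suc)
  have FS: "x \<in> F \<longleftrightarrow> x = 0 \<or> x ^ (Q - 1) = 1" for x unfolding F_def mem_Collect_eq QS by (rule mult_cancel_left2)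
  have zF: "z \<in> F" using FS[of z] zord[of "Q - 1"] by simp
  have zgen: "\<exists>i. x = z ^ i" if x: "x \<in> F" "x \<noteq> 0" for x
  proof -
    have x1: "x ^ (Q - 1) = 1" using x FS by blast
    then have "x ^ ((Q + 1) * (Q - 1)) = 1" by (simp only: power_mult mult.commute[of "Q + 1"] power_one)
    then obtain i where i: "x = g ^ i" using gU by blast
    then have "(Q + 1) * (Q - 1) dvd i * (Q - 1)" using x1 by (simp only: power_mult[symmetric] g1)
    then have "Q + 1 dvd i" using Q4 by (subst (asm) dvd_times_right_cancel_iff) auto
    then obtain j where "i = (Q + 1) * j" by (rule dvdE)
    then have "x = z ^ j" using i by (simp only: z_def power_mult)
    then show ?thesis by blast
  qed
  have "F = insert 0 {x. x ^ (Q - 1) = 1}" using FS by blast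
  moreover have c: "card {x::'a. x ^ (Q - 1) = 1} = Q - 1"
    by (rule card_roots_of_unity[OF char2]) (use Q4 Qe in simp)
  moreover have "finite {x::'a. x ^ (Q - 1) = 1}" using c Q4 by (intro card_ge_0_finite) simp
  ultimately have finF: "finite F" and cardF: "card F = Q"
    using Q4 by (simp_all add: power_0_left)
  have Fc: "0 \<in> F" "1 \<in> F" "a \<in> F \<Longrightarrow> b \<in> F \<Longrightarrow> a + b \<in> F"
      "a \<in> F \<Longrightarrow> b \<in> F \<Longrightarrow> a * b \<in> F" "a \<in> F \<Longrightarrow> 1 / a \<in> F" for a b
    using Q4 by (simp_all add: F_def power_0_left frob power_mult_distrib power_divide)
  have wQ1: "w ^ Q * w = 1" using word[of "Q + 1"] by (simp add: mult.commute)
  then have wQ: "w ^ Q = 1 / w" using w0 by (simp add: field_simps)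
  have w2: "w * w \<noteq> 1"
  proof
    assume "w * w = 1"
    then have "Q + 1 dvd 2" using word[of 2] by (simp add: power2_eq_square)
    then show False using Q4 by (auto dest: dvd_imp_le)
  qed
  have yF: "y \<in> F" using w0 by (simp add: F_def y_def frob power_divide wQ add.commute)
  have y0: "y \<noteq> 0"
  proof
    assume "y = 0"
    then have "w = 1 / w" unfolding y_def sum0 .
    then show False using w2 w0 by (simp add: field_simps)
  qed
  have "w \<noteq> 1 / w" using w2 w0 by (simp add: field_simps)
  moreover have "(1 / w) ^ Q = w" using wQ by (simp add: power_divide)
  ultimately have notF: "w \<notin> F" "1 / w \<notin> F" unfolding F_def mem_Collect_eq wQ by metis+
  let ?P = "insert None (Some ` F)"
  define f where "f = mobW \<circ> mobU y"
  have finP: "finite ?P" and cardP: "card ?P = Q + 1"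
  proof -
    have "card (Some ` F) = Q" by (simp add: card_image cardF)
    then show "card ?P = Q + 1" using finF by (subst card_insert_disjoint) auto
    show "finite ?P" using finF by simp
  qed
  \<comment> \<open>The Cayley transform turns \<open>f\<close> into multiplication by \<open>w\<^sup>2\<close>.\<close>
  define \<chi> where "\<chi> p = (case p of None \<Rightarrow> 1 | Some v \<Rightarrow> (v + w) / (v + 1 / w))" for p
  have \<chi>f: "f p \<in> ?P \<and> \<chi> (f p) = w * w * \<chi> p" if p: "p \<in> ?P" for p
  proof (cases p)
    case None
    then show ?thesis using w0 Fc by (simp add: mobU_def mobW_def \<chi>_def f_def)
  next
    case (Some v)
    then have v: "v \<in> F" using p by auto
    have vw: "v + w \<noteq> 0" "v + 1 / w \<noteq> 0" using v notF unfolding sum0 by auto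
    show ?thesis
    proof (cases "v = y")
      case True
      have "y + w = 1 / w" "y + 1 / w = w" unfolding y_def using addself[of w "1/w"] char2[of "1/w"]
        by (simp_all add: add.commute add.assoc)
      then show ?thesis using Some True w0 char2[of y] by (simp add: mobU_def mobW_def \<chi>_def f_def)
    next
      case False
      then have vy: "v + y \<noteq> 0" unfolding sum0 .
      have fv: "f p = Some (1 / (v + y))" using Some vy by (simp add: mobU_def mobW_def f_def)
      have wy: "w * y = w * w + 1" "y / w = 1 + 1 / (w * w)" unfolding y_def using w0 by (simp_all add: field_simps)
      have "1 / (v + y) + w = (1 + w * v + w * y) / (v + y)" using vy by (simp add: field_simps)
      also have "1 + w * v + w * y = w * (v + w)" unfolding wy using addself[of 1 "w * v + w * w"] by (simp add: algebra_simps)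
      finally have 1: "1 / (v + y) + w = w * (v + w) / (v + y)" .
      have "1 / (v + y) + 1 / w = (1 + v / w + y / w) / (v + y)" using vy w0 by (simp add: field_simps)
      also have "1 + v / w + y / w = (v + 1 / w) / w" unfolding wy using addself[of 1 "v / w + 1 / (w * w)"] by (simp add: algebra_simps add_divide_distrib)
      finally have 2: "1 / (v + y) + 1 / w = (v + 1 / w) / w / (v + y)" .
      have "\<chi> (f p) = w * w * \<chi> p" unfolding fv using Some vy vw w0 by (simp add: \<chi>_def 1 2)
      then show ?thesis unfolding fv using v yF Fc by simp
    qed
  qed
  have \<chi>pow: "(f ^^ n) p \<in> ?P \<and> \<chi> ((f ^^ n) p) = w ^ (2 * n) * \<chi> p" if p: "p \<in> ?P" for p n
  proof (induction n)
    case 0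
    then show ?case using p by simp
  next
    case (Suc n)
    then show ?case using \<chi>f[of "(f ^^ n) p"] by (simp add: mult.assoc)
  qed
  have \<chi>inj: "inj_on \<chi> ?P"
  proof (rule inj_onI)
    have key: "\<chi> (Some v) \<noteq> \<chi> None" if "v \<in> F" for v
    proof
      assume "\<chi> (Some v) = \<chi> None"
      then have "(v + w) / (v + 1 / w) = 1" by (simp only: \<chi>_def option.case)
      moreover have "v + 1 / w \<noteq> 0" using that notF unfolding sum0 by auto
      ultimately show False using \<open>w \<noteq> 1 / w\<close> by simp
    qed
    fix p q assume pq: "p \<in> ?P" "q \<in> ?P" "\<chi> p = \<chi> q"
    show "p = q"
    proof (cases p)
      case None
      show ?thesis
      proof (cases q)
        case (Some v')
        then have "v' \<in> F" using pq by auto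
        then show ?thesis using pq(3) key[of v'] unfolding \<open>p = None\<close> Some by metis
      qed (simp add: \<open>p = None\<close>)
    next
      case (Some v)
      then have v: "v \<in> F" using pq by auto
      show ?thesis
      proof (cases q)
        case None
        then show ?thesis using pq(3) key[OF v] unfolding Some by metis
      next
        case (Some v')
        then have v': "v' \<in> F" using pq by auto
        have nz: "v + 1 / w \<noteq> 0" "v' + 1 / w \<noteq> 0" using v v' notF unfolding sum0 by auto
        have "(v + w) * (v' + 1 / w) = (v' + w) * (v + 1 / w)"
          using pq(3) Some \<open>p = Some v\<close> nz by (simp add: \<chi>_def frac_eq_eq)
        moreover have "(v - v') * (c - w) = (v + w) * (v' + c) - (v' + w) * (v + c)" for c
          by (simp add: algebra_simps)
        ultimately have "(v - v') * (1 / w - w) = 0" by (simp only: diff_self)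
        then show ?thesis using Some \<open>p = Some v\<close> \<open>w \<noteq> 1 / w\<close> by simp
      qed
    qed
  qed
  have ford: "(f ^^ (Q + 1)) p = p" if p: "p \<in> ?P" for p
  proof (rule inj_onD[OF \<chi>inj _ _ p])
    have "w ^ (2 * (Q + 1)) = 1" unfolding word by (rule dvd_triv_right)
    then show "\<chi> ((f ^^ (Q + 1)) p) = \<chi> p" using \<chi>pow[OF p, of "Q + 1"] by simp
    show "(f ^^ (Q + 1)) p \<in> ?P" using \<chi>pow[OF p, of "Q + 1"] by blast
  qed
  have forb: "\<exists>n. (f ^^ n) None = p" if p: "p \<in> ?P" for p
  proof -
    let ?h = "\<lambda>n. (f ^^ n) None"
    have "inj_on ?h {..<Q + 1}"
    proof (rule inj_onI)
      have *: "i = j" if "i \<le> j" "j < Q + 1" "?h i = ?h j" for i j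
      proof -
        have "w ^ (2 * i) = w ^ (2 * j)" using \<chi>pow[of None i] \<chi>pow[of None j] that by (simp add: \<chi>_def)
        also have "2 * j = 2 * i + 2 * (j - i)" using that by simp
        finally have "w ^ (2 * i) * 1 = w ^ (2 * i) * w ^ (2 * (j - i))" by (simp only: power_add mult_1_right)
        then have "w ^ (2 * (j - i)) = 1" using w0 by simp
        then have "Q + 1 dvd 2 * (j - i)" unfolding word .
        \<comment> \<open>As \<open>Q + 1\<close> is odd, \<open>w ^ 2\<close> has the same order as
          \<open>w\<close>, so \<open>f\<close> is a full cycle and not two shorter ones.\<close>
        moreover have "coprime (Q + 1) 2" using Qe by simp
        ultimately have "Q + 1 dvd j - i" by (simp add: coprime_dvd_mult_right_iff)
        then show "i = j" using that by (auto dest: dvd_imp_le)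
      qed
      fix i j assume "i \<in> {..<Q + 1}" "j \<in> {..<Q + 1}" "?h i = ?h j"
      then show "i = j" using *[of i j] *[of j i] by (cases "i \<le> j") auto
    qed
    then have "card (?h ` {..<Q + 1}) = Q + 1" by (simp add: card_image)
    moreover have "?h ` {..<Q + 1} \<subseteq> ?P"
    proof (rule image_subsetI)
      show "(f ^^ n) None \<in> ?P" for n using \<chi>pow[OF insertI1, of n] by (rule conjunct1)
    qed
    ultimately have "?h ` {..<Q + 1} = ?P" using finP cardP by (intro card_subset_eq) auto
    then show ?thesis using p by (metis imageE)
  qed
  have "gf F z y k"
    by (unfold_locales; (fold Q_def f_def)?)
      (use char2 Fc finF cardF k zF zgen zord yF y0 forb ford in \<open>simp_all del: insert_iff comp_apply funpow.simps\<close>)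
  then show ?thesis by blast
qed

section \<open>Short words for cycles on arcs\<close>

text \<open>Says that \<open>g\<close> is a cycle on \<open>W\<close>, with \<open>x\<close> as
  starting point, in the form that the gluing uses: conjugation by powers of \<open>g\<close>
  carries a transposition at \<open>x\<close> to every point of \<open>W\<close>. A singleton with
  \<open>g = 1\<close> is included.\<close>

definition cycle_from :: "'a prm \<Rightarrow> 'a \<Rightarrow> 'a set \<Rightarrow> bool" where
  "cycle_from g x W \<longleftrightarrow> g \<in> Sym W \<and> x \<in> W \<and> (\<forall>w\<in>W. \<exists>n. app (g ^ n) x = w)"

lemma cycle_from_cj:
  assumes "cycle_from g x W"
  shows "cycle_from (cj g h) (app h x) (app h ` W)"
proof -
  have "app (cj g h) v = v" if "v \<notin> app h ` W" for v
  proof -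
    have "app (inverse h) v \<notin> W" using that app_inv(2)[of h v] by (metis imageI)
    then show ?thesis using assms by (simp add: cycle_from_def Sym_def cj_def)
  qed
  moreover have "\<exists>n. app (cj g h ^ n) (app h x) = app h w" if "w \<in> W" for w
  proof -
    obtain n where "app (g ^ n) x = w" using assms \<open>w \<in> W\<close> by (auto simp: cycle_from_def)
    then have "app (cj g h ^ n) (app h x) = app h w" unfolding cj_power[symmetric] by (simp add: cj_def)
    then show ?thesis ..
  qed
  ultimately show ?thesis using assms unfolding cycle_from_def Sym_def by auto
qed

text \<open>The new product sends \<open>a\<close> to \<open>x\<close>, follows \<open>c\<close>
  around \<open>W\<close>, and leaves for \<open>a\<close> at the moment when \<open>c\<close> would
  return to \<open>x\<close>.\<close>

lemma cycle_from_extend: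
  assumes c: "cycle_from c x W" and new: "a \<notin> W"
  shows "cycle_from (c * tr x a) a (insert a W)"
proof -
  let ?g = "c * tr x a"
  have cS: "c \<in> Sym W" and xW: "x \<in> W" using c by (auto simp: cycle_from_def)
  then have "?g \<in> Sym (insert a W)"
    using Sym_mono[of W "insert a W"] by (intro Sym_mult Sym_tr) auto
  moreover have "\<exists>n. app (?g ^ n) a = w" if w: "w \<in> W" for w
  proof -
    \<comment> \<open>Minimality ensures that the path from \<open>x\<close> to \<open>w\<close>
      does not pass through \<open>x\<close> again, where the transposition would divert it to
      \<open>a\<close>.\<close>
    define n where "n = (LEAST n. app (c ^ n) x = w)"
    have n: "app (c ^ n) x = w"
      unfolding n_def by (rule LeastI_ex) (use c w in \<open>simp add: cycle_from_def\<close>)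
    have nx: "app (c ^ m) x \<noteq> x" if "0 < m" "m \<le> n" for m
    proof
      assume "app (c ^ m) x = x"
      then have "app (c ^ (n - m)) x = app (c ^ (m + (n - m))) x" by (simp only: power_add app_mult)
      then have "app (c ^ (n - m)) x = w" using n that by simp
      then have "n \<le> n - m" unfolding n_def by (rule Least_le)
      then show False using that by simp
    qed
    have "app (?g ^ Suc m) a = app (c ^ m) x" if "m \<le> n" for m
      using that
    proof (induction m)
      case 0
      have "app c a = a" using cS new by (simp add: Sym_def)
      then show ?case by (simp add: app_tr)
    next
      case (Suc m)
      have "app (?g ^ Suc (Suc m)) a = app ?g (app (c ^ m) x)"
        using Suc by (simp only: power_Suc2[of _ "Suc m"] app_mult)
      also have "\<dots> = transpose x a (app (c ^ Suc m) x)"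
        by (simp only: power_Suc2 app_mult app_tr)
      also have "\<dots> = app (c ^ Suc m) x"
      proof -
        have "c ^ Suc m \<in> Sym W" using cS by (rule Sym_power)
        then have "app (c ^ Suc m) x \<in> W" using xW by (simp add: Sym_app_mem del: power_Suc)
        then have "app (c ^ Suc m) x \<noteq> a" using new by auto
        moreover have "app (c ^ Suc m) x \<noteq> x" using nx[of "Suc m"] Suc.prems by blast
        ultimately show ?thesis by (simp add: transpose_def)
      qed
      finally show ?case .
    qed
    then show ?thesis using n by blast
  qed
  moreover have "\<exists>n. app (?g ^ n) a = a" by (rule exI[of _ 0]) simp
  ultimately show ?thesis by (simp add: cycle_from_def)
qed

section \<open>Powers of the two cycles as words of length linear in k\<close>

context gf begin

definition sh :: "nat \<Rightarrow> 'k option option prm \<Rightarrow> bool" where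
  "sh L p \<longleftrightarrow> (\<exists>v\<in>words {..<7}. length v \<le> L \<and> wev base_ev v = p)"

lemma sh_mono: "sh L p \<Longrightarrow> L \<le> M \<Longrightarrow> sh M p"
  unfolding sh_def by (meson order_trans)

lemma sh_1: "sh 0 1"
  unfolding sh_def by (rule bexI[of _ "[]"]) simp_all

lemma sh_letter: "i < 7 \<Longrightarrow> sh 1 (base_ev i)"
  unfolding sh_def by (rule bexI[of _ "[(i, True)]"]) simp_all

lemma sh_mult: "sh L p \<Longrightarrow> sh M q \<Longrightarrow> sh (L + M) (p * q)"
proof -
  assume "sh L p" "sh M q"
  then obtain v v2 where v: "v \<in> words {..<7}" "length v \<le> L" "wev base_ev v = p"
    and v2: "v2 \<in> words {..<7}" "length v2 \<le> M" "wev base_ev v2 = q"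
    by (auto simp: sh_def)
  show ?thesis unfolding sh_def by (rule bexI[of _ "v @ v2"]) (use v v2 in simp_all)
qed

lemma sh_inverse: "sh L p \<Longrightarrow> sh L (inverse p)"
proof -
  assume "sh L p"
  then obtain v where v: "v \<in> words {..<7}" "length v \<le> L" "wev base_ev v = p" by (auto simp: sh_def)
  show ?thesis unfolding sh_def by (rule bexI[of _ "winv v"]) (use v in simp_all)
qed

lemma sh_cj: "sh L p \<Longrightarrow> sh M q \<Longrightarrow> sh (M + L + M) (cj p q)"
  unfolding cj_def by (intro sh_mult sh_inverse)

lemma length_wU: "x \<in> F \<Longrightarrow> length (wU u a x) \<le> 3 * k"
  using length_wUl[of u a "bits x"] bits[of x] by (simp add: wU_def)

lemma length_wHd: "x \<in> F \<Longrightarrow> length (wHd u a w x) \<le> 9 * k + 3"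
  using length_wU[of x u a] length_wU[of "1 / x" u a] F_closed(5)[of x] by (simp add: wHd_def)

lemma words_wU: "u \<in> X \<Longrightarrow> a \<in> X \<Longrightarrow> wU u a x \<in> words X"
  by (simp add: wU_def words_wUl)

lemma words_wHd: "u \<in> X \<Longrightarrow> a \<in> X \<Longrightarrow> w \<in> X \<Longrightarrow> wHd u a w x \<in> words X"
  by (simp add: wHd_def words_wU)

lemma sh_U:
  assumes "x \<in> F"
  shows "sh (3 * k) (U pu pa x)" "sh (3 * k) (U (cj pu pK) (cj pa pK) x)"
proof -
  show "sh (3 * k) (U pu pa x)" unfolding sh_def
    by (rule bexI[of _ "wU 1 2 x"]) (use assms length_wU words_wU in simp_all)
  show "sh (3 * k) (U (cj pu pK) (cj pa pK) x)" unfolding sh_def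
    by (rule bexI[of _ "wU 4 5 x"]) (use assms length_wU words_wU in simp_all)
qed

lemma sh_Hd:
  assumes "x \<in> F"
  shows "sh (9 * k + 3) (Hd pu pa pw x)" "sh (9 * k + 3) (Hd (cj pu pK) (cj pa pK) (cj pw pK) x)"
proof -
  show "sh (9 * k + 3) (Hd pu pa pw x)" unfolding sh_def
    by (rule bexI[of _ "wHd 1 2 3 x"]) (use assms length_wHd words_wHd in simp_all)
  show "sh (9 * k + 3) (Hd (cj pu pK) (cj pa pK) (cj pw pK) x)" unfolding sh_def
    by (rule bexI[of _ "wHd 4 5 6 x"]) (use assms length_wHd words_wHd in simp_all)
qed

lemma onP_mobA_Hd: "t \<in> F \<Longrightarrow> t \<noteq> 0 \<Longrightarrow> onP (mobA t) = Hd pu pa pw (isqrt t)"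
  using isqrt[of t] Hd_onP[of "isqrt t"] by simp

text \<open>Multiplication by \<open>z ^ l\<close> is written as \<open>Hd\<close> at an inverse
  square root, so the bound, three translations of length \<open>3 * k\<close> and three letters
  \<open>w\<close>, is independent of \<open>l\<close>.\<close>

lemma sh_pa_power: "sh (9 * k + 3) (pa ^ l)"
  using sh_Hd(1)[of "isqrt (z ^ l)"] isqrt[of "z ^ l"] onP_mobA_Hd[of "z ^ l"] zpow_F z_nz
  by (simp add: pa_power)

text \<open>The rotation is the torus element of the second copy, so by \<open>bruhat_power\<close>
  each of its powers is in normal form: two translations, one \<open>w\<close> and one diagonal
  element, which has to be rewritten as an \<open>Hd\<close> to be short.\<close>

lemma sh_rotation: "sh (15 * k + 4) (onP zM ^ l)"
proof -
  interpret T: sl2 F z y k "cj pu pK" "cj pa pK" "cj pw pK"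
    by unfold_locales (rule SL2_rel_cj[OF SL2_perms])
  have diag: "sh (9 * k + 3) A" if A: "T.diag A t" for A t
  proof -
    obtain i j where ij: "A = cj pa pK ^ i * inverse (cj pa pK ^ j)" "t = z ^ i / z ^ j"
      using A by (auto simp: T.diag_def)
    have t: "t \<in> F" "t \<noteq> 0" using T.diag_F[OF A] by auto
    have "onP (mobA t) * pa ^ j = pa ^ i"
      unfolding pa_power onP_mult[OF mob_bij(2)[OF t] mob_bij(2)[OF zpow_F power_not_zero[OF z_nz]]]
      by (rule onP_eq) (auto simp: mobA_def ij z_nz)
    then have "pa ^ i * inverse (pa ^ j) = onP (mobA t) * pa ^ j * inverse (pa ^ j)" by (simp only:)
    then have "A = cj (onP (mobA t)) pK"
      by (simp only: ij cj_power[symmetric] cj_inverse[symmetric] cj_mult[symmetric] mult.assoc right_inv mult_1_right)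
    also have "\<dots> = Hd (cj pu pK) (cj pa pK) (cj pw pK) (isqrt t)"
      by (simp add: onP_mobA_Hd[OF t] Hd_def U_conj cj_mult)
    finally show ?thesis using sh_Hd(2) isqrt[OF t] by simp
  qed
  have w: "sh 1 (cj pw pK)" using sh_letter[of 6] by simp
  have "T.bruhat ((T.V y * cj pw pK) ^ l)" by (rule T.bruhat_power[OF y_F])
  then have "T.bruhat (onP zM ^ l)" by (simp only: second_torus)
  then obtain x A t where x: "x \<in> F" and A: "T.diag A t"
    and "onP zM ^ l = T.V x * A \<or> (\<exists>c\<in>F. onP zM ^ l = T.V x * cj pw pK * A * T.V c)"
    unfolding T.bruhat_def by blast
  then consider "onP zM ^ l = T.V x * A" | c where "c \<in> F" "onP zM ^ l = T.V x * cj pw pK * A * T.V c" by blast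
  then show ?thesis
  proof cases
    case 1
    show ?thesis unfolding 1 by (rule sh_mono[OF sh_mult[OF sh_U(2)[OF x] diag[OF A]]]) simp
  next
    case 2
    show ?thesis unfolding 2(2)
      by (rule sh_mono[OF sh_mult[OF sh_mult[OF sh_mult[OF sh_U(2)[OF x] w] diag[OF A]] sh_U(2)[OF 2(1)]]]) simp
  qed
qed

text \<open>Cyclic labels modulo \<open>q + 1\<close> on the projective line: label 0 is infinity,
  labels 1 to \<open>q - 1\<close> are the powers of \<open>z\<close> starting with 1, and label
  \<open>q\<close> is the field element 0.\<close>

definition pt :: "nat \<Rightarrow> 'k option option" where
  "pt n = Some ((zM ^^ n) None)"

lemma pt_eq_iff: "pt i = pt j \<longleftrightarrow> i mod (2 ^ k + 1) = j mod (2 ^ k + 1)"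
  by (simp add: pt_def zM_mod)

lemma pt_add_Q: "pt (i + (2 ^ k + 1)) = pt i"
  unfolding pt_eq_iff by (rule mod_add_self2)

lemma pt_inj: "inj_on pt {s..<s + (2 ^ k + 1)}"
proof (rule inj_onI)
  have *: "i = j" if "i \<le> j" "j < i + Q" "i mod Q = j mod Q" for i j Q :: nat
  proof -
    have "Q dvd j - i" using that by (metis mod_eq_dvd_iff_nat)
    then show ?thesis using that by (auto dest: dvd_imp_le)
  qed
  fix i j assume "i \<in> {s..<s + (2 ^ k + 1)}" "j \<in> {s..<s + (2 ^ k + 1)}" "pt i = pt j"
  then show "i = j" unfolding pt_eq_iff using *[of i j "2 ^ k + 1"] *[of j i "2 ^ k + 1"]
    by (cases "i \<le> j") auto
qed

lemma pt_image: "pt ` {s..<s + (2 ^ k + 1)} = Some ` P1"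
proof (rule card_subset_eq)
  show "finite (Some ` P1)" using finite_F by simp
  have "pt i \<in> Some ` P1" for i unfolding pt_def by (rule imageI[OF funpow_P1[OF zM_bij insertI1]])
  then show "pt ` {s..<s + (2 ^ k + 1)} \<subseteq> Some ` P1" by blast
  have "card (pt ` {s..<s + (2 ^ k + 1)}) = 2 ^ k + 1" using card_image[OF pt_inj[of s]] by simp
  moreover have "card (Some ` P1) = 2 ^ k + 1" by (simp only: card_image[OF inj_Some] card_P1)
  ultimately show "card (pt ` {s..<s + (2 ^ k + 1)}) = card (Some ` P1)" by (simp only:)
qed

lemma app_rotation: "app (onP zM ^ l) (pt i) = pt (i + l)" "app (onP zM ^ l) None = None"
proof -
  have 1: "app (onP zM) (pt i) = pt (Suc i)" for i
    using funpow_P1[OF zM_bij insertI1, of i] by (simp only: pt_def app_onP[OF zM_bij] if_True funpow.simps comp_apply)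
  show "app (onP zM ^ l) (pt i) = pt (i + l)" by (induction l arbitrary: i) (simp_all add: 1)
  show "app (onP zM ^ l) None = None" by (induction l) (simp_all add: app_onP[OF zM_bij])
qed

lemma app_rotation_inverse: "app (inverse (onP zM ^ l)) (pt (i + l)) = pt i"
  unfolding app_inv_eq by (rule app_rotation(1)[symmetric])

lemma pt_0: "pt 0 = Some None"
  by (simp add: pt_def)

lemma pt_q: "pt (2 ^ k) = Some (Some 0)"
  by (simp only: pt_def zM_0)

lemma pt_Suc: "n < 2 ^ k - 1 \<Longrightarrow> pt (Suc n) = Some (Some (z ^ n))"
  by (simp only: pt_def zM_pow)

lemma app_pa: "app pa None = None" "app pa (pt 0) = pt 0" "app pa (pt (2 ^ k)) = pt (2 ^ k)"
  "n < 2 ^ k - 2 \<Longrightarrow> app pa (pt (Suc n)) = pt (Suc (Suc n))" "app pa (pt (2 ^ k - 1)) = pt 1"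
proof -
  have m: "mobA z None = None" "mobA z (Some 0) = Some 0" "mobA z (Some (z ^ n)) = Some (z ^ Suc n)" for n
    by (simp_all add: mobA_def mult.commute)
  show "app pa None = None" "app pa (pt 0) = pt 0" "app pa (pt (2 ^ k)) = pt (2 ^ k)"
    by (simp_all add: app_onP[OF mob_bij'(2)] pt_0 pt_q m)
  have *: "app pa (Some (Some (z ^ n))) = Some (Some (z ^ Suc n))" for n
    using zpow_F[of n] by (simp add: app_onP[OF mob_bij'(2)] m del: power_Suc)
  show "n < 2 ^ k - 2 \<Longrightarrow> app pa (pt (Suc n)) = pt (Suc (Suc n))"
    using pt_Suc[of n] pt_Suc[of "Suc n"] *[of n] by simp
  have "z ^ (2 ^ k - 1) = 1" by (simp only: z_ord dvd_refl)
  moreover have "(2 ^ k - 1 :: nat) = Suc (2 ^ k - 2)" using q_ge by simp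
  ultimately show "app pa (pt (2 ^ k - 1)) = pt 1"
    using pt_Suc[of "2 ^ k - 2"] pt_Suc[of 0] *[of "2 ^ k - 2"] q_ge by simp
qed

lemma app_pa_power:
  "app (pa ^ l) None = None" "app (pa ^ l) (pt 0) = pt 0" "app (pa ^ l) (pt (2 ^ k)) = pt (2 ^ k)"
  "1 \<le> n \<Longrightarrow> n + l \<le> 2 ^ k - 1 \<Longrightarrow> app (pa ^ l) (pt n) = pt (n + l)"
  "n \<le> 2 ^ k - 1 \<Longrightarrow> 2 ^ k - 1 < n + l \<Longrightarrow> l \<le> 2 ^ k - 1 \<Longrightarrow> app (pa ^ l) (pt n) = pt (n + l - (2 ^ k - 1))"
proof -
  show "app (pa ^ l) None = None" "app (pa ^ l) (pt 0) = pt 0" "app (pa ^ l) (pt (2 ^ k)) = pt (2 ^ k)"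
    by (induction l) (simp_all add: app_pa)
  show *: "app (pa ^ l) (pt n) = pt (n + l)" if "1 \<le> n" "n + l \<le> 2 ^ k - 1" for n l
    using that
  proof (induction l arbitrary: n)
    case (Suc l)
    then obtain i where i: "n = Suc i" "i < 2 ^ k - 2" by (cases n) auto
    then have "app pa (pt n) = pt (Suc n)" using app_pa(4) by simp
    then show ?case using Suc.IH[of "Suc n"] Suc.prems by simp
  qed simp
  assume n: "n \<le> 2 ^ k - 1" "2 ^ k - 1 < n + l" "l \<le> 2 ^ k - 1"
  define i where "i = n + l - (2 ^ k - 1) - 1"
  have l: "l = (2 ^ k - 1 - n) + (1 + i)" using n by (simp add: i_def)
  have "app (pa ^ l) (pt n) = app (pa ^ i) (app pa (app (pa ^ (2 ^ k - 1 - n)) (pt n)))"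
    unfolding l by (simp only: power_add power_one_right app_mult)
  also have "app (pa ^ (2 ^ k - 1 - n)) (pt n) = pt (2 ^ k - 1)"
    using *[of n "2 ^ k - 1 - n"] n by simp
  also have "app pa (pt (2 ^ k - 1)) = pt 1" by (rule app_pa)
  also have "app (pa ^ i) (pt 1) = pt (1 + i)" using n by (intro *) (simp_all add: i_def)
  also have "1 + i = n + l - (2 ^ k - 1)" using n by (simp add: i_def)
  finally show "app (pa ^ l) (pt n) = pt (n + l - (2 ^ k - 1))" .
qed

text \<open>The two cycles \<open>pa\<close> and \<open>onP zM\<close> agree except at three consecutive points around infinity, so their \<open>l\<close>-th
  powers differ only on a window of \<open>l + 2\<close> points, which the quotient rotates by two places.\<close>

lemma odd_window:
  assumes l: "odd l" "l < 2 ^ k - 1"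
  shows "cycle_from (pa ^ l * inverse (onP zM ^ l)) (pt (2 ^ k - l)) (pt ` {2 ^ k - l..<2 ^ k - l + (l + 2)})"
proof -
  let ?g = "pa ^ l * inverse (onP zM ^ l)"
  define T where "T = l + 2"
  define s :: nat where "s = 2 ^ k - l"
  have s: "s + l = 2 ^ k" "2 \<le> s" using l by (simp_all add: s_def)
  \<comment> \<open>A rotation by two places is a single cycle precisely because the number of
    places is odd; odd positions are reached on the second round.\<close>
  have oddT: "odd T" using l by (simp add: T_def)
  have step: "app ?g (pt (s + j)) = pt (s + (j + 2) mod T)" if j: "j < T" for j
  proof -
    \<comment> \<open>For \<open>j < l\<close> both powers run past the end of their cycles, and the
      shift by two is the difference of the lengths \<open>q + 1\<close> and \<open>q - 1\<close>.
      The positions \<open>l\<close> and \<open>l + 1\<close> of the window are 0 and infinity, both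
      fixed by \<open>pa\<close>.\<close>
    consider "j < l" | "j = l" | "j = Suc l" using j by (auto simp: T_def less_Suc_eq)
    then show ?thesis
    proof cases
      case 1
      have "app (pa ^ l) (pt (s + j)) = pt (s + j + l - (2 ^ k - 1))"
        using 1 s l by (intro app_pa_power(5)) auto
      also have "s + j + l - (2 ^ k - 1) = Suc j" using s by simp
      also have "pt (Suc j) = pt (Suc j + (2 ^ k + 1))" by (rule pt_add_Q[symmetric])
      also have "Suc j + (2 ^ k + 1) = (s + (j + 2)) + l" using s by simp
      finally have "app ?g (pt (s + j)) = pt (s + (j + 2))"
        by (simp only: app_mult app_rotation_inverse)
      then show ?thesis using 1 by (simp add: T_def)
    next
      case 2
      have "pt (2 ^ k) = pt (s + l)" using s by simp
      then have "app ?g (pt (s + j)) = pt s"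
        using 2 s(1) app_rotation_inverse[of l s] app_pa_power(3)[of l] by simp
      then show ?thesis using 2 by (simp add: T_def)
    next
      case 3
      have e: "s + Suc l = 0 + (2 ^ k + 1)" using s by simp
      have "pt (s + j) = pt 0" unfolding 3 e by (rule pt_add_Q)
      moreover have "pt 0 = pt ((s + 1) + l)" using pt_add_Q[of 0] e by simp
      ultimately have "app ?g (pt (s + j)) = pt (s + 1)"
        using app_rotation_inverse[of l "s + 1"] app_pa_power(2)[of l] by simp
      moreover have "j + 2 = T + 1" using 3 by (simp add: T_def)
      moreover have "(T + 1) mod T = 1" unfolding mod_add_self1 by (simp add: T_def)
      ultimately show ?thesis by (simp only:)
    qed
  qed
  have pow: "app (?g ^ n) (pt s) = pt (s + (2 * n) mod T)" for n
  proof (induction n)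
    case (Suc n)
    have "app (?g ^ Suc n) (pt s) = app ?g (app (?g ^ n) (pt s))" by (simp only: power_Suc2 app_mult)
    also have "\<dots> = pt (s + ((2 * n) mod T + 2) mod T)"
      unfolding Suc by (rule step) (simp add: T_def)
    also have "((2 * n) mod T + 2) mod T = (2 * Suc n) mod T" by (simp add: mod_simps)
    finally show ?case .
  qed simp
  have "?g \<in> Sym (pt ` {s..<s + T})"
  proof -
    have "app ?g v = v" if v: "v \<notin> pt ` {s..<s + T}" for v
    proof (cases "v \<in> Some ` P1")
      case True
      have "v \<in> pt ` {0..<0 + (2 ^ k + 1)}" unfolding pt_image using True .
      then obtain n where n: "v = pt n" "n < 2 ^ k + 1" by auto
      have "n < s" using n v s by (auto simp: T_def)
      moreover have "n \<noteq> 0"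
      proof
        assume "n = 0"
        then have "v = pt (s + (l + 1))" using n(1) pt_add_Q[of 0] s by (simp add: add.assoc[symmetric])
        then show False using v by (auto simp: T_def)
      qed
      ultimately have "app (pa ^ l) v = pt (n + l)" unfolding n(1) using s by (intro app_pa_power(4)) auto
      then show ?thesis using n(1) by (simp add: app_rotation_inverse)
    next
      case False
      have "pa ^ l \<in> Sym (Some ` P1)" "onP zM ^ l \<in> Sym (Some ` P1)"
        by (rule Sym_power, rule onP_Sym, rule mob_bij' zM_bij)+
      then have "?g \<in> Sym (Some ` P1)" by (intro Sym_mult Sym_inverse)
      then show ?thesis using False unfolding Sym_def by blast
    qed
    then show ?thesis by (simp add: Sym_def)
  qed
  moreover have orbit: "\<exists>n. app (?g ^ n) (pt s) = pt (s + j)" if j: "j < T" for j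
  proof (cases "even j")
    case True
    then have "2 * (j div 2) mod T = j" using j by simp
    then show ?thesis using pow[of "j div 2"] by metis
  next
    case False
    then have "2 * ((j + T) div 2) = j + T" using oddT by simp
    then have "2 * ((j + T) div 2) mod T = j" using j by simp
    then show ?thesis using pow[of "(j + T) div 2"] by metis
  qed
  then have "\<exists>n. app (?g ^ n) (pt s) = w" if "w \<in> pt ` {s..<s + T}" for w
  proof -
    obtain i where i: "w = pt i" "s \<le> i" "i < s + T" using \<open>w \<in> _\<close> by auto
    then show ?thesis using orbit[of "i - s"] by simp
  qed
  ultimately show ?thesis unfolding cycle_from_def T_def s_def by auto
qed

text \<open>A window of \<open>T\<close> points comes from the exponent \<open>T - 2\<close>, and a
  short rotation carries it to any starting point. A single point is served by the identity.\<close>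

lemma odd_arc:
  assumes T: "odd T" "T < 2 ^ k"
  shows "\<exists>g x. cycle_from g x (pt ` {s..<s + T}) \<and> sh (54 * k + 15) g"
proof (cases "T = 1")
  case True
  have "pt ` {s..<s + T} = {pt s}" using True by auto
  then have "cycle_from 1 (pt s) (pt ` {s..<s + T})"
    by (auto simp: cycle_from_def)
  then show ?thesis using sh_mono[OF sh_1] by blast
next
  case False
  define l where "l = T - 2"
  have "3 \<le> T" using False T by (cases T) (auto elim!: oddE)
  then have l: "T = l + 2" "odd l" "l < 2 ^ k - 1" using T by (auto simp: l_def)
  let ?g = "pa ^ l * inverse (onP zM ^ l)" and ?h = "onP zM ^ (s + (l + 1))"
  have c: "cycle_from (cj ?g ?h) (app ?h (pt (2 ^ k - l))) (app ?h ` pt ` {2 ^ k - l..<2 ^ k - l + (l + 2)})"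
    by (rule cycle_from_cj[OF odd_window[OF l(2,3)]])
  have "(\<lambda>i. app ?h (pt i)) ` {2 ^ k - l..<2 ^ k - l + T} = pt ` {s..<s + T}"
  proof -
    have "app ?h (pt (2 ^ k - l + j)) = pt (s + j)" for j
    proof -
      have "2 ^ k - l + j + (s + (l + 1)) = s + j + (2 ^ k + 1)" using l(3) by simp
      then show ?thesis by (simp only: app_rotation(1) pt_add_Q)
    qed
    moreover have "{2 ^ k - l..<2 ^ k - l + T} = (\<lambda>j. 2 ^ k - l + j) ` {0..<T}" "{s..<s + T} = (\<lambda>j. s + j) ` {0..<T}"
      by (simp_all add: add.commute)
    ultimately show ?thesis by (simp only: image_image)
  qed
  moreover have "sh ((15 * k + 4) + ((9 * k + 3) + (15 * k + 4)) + (15 * k + 4)) (cj ?g ?h)"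
    by (intro sh_cj sh_mult sh_inverse sh_pa_power sh_rotation)
  then have "sh (54 * k + 15) (cj ?g ?h)" by (rule sh_mono) simp
  ultimately show ?thesis using c unfolding image_image l(1)[symmetric] by auto
qed

lemma sh_tr_None: "sh (30 * k + 9) (tr None (pt i))"
proof -
  have "tr None (pt i) = cj pe (onP zM ^ i)"
    using app_rotation(1)[of i 0] app_rotation(2)[of i] by (simp add: cj_tr pt_0)
  moreover have "sh 1 pe" using sh_letter[of 0] by simp
  ultimately show ?thesis using sh_mono[OF sh_cj[OF _ sh_rotation]] by simp
qed

lemma sh_tr: "sh (90 * k + 27) (tr (pt i) (pt j))"
proof (cases "pt i = pt j")
  case True
  then show ?thesis using sh_mono[OF sh_1] by simp
next
  case False
  have "tr None (pt i) * tr None (pt j) * tr None (pt i) = tr (pt i) (pt j)"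
    using False by (intro tr_conj3) (simp_all add: pt_def)
  moreover have "sh ((30 * k + 9) + (30 * k + 9) + (30 * k + 9)) (tr None (pt i) * tr None (pt j) * tr None (pt i))"
    by (intro sh_mult sh_tr_None)
  ultimately show ?thesis using sh_mono by fastforce
qed

text \<open>An even arc is an odd arc with one more point, appended by a transposition as in
  \<open>cycle_from_extend\<close>; the bound is the sum of those in \<open>odd_arc\<close> and
  \<open>sh_tr\<close>.\<close>

lemma arc:
  assumes T: "1 \<le> T" "T \<le> 2 ^ k"
  shows "\<exists>g x. cycle_from g x (pt ` {s..<s + T}) \<and> sh (144 * k + 42) g"
proof (cases "odd T")
  case True
  moreover have "even ((2::nat) ^ k)" using k_ge by simp
  ultimately have "T < 2 ^ k" using T by (cases "T = 2 ^ k") auto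
  then obtain g x where "cycle_from g x (pt ` {s..<s + T})" "sh (54 * k + 15) g" using odd_arc True by blast
  moreover from this(2) have "sh (144 * k + 42) g" by (rule sh_mono) simp
  ultimately show ?thesis by blast
next
  case False
  then obtain t where t: "T = Suc t" "odd t" using T by (cases T) auto
  then obtain g x where g: "cycle_from g x (pt ` {s..<s + t})" "sh (54 * k + 15) g"
    using odd_arc[of t s] T by auto
  have "pt (s + t) \<notin> pt ` {s..<s + t}"
    using inj_on_image_mem_iff[OF pt_inj[of s], of "s + t" "{s..<s + t}"] t T by auto
  then have "cycle_from (g * tr x (pt (s + t))) (pt (s + t)) (insert (pt (s + t)) (pt ` {s..<s + t}))"
    by (rule cycle_from_extend[OF g(1)])
  moreover have "insert (pt (s + t)) (pt ` {s..<s + t}) = pt ` {s..<s + T}"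
    by (simp add: t(1) atLeastLessThanSuc)
  moreover have "sh ((54 * k + 15) + (90 * k + 27)) (g * tr x (pt (s + t)))"
  proof -
    obtain i where "x = pt i" using g(1) by (auto simp: cycle_from_def)
    then show ?thesis using sh_mult[OF g(2) sh_tr] by simp
  qed
  then have "sh (144 * k + 42) (g * tr x (pt (s + t)))" by (rule sh_mono) simp
  ultimately show ?thesis by metis
qed

end

section \<open>Glueing two copies\<close>

text \<open>A transposition that avoids the centre is a product of three star transpositions, so
  right multiplication by the star suffices.\<close>

lemma Sym_star_induct [consumes 2, case_names one step]:
  assumes fin: "finite B" and p: "p \<in> Sym (insert c B)"
    and one: "P 1" and step: "\<And>p i. p \<in> Sym (insert c B) \<Longrightarrow> i \<in> B \<Longrightarrow> P p \<Longrightarrow> P (p * tr c i)"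
  shows "P p"
proof -
  have "finite (insert c B)" using fin by simp
  then show ?thesis using p
  proof (induction rule: Sym_induct)
    case one
    show ?case by (rule \<open>P 1\<close>)
  next
    case (step p x y)
    have s: "P (q * tr c i)" if "P q" "q \<in> Sym (insert c B)" "i \<in> insert c B" for q i
      using that \<open>\<And>p i. p \<in> Sym (insert c B) \<Longrightarrow> i \<in> B \<Longrightarrow> P p \<Longrightarrow> P (p * tr c i)\<close> by (cases "i = c") auto
    have S: "tr c i \<in> Sym (insert c B)" if "i \<in> insert c B" for i using that by (simp add: Sym_tr)
    consider "x = c" | "y = c" | "x \<noteq> c" "y \<noteq> c" by blast
    then show ?case
    proof cases
      case 1
      then show ?thesis using s step by blast
    next
      case 2
      then show ?thesis using s[of p x] step tr_sym[of x y] by simp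
    next
      case 3
      have "tr c x * tr c y * tr c x = tr x y"
        using cj_tr[of c y "tr c x"] 3 step.hyps by (simp add: cj_def app_tr)
      then have "p * tr x y = p * tr c x * tr c y * tr c x" by (simp only: mult.assoc)
      moreover have "P (p * tr c x * tr c y * tr c x)"
        by (intro s Sym_mult S step)
      ultimately show ?thesis by simp
    qed
  qed
qed

lemma generated_star:
  fixes ev :: "nat \<Rightarrow> 'a prm"
  assumes B: "finite B" and p: "p \<in> Sym (insert c B)"
    and star: "\<And>i. i \<in> B \<Longrightarrow> \<exists>v\<in>words X. wev ev v = tr c i"
  shows "\<exists>v\<in>words X. wev ev v = p"
  using B p
proof (induction rule: Sym_star_induct)
  case one
  show ?case by (rule bexI[of _ "[]"]) simp_all
next
  case (step p i)
  then obtain v v2 where "v \<in> words X" "wev ev v = p" "v2 \<in> words X" "wev ev v2 = tr c i"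
    using star by blast
  then show ?case by (intro bexI[of _ "v @ v2"]) simp_all
qed

text \<open>Here \<open>d\<close> is the transposition of the centre and \<open>x0\<close>, and
  \<open>d * e j * d\<close> that of \<open>x0\<close> and \<open>j\<close>. The hypotheses involve
  at most two leaves besides \<open>x0\<close>, which suits the gluing: three leaves may be spread
  over both copies, but any two either lie in one copy or are subject to a commutation relation
  across the copies.\<close>

lemma star_hom_commuting:
  fixes d :: "'h::mgroup" and e :: "'i \<Rightarrow> 'h"
  assumes fin: "finite J" and x0: "x0 \<notin> J" and dd: "d * d = 1"
    and ee: "\<And>i. i \<in> J \<Longrightarrow> e i * e i = 1"
    and de: "\<And>i. i \<in> J \<Longrightarrow> d * e i * d = e i * d * e i"
    and comm: "\<And>i j. i \<in> J \<Longrightarrow> j \<in> J \<Longrightarrow> i \<noteq> j \<Longrightarrow> cm (e i) (d * e j * d)"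
  shows "\<exists>f. hom_on (insert None (Some ` insert x0 J)) f \<and> f (tr None (Some x0)) = d \<and>
    (\<forall>i\<in>J. f (tr None (Some i)) = e i)"
proof -
  define b where "b i = d * e i * d" for i
  have dd': "d * (d * g) = g" for g using dd by (metis mult.assoc mult_1_left)
  have ee': "e i * (e i * g) = g" if "i \<in> J" for i g using ee[OF that] by (metis mult.assoc mult_1_left)
  have b2: "b i = e i * d * e i" if "i \<in> J" for i using de[OF that] by (simp add: b_def)
  have bb': "b i * (b i * g) = g" if "i \<in> J" for i g
    using that by (simp add: b_def mult.assoc dd' ee')
  have c: "e i * b j = b j * e i" if "i \<in> J" "j \<in> J" "i \<noteq> j" for i j
    using comm[OF that] by (simp add: cm_def b_def)
  have bd: "b i * d * b i = e i" if "i \<in> J" for i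
  proof -
    have "b i * d * b i = e i * ((d * e i * d) * (e i * d * e i))"
      by (simp only: b2[OF that] mult.assoc)
    also have "\<dots> = e i * (b i * (b i * 1))"
      by (simp only: b_def[symmetric] b2[OF that, symmetric] mult_1_right)
    also have "\<dots> = e i" by (simp only: bb'[OF that]) simp
    finally show ?thesis .
  qed
  \<comment> \<open>Substituting \<open>e j = b j * d * b j\<close> and moving \<open>b j\<close>
    across \<open>e i\<close> gives one form, resolving \<open>e i\<close> instead gives the other.
    Together they yield the braid relation of \<open>e i\<close> and \<open>e j\<close>, and the
    second one makes \<open>e i * e j * e i\<close> commute with \<open>d\<close> and with every
    further leaf.\<close>
  have e1: "e i * e j * e i = b j * b i * b j" if ij: "i \<in> J" "j \<in> J" "i \<noteq> j" for i j
  proof -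
    have "e i * e j * e i = (e i * b j) * d * (b j * e i)"
      by (simp only: bd[OF ij(2), symmetric] mult.assoc)
    also have "\<dots> = (b j * e i) * d * (e i * b j)" by (simp only: c[OF ij])
    also have "\<dots> = b j * (e i * d * e i) * b j" by (simp only: mult.assoc)
    finally show ?thesis by (simp only: b2[OF ij(1)] mult.assoc)
  qed
  have e2: "e i * e j * e i = b i * b j * b i" if ij: "i \<in> J" "j \<in> J" "i \<noteq> j" for i j
  proof -
    have "e i * e j * e i = b i * d * (b i * e j * b i) * d * b i"
      by (simp only: bd[OF ij(1), symmetric] mult.assoc)
    also have "b i * e j * b i = e j"
      using c[OF ij(2,1)] ij bb' by (metis mult.assoc mult_1_right)
    finally show ?thesis by (simp only: b_def[of j] mult.assoc)
  qed
  have db: "d * b i = e i * d" "b i * d = d * e i" for i by (simp_all add: b_def mult.assoc dd' dd)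
  define E where "E i = (if i = x0 then d else e i)" for i
  have Ed: "E x0 = d" and Ee: "\<And>i. i \<in> J \<Longrightarrow> E i = e i" using x0 by (auto simp: E_def)
  have "\<exists>f. hom_on (insert None (Some ` insert x0 J)) f \<and> (\<forall>i\<in>insert x0 J. f (tr None (Some i)) = E i)"
  proof (rule star_hom)
    show "finite (insert x0 J)" using fin by simp
    show "E i * E i = 1" if "i \<in> insert x0 J" for i
      using that dd ee Ed Ee by auto
    show "E i * E j * E i = E j * E i * E j" if ij: "i \<in> insert x0 J" "j \<in> insert x0 J" "i \<noteq> j" for i j
    proof -
      consider "i = x0" "j \<in> J" | "j = x0" "i \<in> J" | "i \<in> J" "j \<in> J" using ij by blast
      then show ?thesis
      proof cases
        case 3
        then show ?thesis using e1[of i j] e2[of j i] Ee \<open>i \<noteq> j\<close> by simp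
      qed (use Ed Ee de in simp_all)
    qed
    show "cm (E i * E j * E i) (E l)"
      if ijl: "i \<in> insert x0 J" "j \<in> insert x0 J" "l \<in> insert x0 J" "i \<noteq> j" "i \<noteq> l" "j \<noteq> l" for i j l
    proof -
      have bl: "cm (b i) (e l)" if "i \<in> J" "l \<in> J" "i \<noteq> l" for i l
        using comm[of l i] that cm_sym[of "e l" "b i"] by (simp add: b_def)
      consider "i = x0" "j \<in> J" "l \<in> J" | "j = x0" "i \<in> J" "l \<in> J" | "l = x0" "i \<in> J" "j \<in> J"
        | "i \<in> J" "j \<in> J" "l \<in> J" using ijl by blast
      then show ?thesis
      proof cases
        case 1
        then show ?thesis using bl[of j l] that by (simp add: Ed Ee b_def)
      next
        case 2
        then show ?thesis using bl[of i l] that by (simp add: Ed Ee b2)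
      next
        case 3
        have "d * (b i * b j * b i) = e i * e j * e i * d" by (simp only: mult.assoc[symmetric] db(1)) (simp only: mult.assoc db(1))
        then have "cm d (e i * e j * e i)" using e2[of i j] 3 that by (simp add: cm_def)
        then show ?thesis using 3 by (simp add: Ed Ee cm_sym)
      next
        case 4
        have "cm (b i * b j * b i) (e l)"
          using 4 that bl by (intro cm_mult2) simp_all
        then show ?thesis using 4 that e2[of i j] by (simp add: Ee)
      qed
    qed
  qed
  then show ?thesis using Ed Ee by auto
qed

text \<open>The type \<open>'h\<close> is where the universal property is tested.\<close>

definition presents :: "'h::mgroup itself \<Rightarrow> nat \<Rightarrow> nat word list \<Rightarrow> 'a set \<Rightarrow> (nat \<Rightarrow> 'a prm) \<Rightarrow> bool" where
  "presents _ g rs A ev \<longleftrightarrow> (\<forall>r\<in>set rs. r \<in> words {..<g} \<and> wev ev r = 1) \<and>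
     (\<forall>i<g. ev i \<in> Sym A) \<and> (\<forall>p\<in>Sym A. \<exists>v\<in>words {..<g}. wev ev v = p) \<and>
     (\<forall>h::nat \<Rightarrow> 'h. (\<forall>r\<in>set rs. wev h r = 1) \<longrightarrow> (\<exists>\<psi>. hom_on A \<psi> \<and> (\<forall>i<g. \<psi> (ev i) = h i)))"

section \<open>Transport of permutations along injections\<close>

definition push :: "('a \<Rightarrow> 'b) \<Rightarrow> 'a prm \<Rightarrow> 'b prm" where
  "push f p = Prm (\<lambda>b. if b \<in> range f then f (app p (inv_into UNIV f b)) else b)"

lemma app_push:
  assumes f: "inj f"
  shows "app (push f p) (f x) = f (app p x)" "b \<notin> range f \<Longrightarrow> app (push f p) b = b"
proof -
  let ?g = "\<lambda>p b. if b \<in> range f then f (app p (inv_into UNIV f b)) else b"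
  have inv: "?g q (?g p b) = b" if "p * q = 1" for p q :: "'a prm" and b
    using that by (auto simp: f inv_f_f simp flip: app_mult)
  have "bij (?g p)"
  proof (rule o_bij)
    show "?g (inverse p) \<circ> ?g p = id" unfolding fun_eq_iff comp_apply id_apply using inv[of p "inverse p"] by simp
    show "?g p \<circ> ?g (inverse p) = id" unfolding fun_eq_iff comp_apply id_apply using inv[of "inverse p" p] by simp
  qed
  then have "app (push f p) = ?g p" unfolding push_def by (simp add: Prm_inverse)
  then show "app (push f p) (f x) = f (app p x)" "b \<notin> range f \<Longrightarrow> app (push f p) b = b"
    by (simp_all add: f inv_f_f)
qed

lemma push_eqI:
  assumes f: "inj f" and "\<And>x. app q (f x) = f (app p x)" "\<And>b. b \<notin> range f \<Longrightarrow> app q b = b"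
  shows "push f p = q"
proof (rule prm_eqI)
  fix b
  show "app (push f p) b = app q b"
    using assms app_push[OF f] by (cases "b \<in> range f") auto
qed

lemma push_one: "inj f \<Longrightarrow> push f 1 = 1"
  by (rule push_eqI) simp_all

lemma push_mult: "inj f \<Longrightarrow> push f (p * q) = push f p * push f q"
  by (rule push_eqI) (simp_all add: app_push)

lemma push_inverse: "inj f \<Longrightarrow> push f (inverse p) = inverse (push f p)"
  by (rule inv_unique[symmetric]) (simp add: push_one flip: push_mult)

lemma push_tr: "inj f \<Longrightarrow> push f (tr x y) = tr (f x) (f y)"
  by (rule push_eqI) (auto simp: app_tr transpose_def inj_eq)

lemma push_Sym: "inj f \<Longrightarrow> p \<in> Sym B \<Longrightarrow> push f p \<in> Sym (f ` B)"
proof -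
  assume f: "inj f" and p: "p \<in> Sym B"
  have "app (push f p) b = b" if "b \<notin> f ` B" for b
  proof (cases "b \<in> range f")
    case True
    then obtain x where "b = f x" by blast
    then show ?thesis using that p by (auto simp: app_push[OF f] Sym_def)
  qed (simp add: app_push[OF f])
  then show ?thesis by (simp add: Sym_def)
qed

text \<open>Used for the relations that identify the two copies: both embeddings carry a permutation
  of shared points to the same permutation.\<close>

lemma push_agree:
  assumes f: "inj f" "inj g" and p: "p \<in> Sym B" and eq: "\<And>x. x \<in> B \<Longrightarrow> f x = g x"
  shows "push f p = push g p"
proof (rule prm_eqI)
  fix b
  show "app (push f p) b = app (push g p) b"
  proof (cases "b \<in> f ` B")
    case True
    then obtain x where x: "b = f x" "x \<in> B" by blast
    then have "app (push g p) b = g (app p x)" using eq app_push(1)[OF f(2)] by simp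
    then show ?thesis using x eq[OF iffD2[OF Sym_app_mem[OF p] x(2)]] app_push(1)[OF f(1)] by simp
  next
    case False
    moreover have "f ` B = g ` B" using eq by (rule image_cong[OF HOL.refl])
    ultimately show ?thesis using push_Sym[OF f(1) p] push_Sym[OF f(2) p] by (simp add: Sym_def)
  qed
qed

lemma wev_push: "inj f \<Longrightarrow> wev (\<lambda>i. push f (ev i)) v = push f (wev ev v)"
  by (induction v) (auto simp: push_one push_mult push_inverse)

lemma cm_Sym_disjoint: "p \<in> Sym A \<Longrightarrow> q \<in> Sym B \<Longrightarrow> A \<inter> B = {} \<Longrightarrow> cm p q"
proof -
  assume p: "p \<in> Sym A" and q: "q \<in> Sym B" and AB: "A \<inter> B = {}"
  have "app (p * q) x = app (q * p) x" for x
  proof (cases "x \<in> A")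
    case True
    then have "x \<notin> B" "app p x \<notin> B" using AB Sym_app_mem[OF p] by blast+
    then show ?thesis using q by (simp add: Sym_def)
  next
    case False
    show ?thesis
    proof (cases "x \<in> B")
      case True
      then have "app q x \<notin> A" using AB Sym_app_mem[OF q] by blast
      then show ?thesis using False p by (simp add: Sym_def)
    qed (use False p q in \<open>simp add: Sym_def\<close>)
  qed
  then show ?thesis unfolding cm_def by (rule prm_eqI)
qed

definition shift_word :: "nat word \<Rightarrow> nat word" where
  "shift_word = map (\<lambda>(x, b). (x + 7, b))"

lemma length_shift_word [simp]: "length (shift_word v) = length v"
  by (simp add: shift_word_def)

lemma wev_shift_word: "wev h (shift_word v) = wev (\<lambda>x. h (x + 7)) v"
  by (induction v) (auto simp: shift_word_def)

lemma words_shift_word: "v \<in> words {..<7} \<Longrightarrow> shift_word v \<in> words {..<14}"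
  by (induction v) (auto simp: shift_word_def)

lemma words_mono: "v \<in> words X \<Longrightarrow> X \<subseteq> Y \<Longrightarrow> v \<in> words Y"
  by (induction v) auto

lemma length_comm_word [simp]: "length (comm_word v w) = 2 * (length v + length w)"
  by (simp add: comm_word_def)

lemma words_comm_word: "v \<in> words X \<Longrightarrow> w \<in> words X \<Longrightarrow> comm_word v w \<in> words X"
  by (simp add: comm_word_def)

section \<open>Two base presentations sharing the complement of an arc\<close>

context gf begin

lemma length_base_word: "r \<in> set base_words \<Longrightarrow> length r \<le> 40 * k"
proof -
  have i: "isqrt (1 + z) \<in> F" "isqrt z \<in> F" using isqrt z1 z_F z_nz by blast+
  have H: "length (wHd u a w (isqrt (1 + z))) \<le> 9 * k + 3" "length (wHd u a w (isqrt z)) \<le> 9 * k + 3" for u a w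
    using i length_wHd by blast+
  have U: "length (wU u a (z ^ k)) \<le> 3 * k" "length (wU u a y) \<le> 3 * k" for u a
    using length_wU zpow_F y_F by blast+
  have S: "length r \<le> 40 * k" if "r \<in> set (SL2_words u a w)" for r u a w
    using that H[of u a w] U(1)[of u a] k_ge unfolding SL2_words_def Let_def by auto
  show "r \<in> set base_words \<Longrightarrow> length r \<le> 40 * k"
    using S[of r 1 2 3] S[of r 4 5 6] U(2)[of 4 5] k_ge unfolding base_words_def Let_def by auto
qed

text \<open>The second copy of the base presentation, in letters shifted by 7, acts on \<open>(i, True)\<close> for \<open>i\<close> in an
  arc \<open>D\<close> and shares the remaining points \<open>(i, False)\<close> with the first one. The extra relations identify the two
  subgroups on the shared points, and make the permutations of the center and \<open>D\<close> in the first copy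
  commute with those of \<open>x0\<close> and \<open>D\<close> in the second.\<close>

lemma glue:
  assumes d: "1 \<le> d" "d \<le> 2 ^ k"
  shows "\<exists>rs (A :: ('k option \<times> bool) option set) ev. presents TYPE('h::mgroup) 14 rs A ev \<and>
    finite A \<and> card A = 2 ^ k + 2 + d \<and> length rs = 54 \<and> sum_list (map length rs) \<le> 7000 * k"
proof -
  let ?pt = "\<lambda>n. (zM ^^ n) None"
  let ?Q = "2 ^ k :: nat"
  define D where "D = ?pt ` {0..<d}"
  define R where "R = ?pt ` {d..<d + (?Q + 1 - d)}"
  have SD: "Some ` D = pt ` {0..<0 + d}" and SR: "Some ` R = pt ` {d..<d + (?Q + 1 - d)}"
    by (simp_all add: D_def R_def pt_def image_image)
  have "{0..<0 + (?Q + 1)} = {0..<d} \<union> {d..<d + (?Q + 1 - d)}" using d by auto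
  then have "Some ` P1 = Some ` D \<union> Some ` R"
    using pt_image[of 0] SD SR by (simp only: image_Un add_0)
  then have PDR: "P1 = D \<union> R" by (auto simp del: insert_iff)
  have "pt ` {0..<d} \<inter> pt ` {d..<d + (?Q + 1 - d)} = pt ` ({0..<d} \<inter> {d..<d + (?Q + 1 - d)})"
    by (rule inj_on_image_Int[OF pt_inj[of 0], symmetric]) (use d in auto)
  then have "Some ` D \<inter> Some ` R = {}" unfolding SD SR by simp
  then have DR: "D \<inter> R = {}" by blast
  have DP: "D \<subseteq> P1" and RP: "R \<subseteq> P1" using PDR by blast+
  have finD: "finite D" by (simp add: D_def)
  have cardD: "card D = d"
  proof -
    have "card (Some ` D) = card {0..<d}"
      unfolding SD using inj_on_subset[OF pt_inj[of 0], of "{0..<d}"] d by (simp add: card_image)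
    then show ?thesis by (simp add: card_image)
  qed
  obtain gR x where gR: "cycle_from gR x (Some ` R)" and sR: "sh (144 * k + 42) gR"
  proof -
    have "1 \<le> ?Q + 1 - d" "?Q + 1 - d \<le> ?Q" using d by simp_all
    then show ?thesis using arc[of "?Q + 1 - d" d] that unfolding SR by blast
  qed
  obtain gD y' where gD: "cycle_from gD y' (Some ` D)" and sD: "sh (144 * k + 42) gD"
    using arc[OF d, of 0] unfolding SD by blast
  obtain x0 where x0: "x = Some x0" "x0 \<in> R" using gR by (auto simp: cycle_from_def)
  obtain y0 where y0: "y' = Some y0" "y0 \<in> D" using gD by (auto simp: cycle_from_def)
  obtain ix where ix: "Some x0 = pt ix" using x0 SR by blast
  obtain iy where iy: "Some y0 = pt iy" using y0 SD by blast
  \<comment> \<open>A common bound for the five words; the constant 165 makes the second inequality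
    sharp at \<open>k = 2\<close>.\<close>
  have L: "30 * k + 9 \<le> 165 * k" "144 * k + 42 \<le> 165 * k" "90 * k + 27 \<le> 165 * k" using k_ge by simp_all
  have "sh (165 * k) gR" "sh (165 * k) gD" "sh (165 * k) (tr None (Some x0))" "sh (165 * k) (tr None (Some y0))"
    "sh (165 * k) (tr (Some x0) (Some y0))"
    unfolding ix iy using sh_mono[OF sR L(2)] sh_mono[OF sD L(2)] sh_mono[OF sh_tr_None L(1)] sh_mono[OF sh_tr L(3)]
    by blast+
  then obtain wR wD tx ty txy where
    wR: "wR \<in> words {..<7}" "length wR \<le> 165 * k" "wev base_ev wR = gR" and
    wD: "wD \<in> words {..<7}" "length wD \<le> 165 * k" "wev base_ev wD = gD" and
    tx: "tx \<in> words {..<7}" "length tx \<le> 165 * k" "wev base_ev tx = tr None (Some x0)" and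
    ty: "ty \<in> words {..<7}" "length ty \<le> 165 * k" "wev base_ev ty = tr None (Some y0)" and
    txy: "txy \<in> words {..<7}" "length txy \<le> 165 * k" "wev base_ev txy = tr (Some x0) (Some y0)"
    unfolding sh_def by blast
  \<comment> \<open>The cycle on \<open>R\<close> and the transposition of the centre and
    \<open>x0\<close> generate all transpositions of the centre with shared points, so two relations
    identify them. Likewise \<open>wD\<close> with \<open>ty\<close>, and \<open>wD\<close> with
    \<open>txy\<close>, generate the two groups that must commute, whence four commutators.\<close>
  define extra where "extra = [wR @ winv (shift_word wR), tx @ winv (shift_word tx),
    comm_word wD (shift_word wD), comm_word wD (shift_word txy),
    comm_word ty (shift_word wD), comm_word ty (shift_word txy)]"
  define rs where "rs = base_words @ map shift_word base_words @ extra"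
  define I :: "('k option \<times> bool) set" where "I = P1 \<times> {False} \<union> D \<times> {True}"
  \<comment> \<open>The two embeddings of the base points agree at the centre and off
    \<open>D\<close>, and have disjoint images on \<open>D\<close>.\<close>
  define l1 :: "'k option option \<Rightarrow> ('k option \<times> bool) option" where "l1 = map_option (\<lambda>i. (i, False))"
  define l2 :: "'k option option \<Rightarrow> ('k option \<times> bool) option" where "l2 = map_option (\<lambda>i. (i, i \<in> D))"
  have l: "inj l1" "inj l2" unfolding l1_def l2_def by (intro option.inj_map injI; simp)+
  have l12: "l1 None = None" "l2 None = None" "l1 (Some i) = Some (i, False)" "l2 (Some i) = Some (i, i \<in> D)" for i
    by (simp_all add: l1_def l2_def)
  define ev where "ev i = (if i < 7 then push l1 (base_ev i) else push l2 (base_ev (i - 7)))" for i :: nat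
  define A where "A = insert None (Some ` I)"
  have finI: "finite I" unfolding I_def using finite_P1 finD by simp
  have Pts: "insert None (Some ` P1) = Pts" ..
  have evw: "wev ev v = push l1 (wev base_ev v)" "wev ev (shift_word v) = push l2 (wev base_ev v)"
    if "v \<in> words {..<7}" for v
  proof -
    have "wev ev v = wev (\<lambda>i. push l1 (base_ev i)) v"
      by (rule wev_cong[OF that]) (simp add: ev_def)
    then show "wev ev v = push l1 (wev base_ev v)" by (simp only: wev_push[OF l(1)])
    have "wev ev (shift_word v) = wev (\<lambda>i. push l2 (base_ev i)) v"
      by (simp add: wev_shift_word ev_def)
    then show "wev ev (shift_word v) = push l2 (wev base_ev v)" by (simp only: wev_push[OF l(2)])
  qed
  have xD: "x0 \<notin> D" using x0 DR by blast
  have gRS: "gR \<in> Sym (Some ` R)" and gDS: "gD \<in> Sym (Some ` D)" using gR gD by (simp_all add: cycle_from_def)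
  have extra_words: "r \<in> words {..<14}" if "r \<in> set extra" for r
  proof -
    note w = words_shift_word words_mono[of _ "{..<7}" "{..<14}"]
    show ?thesis using that wR(1) wD(1) tx(1) ty(1) txy(1) unfolding extra_def
      by (auto simp: w words_comm_word)
  qed
  have extra_ev: "wev ev r = 1" if r: "r \<in> set extra" for r
  proof -
    have "push l1 gR = push l2 gR"
      by (rule push_agree[OF l gRS]) (use DR in \<open>auto simp: l12\<close>)
    then have 1: "wev ev (wR @ winv (shift_word wR)) = 1" by (simp add: evw[OF wR(1)] wR(3))
    have "push l1 (tr None (Some x0)) = push l2 (tr None (Some x0))"
      using xD by (simp add: push_tr[OF l(1)] push_tr[OF l(2)] l12)
    then have 2: "wev ev (tx @ winv (shift_word tx)) = 1" by (simp add: evw[OF tx(1)] tx(3))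
    have cw: "wev ev (comm_word v (shift_word v')) = 1"
      if "wev base_ev v \<in> Sym (insert None (Some ` D))" "wev base_ev v' \<in> Sym (insert (Some x0) (Some ` D))"
        "v \<in> words {..<7}" "v' \<in> words {..<7}" for v v'
      unfolding wev_comm_word evw(1)[OF that(3)] evw(2)[OF that(4)]
      by (rule cm_Sym_disjoint[OF push_Sym[OF l(1) that(1)] push_Sym[OF l(2) that(2)]]) (use xD in \<open>auto simp: l12\<close>)
    have y: "Some y0 \<in> Some ` D" using y0(2) by (rule imageI)
    have gDS': "gD \<in> Sym (insert b (Some ` D))" for b by (rule subsetD[OF Sym_mono[OF subset_insertI] gDS])
    have yS: "tr b (Some y0) \<in> Sym (insert b (Some ` D))" for b by (rule Sym_tr[OF insertI1 insertI2[OF y]])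
    have wS: "wev base_ev wD \<in> Sym (insert b (Some ` D))" "wev base_ev ty \<in> Sym (insert None (Some ` D))"
      "wev base_ev txy \<in> Sym (insert (Some x0) (Some ` D))" for b
      unfolding wD(3) ty(3) txy(3) by (rule gDS' yS)+
    consider "r = wR @ winv (shift_word wR)" | "r = tx @ winv (shift_word tx)"
      | v v' where "r = comm_word v (shift_word v')" "v \<in> {wD, ty}" "v' \<in> {wD, txy}"
      using r unfolding extra_def by auto
    then show ?thesis
    proof cases
      case 3
      show ?thesis unfolding 3(1)
        by (rule cw)
          (use 3 wS wD(1) ty(1) txy(1) in auto)
    qed (use 1 2 in simp_all)
  qed
  have rels: "r \<in> words {..<14} \<and> wev ev r = 1" if r: "r \<in> set rs" for r
  proof -
    consider "r \<in> set base_words" | v where "r = shift_word v" "v \<in> set base_words" | "r \<in> set extra"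
      using r unfolding rs_def by auto
    then show ?thesis
    proof cases
      case 1
      then show ?thesis using base_words_words[OF 1] base_ev_rel[OF 1] words_mono[of r "{..<7}" "{..<14}"]
        by (simp add: evw push_one l)
    next
      case 2
      then show ?thesis using base_words_words[OF 2(2)] base_ev_rel[OF 2(2)] words_shift_word
        by (simp add: evw push_one l)
    next
      case 3
      then show ?thesis using extra_words extra_ev by blast
    qed
  qed
  have lP: "l1 ` Pts \<subseteq> A" "l2 ` Pts \<subseteq> A"
    by (auto simp: l12 A_def I_def simp del: insert_iff) (auto simp: l12)
  have evS: "ev i \<in> Sym A" if "i < 14" for i
  proof (cases "i < 7")
    case True
    have "push l1 (base_ev i) \<in> Sym (l1 ` Pts)" by (rule push_Sym[OF l(1) base_ev_Sym[OF True]])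
    then show ?thesis using True Sym_mono[OF lP(1)] by (auto simp: ev_def)
  next
    case False
    have "push l2 (base_ev (i - 7)) \<in> Sym (l2 ` Pts)" by (rule push_Sym[OF l(2) base_ev_Sym]) (use that in simp)
    then show ?thesis using False Sym_mono[OF lP(2)] by (auto simp: ev_def)
  qed
  have star_word: "\<exists>v\<in>words {..<7}. wev base_ev v = tr None (Some i)" if i: "i \<in> P1" for i
  proof -
    have "Some i \<in> pt ` {0..<0 + (?Q + 1)}" unfolding pt_image using i by (rule imageI)
    then obtain n where "Some i = pt n" by blast
    then show ?thesis using sh_tr_None[of n] by (auto simp: sh_def)
  qed
  have gen: "\<exists>v\<in>words {..<14}. wev ev v = p" if p: "p \<in> Sym A" for p
  proof (rule generated_star[of "Some ` I" _ None])
    show "finite (Some ` I)" using finI by simp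
    show "p \<in> Sym (insert None (Some ` I))" using p by (simp add: A_def)
    fix j assume "j \<in> Some ` I"
    then obtain i b where j: "j = Some (i, b)" "(i, b) \<in> I" by auto
    then have i: "i \<in> P1" using DP unfolding I_def by blast
    obtain v where v: "v \<in> words {..<7}" "wev base_ev v = tr None (Some i)" using star_word[OF i] by blast
    show "\<exists>v\<in>words {..<14}. wev ev v = tr None j"
    proof (cases b)
      case True
      then have "i \<in> D" using j unfolding I_def by blast
      then have "wev ev (shift_word v) = tr None j"
        using j True by (simp add: evw v push_tr l l12)
      then show ?thesis using words_shift_word[OF v(1)] by blast
    next
      case False
      then have "wev ev v = tr None j" using j by (simp add: evw v push_tr l l12)
      then show ?thesis using words_mono[OF v(1), of "{..<14}"] by auto
    qed
  qed
  have univ: "\<exists>\<psi>. hom_on A \<psi> \<and> (\<forall>i<14. \<psi> (ev i) = h i)" if h: "\<forall>r\<in>set rs. wev h r = 1" for h :: "nat \<Rightarrow> 'h"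
  proof -
    have "wev h r = 1" "wev (\<lambda>i. h (i + 7)) r = 1" if "r \<in> set base_words" for r
      using h that unfolding rs_def by (auto simp flip: wev_shift_word)
    then obtain p1 p2 where p1: "hom_on Pts p1" "\<And>i. i < 7 \<Longrightarrow> p1 (base_ev i) = h i"
      and p2: "hom_on Pts p2" "\<And>i. i < 7 \<Longrightarrow> p2 (base_ev i) = h (i + 7)"
      using base_universal[of h] base_universal[of "\<lambda>i. h (i + 7)"] by blast
    have w1: "wev h v = p1 (wev base_ev v)" and w2: "wev h (shift_word v) = p2 (wev base_ev v)"
      if v: "v \<in> words {..<7}" for v
    proof -
      have "wev h v = wev (\<lambda>i. p1 (base_ev i)) v" by (rule wev_cong[OF v]) (simp add: p1)
      also have "\<dots> = p1 (wev base_ev v)" by (rule wev_hom[OF v base_ev_Sym p1(1)]) simp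
      finally show "wev h v = p1 (wev base_ev v)" .
      have "wev h (shift_word v) = wev (\<lambda>i. p2 (base_ev i)) v"
        unfolding wev_shift_word by (rule wev_cong[OF v]) (simp add: p2)
      also have "\<dots> = p2 (wev base_ev v)" by (rule wev_hom[OF v base_ev_Sym p2(1)]) simp
      finally show "wev h (shift_word v) = p2 (wev base_ev v)" .
    qed
    have hx: "wev h r = 1" if "r \<in> set extra" for r using h that unfolding rs_def by simp
    have hxe: "wev h (v @ winv v') = 1 \<longleftrightarrow> wev h v = wev h v'" for v v' using mult_inverse_eq_1_iff by simp
    have eqR: "p1 gR = p2 gR" and eqx: "p1 (tr None (Some x0)) = p2 (tr None (Some x0))"
      using hx[of "wR @ winv (shift_word wR)"] hx[of "tx @ winv (shift_word tx)"] wR tx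
      unfolding hxe by (simp_all add: extra_def w1 w2)
    have cms: "cm (p1 gD) (p2 gD)" "cm (p1 gD) (p2 (tr (Some x0) (Some y0)))"
      "cm (p1 (tr None (Some y0))) (p2 gD)" "cm (p1 (tr None (Some y0))) (p2 (tr (Some x0) (Some y0)))"
      using hx[of "comm_word wD (shift_word wD)"] hx[of "comm_word wD (shift_word txy)"]
        hx[of "comm_word ty (shift_word wD)"] hx[of "comm_word ty (shift_word txy)"] wD ty txy
      unfolding wev_comm_word by (simp_all add: extra_def w1 w2)
    define T where "T p i = p (tr None (Some i))" for p :: "'k option option prm \<Rightarrow> 'h" and i
    have trP: "tr None (Some i) \<in> Sym Pts" if "i \<in> P1" for i
      by (rule Sym_tr[OF insertI1 insertI2[OF imageI[OF that]]])
    have trPP: "tr (Some i) (Some j) \<in> Sym Pts" if "i \<in> P1" "j \<in> P1" for i j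
      by (rule Sym_tr[OF insertI2[OF imageI[OF that(1)]] insertI2[OF imageI[OF that(2)]]])
    have SP: "Some ` D \<subseteq> Pts" "Some ` R \<subseteq> Pts"
      by (rule subset_insertI2[OF image_mono[OF DP]], rule subset_insertI2[OF image_mono[OF RP]])
    have gP: "gD \<in> Sym Pts" "gR \<in> Sym Pts"
      using Sym_mono[OF SP(1)] Sym_mono[OF SP(2)] gDS gRS by blast+
    have x0P: "x0 \<in> P1" and y0P: "y0 \<in> P1" using x0 y0 DP RP by blast+
    have fixD: "app (gD ^ n) None = None" "app (gD ^ n) (Some x0) = Some x0" for n
      using Sym_power[OF gDS, of n] xD by (auto simp: Sym_def)
    have fixR: "app (gR ^ n) None = None" for n
      using Sym_power[OF gRS, of n] by (auto simp: Sym_def)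
    have hc: "p (cj g (g' ^ n)) = cj (p g) (p g' ^ n)" if "hom_on Pts p" "g \<in> Sym Pts" "g' \<in> Sym Pts"
      for p :: "'k option option prm \<Rightarrow> 'h" and g g' n
      using that by (simp add: hom_on_cj hom_on_power Sym_power)
    have agree: "T p1 i = T p2 i" if i: "i \<in> R" for i
    proof -
      obtain n where n: "app (gR ^ n) (Some x0) = Some i" using gR i x0 unfolding cycle_from_def by blast
      then have "tr None (Some i) = cj (tr None (Some x0)) (gR ^ n)" by (simp add: cj_tr fixR)
      then show ?thesis unfolding T_def
        by (simp only: hc[OF p1(1) trP[OF x0P] gP(2)] hc[OF p2(1) trP[OF x0P] gP(2)] eqR eqx)
    qed
    \<comment> \<open>The commutation at \<open>y0\<close> spreads to all pairs: powers of
      \<open>p1 gD\<close> move the left index and commute with the right factor, powers of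
      \<open>p2 gD\<close> move the right index and commute with the left one. The case
      \<open>i = j\<close> is included, since these are different points of the glued set.\<close>
    have DD: "cm (T p1 i) (p2 (tr (Some x0) (Some j)))" if i: "i \<in> D" and j: "j \<in> D" for i j
    proof -
      obtain n where n: "app (gD ^ n) (Some y0) = Some i" using gD i y0 unfolding cycle_from_def by blast
      obtain m where m: "app (gD ^ m) (Some y0) = Some j" using gD j y0 unfolding cycle_from_def by blast
      have "tr None (Some i) = cj (tr None (Some y0)) (gD ^ n)"
        "tr (Some x0) (Some j) = cj (tr (Some x0) (Some y0)) (gD ^ m)"
        using n m by (simp_all add: cj_tr fixD)
      then have "T p1 i = cj (p1 (tr None (Some y0))) (p1 gD ^ n)"
        "p2 (tr (Some x0) (Some j)) = cj (p2 (tr (Some x0) (Some y0))) (p2 gD ^ m)"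
        unfolding T_def by (simp_all only: hc[OF p1(1) trP[OF y0P] gP(1)] hc[OF p2(1) trPP[OF x0P y0P] gP(1)])
      then show ?thesis
        by (simp only:) (intro cm_cj2 cm_power; rule cm_sym; intro cm_cj2 cm_power; rule cm_sym; rule cms)
    qed
    define d where "d = T p1 x0"
    have d2: "d = T p2 x0" using agree x0(2) by (simp add: d_def)
    have sq: "T p i * T p i = 1" if "hom_on Pts p" "i \<in> P1" for p i
      using hom_onD[OF that(1) trP[OF that(2)] trP[OF that(2)]] hom_on_one[OF that(1)] by (simp add: T_def)
    have h3: "p (tr (Some x0) (Some i)) = T p x0 * T p i * T p x0"
      "p (tr (Some x0) (Some i)) = T p i * T p x0 * T p i"
      if "hom_on Pts p" "i \<in> P1" "i \<noteq> x0" for p i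
    proof -
      have 1: "tr (Some x0) (Some i) = tr None (Some x0) * tr None (Some i) * tr None (Some x0)"
        by (rule tr_conj3[symmetric]) (use that in simp_all)
      have 2: "tr (Some i) (Some x0) = tr None (Some i) * tr None (Some x0) * tr None (Some i)"
        by (rule tr_conj3[symmetric]) (use that in simp_all)
      note hm = hom_onD[OF that(1)] Sym_mult[OF trP trP] trP that(2) x0P
      show "p (tr (Some x0) (Some i)) = T p x0 * T p i * T p x0"
        unfolding 1 T_def by (simp only: hm)
      show "p (tr (Some x0) (Some i)) = T p i * T p x0 * T p i"
        unfolding tr_sym[of "Some x0"] 2 T_def by (simp only: hm)
    qed
    have same: "cm (T p i) (T p x0 * T p j * T p x0)"
      if "hom_on Pts p" "i \<in> P1" "j \<in> P1" "i \<noteq> j" "i \<noteq> x0" "j \<noteq> x0" for p i j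
    proof -
      have "cm (tr None (Some i)) (tr (Some x0) (Some j))"
        using that by (simp add: cm_iff_cj cj_tr app_tr)
      then have "cm (T p i) (p (tr (Some x0) (Some j)))"
        unfolding cm_def T_def
        by (simp only: hom_onD[OF that(1), symmetric] trP[OF that(2)] trPP[OF x0P that(3)])
      then show ?thesis by (simp only: h3(1)[OF that(1,3,6)])
    qed
    define E where "E ib = (if snd ib then T p2 (fst ib) else T p1 (fst ib))" for ib
    define J where "J = I - {(x0, False)}"
    have xI: "(x0, False) \<in> I" using x0P unfolding I_def by blast
    have JI: "insert (x0, False) J = I" unfolding J_def using xI by blast
    \<comment> \<open>Each leaf lies in one copy together with the centre and \<open>x0\<close>, so
      the involution and braid relations can be checked in that copy.\<close>
    have JE: "\<exists>p. hom_on Pts p \<and> d = T p x0 \<and> E ib = T p (fst ib) \<and> fst ib \<in> P1 \<and> fst ib \<noteq> x0" if "ib \<in> J" for ib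
    proof -
      obtain i b where ib: "ib = (i, b)" by (cases ib)
      have *: "(b \<and> i \<in> D) \<or> (\<not> b \<and> i \<in> P1 \<and> i \<noteq> x0)" using that unfolding J_def I_def ib by auto
      show ?thesis
      proof (cases b)
        case True
        then have "i \<in> D" using * by blast
        then have "i \<in> P1" "i \<noteq> x0" using DP xD by blast+
        then show ?thesis using True p2(1) d2 by (intro exI[of _ p2]) (simp add: E_def ib del: insert_iff)
      next
        case False
        then show ?thesis using * p1(1) d_def by (intro exI[of _ p1]) (simp add: E_def ib del: insert_iff)
      qed
    qed
    have "\<exists>f. hom_on (insert None (Some ` insert (x0, False) J)) f \<and> f (tr None (Some (x0, False))) = d \<and>
      (\<forall>i\<in>J. f (tr None (Some i)) = E i)"
    proof (rule star_hom_commuting)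
      show "finite J" using finI by (simp add: J_def)
      show "(x0, False) \<notin> J" by (simp add: J_def)
      show "d * d = 1" unfolding d_def by (rule sq[OF p1(1) x0P])
      show "E i * E i = 1" if "i \<in> J" for i
        using JE[OF that] sq by metis
      show "d * E i * d = E i * d * E i" if "i \<in> J" for i
        using JE[OF that] h3 by metis
      show "cm (E ib) (d * E jc * d)" if ij: "ib \<in> J" "jc \<in> J" "ib \<noteq> jc" for ib jc
      proof -
        obtain i b where ib: "ib = (i, b)" by (cases ib)
        obtain j c where jc: "jc = (j, c)" by (cases jc)
        have i: "i \<in> P1" "i \<noteq> x0" "b \<Longrightarrow> i \<in> D" using ij(1) DP xD unfolding J_def I_def ib by auto
        have j: "j \<in> P1" "j \<noteq> x0" "c \<Longrightarrow> j \<in> D" using ij(2) DP xD unfolding J_def I_def jc by auto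
        have Ei: "E ib = (if b then T p2 i else T p1 i)" "E jc = (if c then T p2 j else T p1 j)"
          by (simp_all add: E_def ib jc)
        have ag: "T p1 i = T p2 i" if "i \<in> P1" "i \<notin> D" for i
          using agree that PDR by blast
        \<comment> \<open>A leaf outside \<open>D\<close> is visible in both copies, so two leaves
          either have a common copy or lie in the two different copies of \<open>D\<close>; only the
          latter case uses the commutators.\<close>
        consider "E ib = T p1 i" "E jc = T p1 j" "i \<noteq> j" | "E ib = T p2 i" "E jc = T p2 j" "i \<noteq> j"
          | "\<not> b" "c" "i \<in> D" "j \<in> D" | "b" "\<not> c" "i \<in> D" "j \<in> D"
        proof -
          consider "b = c" | "\<not> b" "c" | "b" "\<not> c" by blast
          then show ?thesis
          proof cases
            case 1
            then have "i \<noteq> j" using ij(3) ib jc by simp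
            then show ?thesis using that(1,2) Ei 1 by (cases c) simp_all
          next
            case 2
            then show ?thesis using that(2,3) Ei ag[OF i(1)] j(3) by (cases "i \<in> D") auto
          next
            case 3
            then show ?thesis using that(2,4) Ei ag[OF j(1)] i(3) by (cases "j \<in> D") auto
          qed
        qed
        then show ?thesis
        proof cases
          case 1
          show ?thesis unfolding 1(1,2) d_def by (rule same[OF p1(1) i(1) j(1) 1(3) i(2) j(2)])
        next
          case 2
          show ?thesis unfolding 2(1,2) d2 by (rule same[OF p2(1) i(1) j(1) 2(3) i(2) j(2)])
        next
          case 3
          have "d * E jc * d = p2 (tr (Some x0) (Some j))" using 3 by (simp add: Ei d2 h3(1)[OF p2(1) j(1,2)])
          then show ?thesis using 3 DD[OF 3(3,4)] Ei by simp
        next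
          case 4
          have dd: "d * d = 1" unfolding d_def by (rule sq[OF p1(1) x0P])
          have id: "inverse d = d" using dd by (rule power_invol)
          have "p2 (tr (Some x0) (Some i)) = cj (T p2 i) d"
            unfolding cj_def id unfolding d2 by (rule h3(1)[OF p2(1) i(1,2)])
          then have "cm (T p1 j) (cj (T p2 i) d)" using DD[OF 4(4,3)] by simp
          \<comment> \<open>\<open>DD\<close> puts the conjugation by \<open>d\<close> on the second
            copy; conjugating both sides by \<open>d\<close> transfers it to the first.\<close>
          then have "cm (cj (T p1 j) d) (cj (cj (T p2 i) d) d)" by (rule cm_cj)
          then have "cm (cj (T p1 j) d) (T p2 i)" by (simp add: cj_cj dd)
          then show ?thesis using 4 Ei cm_sym by (simp add: cj_def id)
        qed
      qed
    qed
    then obtain f where f: "hom_on A f" and fd: "f (tr None (Some (x0, False))) = d"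
      and fE: "\<And>i. i \<in> J \<Longrightarrow> f (tr None (Some i)) = E i"
      unfolding JI A_def by blast
    have fI: "f (tr None (Some i)) = E i" if "i \<in> I" for i
      using that fE[of i] fd by (cases "i = (x0, False)") (auto simp: J_def E_def d_def)
    \<comment> \<open>The values on the star transpositions determine the restriction of
      \<open>f\<close> to each embedded base group, which recovers the letters and not only the
      transpositions.\<close>
    have ext: "f (push l g) = p g"
      if g: "g \<in> Sym Pts" and p: "hom_on Pts p" and l: "inj l" "l ` Pts \<subseteq> A" "l None = None"
        and fp: "\<And>i. i \<in> P1 \<Longrightarrow> f (tr None (l (Some i))) = T p i"
      for g p and l :: "'k option option \<Rightarrow> ('k option \<times> bool) option"
    proof -
      have pS: "push l g \<in> Sym A" if "g \<in> Sym Pts" for g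
        using push_Sym[OF l(1) that] Sym_mono[OF l(2)] by blast
      have "finite (Some ` P1)" using finite_P1 by simp
      then show ?thesis using g
      proof (induction rule: Sym_star_induct)
        case one
        show ?case by (simp add: push_one[OF l(1)] hom_on_one[OF f] hom_on_one[OF p])
      next
        case (step g i)
        then obtain j where j: "i = Some j" "j \<in> P1" by blast
        have t: "push l (tr None i) = tr None (l (Some j))" by (simp add: push_tr[OF l(1)] l(3) j)
        have tS: "tr None i \<in> Sym Pts" unfolding j by (rule trP[OF j(2)])
        show ?case
          using hom_onD[OF f pS[OF step(1)] pS[OF tS]] hom_onD[OF p step(1) tS] step(3) fp[OF j(2)]
          unfolding push_mult[OF l(1)] t by (simp add: T_def j)
      qed
    qed
    have "f (push l1 g) = p1 g" if "g \<in> Sym Pts" for g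
    proof (rule ext[OF that p1(1) l(1) lP(1) l12(1)])
      fix i assume i: "i \<in> P1"
      then have "(i, False) \<in> I" unfolding I_def by blast
      then show "f (tr None (l1 (Some i))) = T p1 i" by (simp add: l12 fI E_def)
    qed
    moreover have "f (push l2 g) = p2 g" if "g \<in> Sym Pts" for g
    proof (rule ext[OF that p2(1) l(2) lP(2) l12(2)])
      fix i assume i: "i \<in> P1"
      then have "(i, i \<in> D) \<in> I" unfolding I_def by blast
      moreover have "i \<notin> D \<Longrightarrow> T p1 i = T p2 i" using i agree PDR by blast
      ultimately show "f (tr None (l2 (Some i))) = T p2 i" by (simp add: l12 fI E_def)
    qed
    ultimately have "f (ev i) = h i" if "i < 14" for i
      using that base_ev_Sym p1(2)[of i] p2(2)[of "i - 7"] by (simp add: ev_def)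
    then show ?thesis using f by blast
  qed
  have pr: "presents TYPE('h) 14 rs A ev"
    unfolding presents_def using rels evS gen univ by blast
  have "card (P1 \<times> {False} \<union> D \<times> {True}) = (?Q + 1) + d"
    using finite_P1 finD card_P1 cardD by (subst card_Un_disjoint) (auto simp: card_cartesian_product simp del: insert_iff)
  then have "card (Some ` I) = (?Q + 1) + d" by (simp only: card_image[OF inj_Some] I_def)
  then have cA: "card A = ?Q + 2 + d" unfolding A_def using finI by (subst card_insert_disjoint) auto
  have "sum_list (map length base_words) \<le> 24 * (40 * k)"
    using sum_list_mono[of base_words length "\<lambda>_. 40 * k"] length_base_word length_base_words by (simp add: sum_list_triv)
  moreover have "sum_list (map length extra) \<le> 3300 * k"
    using wR(2) wD(2) tx(2) ty(2) txy(2) by (simp add: extra_def)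
  moreover have "sum_list (map length (map shift_word base_words)) = sum_list (map length base_words)"
    by (simp add: comp_def)
  ultimately have len: "sum_list (map length rs) \<le> 7000 * k"
    unfolding rs_def map_append sum_list_append by linarith
  have "length rs = 54" by (simp add: rs_def length_base_words extra_def)
  then show ?thesis using pr cA len finI A_def by blast
qed

end

section \<open>Presentations of the symmetric groups\<close>

lemma wev_free_eq: "(u, v) \<in> free_eq X \<Longrightarrow> wev h u = wev h v"
proof (induction rule: free_eq.induct)
  case (cancel u v x b)
  then show ?case by (cases b) simp_all
qed simp_all

text \<open>The right regular representation, extended by the identity outside the carrier. It turns
  a group given by a carrier into an instance of \<open>mgroup\<close> on which the universal
  property can be tested; right multiplication matches products from left to right.\<close>

definition rmul :: "('g, 'm) monoid_scheme \<Rightarrow> 'g \<Rightarrow> 'g prm" where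
  "rmul G a = Prm (\<lambda>c. if c \<in> carrier G then c \<otimes>\<^bsub>G\<^esub> a else c)"

context Group.group begin

lemma app_rmul: "a \<in> carrier G \<Longrightarrow> app (rmul G a) = (\<lambda>c. if c \<in> carrier G then c \<otimes> a else c)"
proof -
  assume a: "a \<in> carrier G"
  have "bij_betw (\<lambda>c. c \<otimes> a) (carrier G) (carrier G)"
    by (rule bij_betw_byWitness[of _ "\<lambda>c. c \<otimes> inv a"]) (use a in \<open>auto simp: m_assoc\<close>)
  then show ?thesis unfolding rmul_def by (rule app_Prm_on)
qed

lemma rmul_mult: "a \<in> carrier G \<Longrightarrow> b \<in> carrier G \<Longrightarrow> rmul G (a \<otimes> b) = rmul G a * rmul G b"
  by (rule prm_eqI) (simp add: app_rmul m_assoc)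

lemma rmul_one: "rmul G \<one> = 1"
  by (rule prm_eqI) (simp add: app_rmul)

lemma rmul_eq_1: "a \<in> carrier G \<Longrightarrow> rmul G a = 1 \<Longrightarrow> a = \<one>"
  using app_rmul[of a] app_one[of \<one>] by (metis one_closed l_one)

lemma normal_normal_closure:
  assumes "S \<subseteq> carrier G"
  shows "normal_closure G S \<lhd> G"
proof -
  let ?A = "{N. N \<lhd> G \<and> S \<subseteq> N}"
  have "carrier G \<in> ?A" using assms by (simp add: normal_invI subgroup_self)
  then have "subgroup (\<Inter> ?A) G" by (intro subgroups_Inter) (auto simp: normal_imp_subgroup)
  then show ?thesis unfolding normal_closure_def
  proof (rule normal_invI)
    fix x h assume "x \<in> carrier G" "h \<in> \<Inter> ?A"
    then show "x \<otimes> h \<otimes> inv x \<in> \<Inter> ?A" by (auto simp: normal_inv_iff)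
  qed
qed

end

text \<open>Translates to plain functions on \<open>nat\<close>, as in \<open>sym_group\<close>.
  Composition there runs the other way, so products are reversed.\<close>

definition relabel :: "('a \<Rightarrow> nat) \<Rightarrow> 'a set \<Rightarrow> 'a prm \<Rightarrow> nat \<Rightarrow> nat" where
  "relabel f A p j = (if j \<in> f ` A then f (app p (inv_into A f j)) else j)"

lemma relabel_f: "inj_on f A \<Longrightarrow> a \<in> A \<Longrightarrow> relabel f A p (f a) = f (app p a)"
  by (simp add: relabel_def)

lemma relabel_mult:
  assumes "inj_on f A" "p \<in> Sym A"
  shows "relabel f A (p * q) = relabel f A q \<circ> relabel f A p"
proof (rule ext)
  fix j
  show "relabel f A (p * q) j = (relabel f A q \<circ> relabel f A p) j"
  proof (cases "j \<in> f ` A")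
    case True
    then obtain a where a: "j = f a" "a \<in> A" by blast
    moreover have "app p a \<in> A" using Sym_app_mem[OF assms(2)] a by simp
    ultimately show ?thesis by (simp add: relabel_f[OF assms(1)])
  qed (simp add: relabel_def)
qed

lemma relabel_one: "inj_on f A \<Longrightarrow> relabel f A 1 = id"
  by (auto simp: relabel_def fun_eq_iff)

lemma relabel_permutes:
  assumes f: "inj_on f A" and p: "p \<in> Sym A"
  shows "relabel f A p permutes f ` A"
proof (rule bij_imp_permutes)
  have ip: "inverse p \<in> Sym A" using p by (rule Sym_inverse)
  have mem: "relabel f A q j \<in> f ` A" if "q \<in> Sym A" "j \<in> f ` A" for q j
    using that relabel_f[OF f] Sym_app_mem[OF that(1)] by auto
  show "bij_betw (relabel f A p) (f ` A) (f ` A)"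
  proof (rule bij_betw_byWitness[of _ "relabel f A (inverse p)"])
    have "relabel f A q (relabel f A p j) = j" if "p * q = 1" "p \<in> Sym A" for p q j
      using relabel_mult[OF f that(2), of q] that(1) relabel_one[OF f] by (metis comp_apply id_apply)
    then show "\<forall>j\<in>f ` A. relabel f A (inverse p) (relabel f A p j) = j"
      "\<forall>j\<in>f ` A. relabel f A p (relabel f A (inverse p) j) = j"
      using p ip by simp_all
  qed (use mem p ip in auto)
  show "relabel f A p j = j" if "j \<notin> f ` A" for j using that by (simp add: relabel_def)
qed

lemma relabel_surj:
  assumes f: "inj_on f A" and s: "s permutes f ` A"
  shows "\<exists>p\<in>Sym A. relabel f A p = s"
proof -
  let ?g = "\<lambda>a. inv_into A f (s (f a))"
  have fA: "bij_betw f A (f ` A)" using f by (rule inj_on_imp_bij_betw)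
  have "bij_betw ?g A A"
    using bij_betw_trans[OF bij_betw_trans[OF fA permutes_imp_bij[OF s]] bij_betw_inv_into[OF fA]]
    by (simp add: comp_def)
  then have p: "app (Prm (\<lambda>x. if x \<in> A then ?g x else x)) = (\<lambda>x. if x \<in> A then ?g x else x)"
    by (rule app_Prm_on)
  show ?thesis
  proof (rule bexI)
    show "relabel f A (Prm (\<lambda>x. if x \<in> A then ?g x else x)) = s"
    proof (rule ext)
      fix j
      show "relabel f A (Prm (\<lambda>x. if x \<in> A then ?g x else x)) j = s j"
      proof (cases "j \<in> f ` A")
        case True
        then obtain a where a: "j = f a" "a \<in> A" by blast
        have "s (f a) \<in> f ` A" using permutes_in_image[OF s] a by simp
        then show ?thesis using a by (simp add: relabel_f[OF f] p f_inv_into_f)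
      next
        case False
        then show ?thesis using permutes_not_in[OF s] by (simp add: relabel_def)
      qed
    qed
    show "Prm (\<lambda>x. if x \<in> A then ?g x else x) \<in> Sym A" by (simp add: Sym_def p)
  qed
qed

text \<open>The presented group and the symmetric group are quotients of one free group, so it
  suffices that the kernel of evaluation is the normal closure of the relators. It contains the
  relators; conversely, the universal property is tested on the regular representation of the
  presented group.\<close>

lemma presents_is_presentation:
  assumes pr: "presents TYPE(nat word set set prm) g rs A ev" and fin: "finite A"
  shows "is_presentation {..<g} rs (sym_group (card A))"
proof -
  let ?X = "{..<g}" and ?n = "card A"
  let ?F = "free_group ?X" and ?S = "sym_group ?n"
  let ?N = "normal_closure ?F (word_class ?X ` set rs)"
  let ?Q = "?F Mod ?N"
  have rw: "r \<in> words ?X" "wev ev r = 1" if "r \<in> set rs" for r using pr that by (auto simp: presents_def)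
  have evS: "ev i \<in> Sym A" if "i \<in> ?X" for i using pr that by (simp add: presents_def)
  have gen: "\<exists>v\<in>words ?X. wev ev v = p" if "p \<in> Sym A" for p using pr that by (auto simp: presents_def)
  have wS: "wev ev v \<in> Sym A" if "v \<in> words ?X" for v using wev_Sym[OF that evS] .
  interpret F: Group.group ?F by (rule group_free_group)
  have cls: "word_class ?X v \<in> carrier ?F" if "v \<in> words ?X" for v
    using that by (simp only: carrier_free_group imageI)
  have N: "?N \<lhd> ?F" using rw cls by (intro F.normal_normal_closure) auto
  then interpret N: normal ?N ?F .
  interpret Q: Group.group ?Q by (rule N.factorgroup_is_group)
  define \<pi> where "\<pi> v = ?N #>\<^bsub>?F\<^esub> word_class ?X v" for v
  have \<pi>c: "\<pi> v \<in> carrier ?Q" if "v \<in> words ?X" for v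
    unfolding \<pi>_def carrier_FactGroup using cls[OF that] by (rule imageI)
  have \<pi>m: "\<pi> (u @ v) = \<pi> u \<otimes>\<^bsub>?Q\<^esub> \<pi> v" if "u \<in> words ?X" "v \<in> words ?X" for u v
    using hom_mult[OF N.r_coset_hom_Mod cls[OF that(1)] cls[OF that(2)]] that
    by (simp add: \<pi>_def mult_free_group)
  have \<pi>1: "\<pi> [] = \<one>\<^bsub>?Q\<^esub>"
    unfolding \<pi>_def one_free_group[symmetric] one_FactGroup
    by (rule F.coset_mult_one[OF N.subset])
  define h where "h i = rmul ?Q (\<pi> [(i, True)])" for i
  have hw: "wev h v = rmul ?Q (\<pi> v)" if "v \<in> words ?X" for v
    using that
  proof (induction v)
    case Nil
    show ?case by (simp only: \<pi>1 Q.rmul_one wev_simps)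
  next
    case (Cons l v)
    obtain x b where l: "l = (x, b)" by (cases l)
    have x: "x < g" and v: "v \<in> words ?X" using Cons.prems l by auto
    have w1: "[(x, c)] \<in> words ?X" for c using x by simp
    have lt: "(if b then h x else inverse (h x)) = rmul ?Q (\<pi> [(x, b)])"
    proof (cases b)
      case False
      have "word_class ?X [(x, True), (x, False)] = word_class ?X []"
        using free_eq.cancel[of "[]" ?X "[]" x True] x word_class_eq_iff[of "[(x, True), (x, False)]" ?X "[]"] by simp
      then have "\<pi> [(x, True), (x, False)] = \<one>\<^bsub>?Q\<^esub>" using \<pi>1 by (simp add: \<pi>_def)
      then have "\<pi> [(x, True)] \<otimes>\<^bsub>?Q\<^esub> \<pi> [(x, False)] = \<one>\<^bsub>?Q\<^esub>"
        using \<pi>m[OF w1[of True] w1[of False]] by simp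
      then have "h x * rmul ?Q (\<pi> [(x, False)]) = 1"
        unfolding h_def using Q.rmul_mult[OF \<pi>c[OF w1[of True]] \<pi>c[OF w1[of False]]] Q.rmul_one by simp
      then show ?thesis using False inv_unique by simp
    qed (simp add: h_def)
    have "wev h (l # v) = rmul ?Q (\<pi> [(x, b)]) * rmul ?Q (\<pi> v)"
      using Cons.IH[OF v] lt by (simp add: l)
    also have "\<dots> = rmul ?Q (\<pi> ([(x, b)] @ v))"
      by (simp only: Q.rmul_mult[OF \<pi>c[OF w1] \<pi>c[OF v], symmetric] \<pi>m[OF w1 v])
    finally show ?case by (simp add: l)
  qed
  have S: "word_class ?X ` set rs \<subseteq> ?N" unfolding normal_closure_def by blast
  have "wev h r = 1" if "r \<in> set rs" for r
  proof -
    have "word_class ?X r \<in> ?N" using S that by blast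
    then have "\<pi> r = \<one>\<^bsub>?Q\<^esub>"
      unfolding \<pi>_def one_FactGroup by (rule F.coset_join2[OF cls[OF rw(1)[OF that]] N.subgroup_axioms])
    then show ?thesis using hw[OF rw(1)[OF that]] Q.rmul_one by simp
  qed
  then obtain \<psi> where \<psi>: "hom_on A \<psi>" "\<And>i. i < g \<Longrightarrow> \<psi> (ev i) = h i"
    using pr unfolding presents_def by blast
  \<comment> \<open>The letters of \<open>h\<close> act as their classes in the quotient, and
    \<open>h\<close> factors through \<open>\<psi>\<close>. So a word that evaluates to 1 acts
    trivially there, and a regular representation is faithful.\<close>
  have key: "word_class ?X v \<in> ?N" if v: "v \<in> words ?X" and 1: "wev ev v = 1" for v
  proof -
    have "wev h v = wev (\<lambda>i. \<psi> (ev i)) v" by (rule wev_cong[OF v]) (simp add: \<psi>)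
    also have "\<dots> = \<psi> (wev ev v)" by (rule wev_hom[OF v evS \<psi>(1)])
    finally have "rmul ?Q (\<pi> v) = 1" using hw[OF v] 1 hom_on_one[OF \<psi>(1)] by simp
    then have "\<pi> v = \<one>\<^bsub>?Q\<^esub>" by (rule Q.rmul_eq_1[OF \<pi>c[OF v]])
    then show ?thesis
      unfolding \<pi>_def one_FactGroup by (rule F.coset_join1[OF _ cls[OF v] N.subgroup_axioms])
  qed
  obtain f where "bij_betw f A {1..?n}"
    using finite_same_card_bij[OF fin, of "{1..?n}"] by auto
  then have f: "inj_on f A" and fA: "f ` A = {1..?n}" by (simp_all add: bij_betw_def)
  \<comment> \<open>Any representative of the class serves, as evaluation respects free
    cancellation. The inverse compensates for the reversal of products in
    \<open>relabel\<close>.\<close>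
  define H where "H W = relabel f A (inverse (wev ev (SOME v. v \<in> W)))" for W
  have Hc: "H (word_class ?X v) = relabel f A (inverse (wev ev v))" if v: "v \<in> words ?X" for v
  proof -
    have "v \<in> word_class ?X v" using free_eq.refl[OF v] by (simp add: word_class_def)
    then have "(SOME u. u \<in> word_class ?X v) \<in> word_class ?X v" by (rule someI)
    then have "(v, SOME u. u \<in> word_class ?X v) \<in> free_eq ?X" by (simp add: word_class_def)
    then show ?thesis unfolding H_def using wev_free_eq by metis
  qed
  have iS: "inverse (wev ev v) \<in> Sym A" if "v \<in> words ?X" for v using Sym_inverse[OF wS[OF that]] .
  have "H \<in> hom ?F ?S"
  proof (rule homI)
    fix W assume "W \<in> carrier ?F"
    then obtain v where v: "W = word_class ?X v" "v \<in> words ?X" unfolding carrier_free_group by blast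
    show "H W \<in> carrier ?S"
      unfolding v(1) Hc[OF v(2)] sym_group_carrier using relabel_permutes[OF f iS[OF v(2)]] by (simp only: fA)
    fix W' assume "W' \<in> carrier ?F"
    then obtain v' where v': "W' = word_class ?X v'" "v' \<in> words ?X" unfolding carrier_free_group by blast
    have vv: "v @ v' \<in> words ?X" using v(2) v'(2) by simp
    show "H (W \<otimes>\<^bsub>?F\<^esub> W') = H W \<otimes>\<^bsub>?S\<^esub> H W'"
      unfolding v(1) v'(1) mult_free_group[OF v(2) v'(2)] Hc[OF vv] Hc[OF v(2)] Hc[OF v'(2)] sym_group_mult
      using relabel_mult[OF f iS[OF v'(2)]] by simp
  qed
  then interpret H: group_hom ?F ?S H
    by (intro group_hom.intro group_hom_axioms.intro F.group_axioms sym_group_is_group)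
  have "H ` carrier ?F = carrier ?S"
  proof
    show "H ` carrier ?F \<subseteq> carrier ?S" using H.hom_closed by blast
    show "carrier ?S \<subseteq> H ` carrier ?F"
    proof
      fix s assume "s \<in> carrier ?S"
      then have "s permutes f ` A" by (simp only: sym_group_carrier fA)
      then obtain p where p: "p \<in> Sym A" "relabel f A p = s" using relabel_surj[OF f] by blast
      obtain v where v: "v \<in> words ?X" "wev ev v = inverse p" using gen[OF Sym_inverse[OF p(1)]] by blast
      have "s = H (word_class ?X v)" using Hc[OF v(1)] v(2) p(2) by simp
      then show "s \<in> H ` carrier ?F" using cls[OF v(1)] by (rule image_eqI)
    qed
  qed
  then have iso: "?F Mod (kernel ?F ?S H) \<cong> ?S" by (rule H.FactGroup_iso)
  have ker: "word_class ?X v \<in> kernel ?F ?S H \<longleftrightarrow> wev ev v = 1" if v: "v \<in> words ?X" for v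
  proof -
    have "relabel f A p = id \<longleftrightarrow> p = 1" if p: "p \<in> Sym A" for p
    proof
      assume r: "relabel f A p = id"
      have "app p a = a" for a
      proof (cases "a \<in> A")
        case True
        then have "f (app p a) = f a" using relabel_f[OF f True, of p] r by simp
        moreover have "app p a \<in> A" using Sym_app_mem[OF p] True by simp
        ultimately show ?thesis using f True by (auto dest: inj_onD)
      qed (use p in \<open>simp add: Sym_def\<close>)
      then show "p = 1" by (intro prm_eqI) simp
    qed (simp add: relabel_one[OF f])
    moreover have "inverse (wev ev v) = 1 \<longleftrightarrow> wev ev v = 1" using inv_eq_iff[of "wev ev v" 1] by simp
    ultimately show ?thesis
      using cls[OF v] iS[OF v] by (simp add: kernel_def Hc[OF v] sym_group_one)
  qed
  have "kernel ?F ?S H = ?N"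
  proof
    show "kernel ?F ?S H \<subseteq> ?N"
    proof
      fix W assume W: "W \<in> kernel ?F ?S H"
      then obtain v where "W = word_class ?X v" "v \<in> words ?X"
        unfolding kernel_def carrier_free_group by blast
      then show "W \<in> ?N" using W ker key by simp
    qed
    have "word_class ?X ` set rs \<subseteq> kernel ?F ?S H" using ker rw by blast
    then show "?N \<subseteq> kernel ?F ?S H" unfolding normal_closure_def using H.normal_kernel by blast
  qed
  then have "presented_group ?X rs \<cong> ?S" using iso by (simp add: presented_group_def)
  moreover have "set rs \<subseteq> words ?X" using rw by blast
  ultimately show ?thesis by (simp add: is_presentation_def)
qed

text \<open>A new letter with itself as relator leaves the group unchanged, and empty relators bring
  the number up to \<open>R\<close> at no cost in length.\<close>

lemma presents_pad:
  assumes pr: "presents TYPE('h::mgroup) g rs A ev" and g: "g \<le> G" "length rs + (G - g) \<le> R"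
  shows "\<exists>rs' ev'. presents TYPE('h) G rs' A ev' \<and> length rs' = R \<and>
    sum_list (map length rs') = sum_list (map length rs) + (G - g)"
proof -
  define ev' where "ev' i = (if i < g then ev i else 1)" for i
  define pad :: "nat word list" where "pad = map (\<lambda>i. [(i, True)]) [g..<G]"
  define rs' where "rs' = rs @ pad @ replicate (R - (length rs + (G - g))) []"
  have pr': "r \<in> set rs \<Longrightarrow> r \<in> words {..<g} \<and> wev ev r = 1" "i < g \<Longrightarrow> ev i \<in> Sym A"
    "p \<in> Sym A \<Longrightarrow> \<exists>v\<in>words {..<g}. wev ev v = p" for r i p
    using pr by (auto simp: presents_def)
  have univ: "\<exists>\<psi>. hom_on A \<psi> \<and> (\<forall>i<g. \<psi> (ev i) = h i)" if "\<forall>r\<in>set rs. wev h r = 1" for h :: "nat \<Rightarrow> 'h"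
    using pr that by (simp add: presents_def)
  have ev': "wev ev' v = wev ev v" if "v \<in> words {..<g}" for v
    by (rule wev_cong[OF that]) (simp add: ev'_def)
  have mono: "v \<in> words {..<g} \<Longrightarrow> v \<in> words {..<G}" for v
    using words_mono[of v "{..<g}" "{..<G}"] g by auto
  have pad: "r \<in> set pad \<longleftrightarrow> (\<exists>i. g \<le> i \<and> i < G \<and> r = [(i, True)])" for r by (auto simp: pad_def)
  have "presents TYPE('h) G rs' A ev'"
    unfolding presents_def
  proof (intro conjI ballI allI impI)
    show "r \<in> words {..<G}" "wev ev' r = 1" if "r \<in> set rs'" for r
      using that pr'(1)[of r] mono ev' pad[of r] unfolding rs'_def by (auto simp: ev'_def split: if_splits)
    show "ev' i \<in> Sym A" if "i < G" for i using pr'(2) by (simp add: ev'_def)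
    show "\<exists>v\<in>words {..<G}. wev ev' v = p" if p: "p \<in> Sym A" for p
      using pr'(3)[OF p] mono ev' by metis
    fix h :: "nat \<Rightarrow> 'h" assume h: "\<forall>r\<in>set rs'. wev h r = 1"
    then obtain \<psi> where \<psi>: "hom_on A \<psi>" "\<forall>i<g. \<psi> (ev i) = h i" using univ[of h] by (auto simp: rs'_def)
    have "h i = 1" if "g \<le> i" "i < G" for i
    proof -
      have "[(i, True)] \<in> set rs'" using pad that by (auto simp: rs'_def)
      then have "wev h [(i, True)] = 1" using h by blast
      then show ?thesis by simp
    qed
    then have "\<forall>i<G. \<psi> (ev' i) = h i" using \<psi> hom_on_one[OF \<psi>(1)] by (simp add: ev'_def)
    then show "\<exists>\<psi>. hom_on A \<psi> \<and> (\<forall>i<G. \<psi> (ev' i) = h i)" using \<psi>(1) by blast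
  qed
  moreover have "length rs' = R" using g by (simp add: rs'_def pad_def)
  moreover have "sum_list (map length pad) = G - g"
    using g by (simp add: pad_def comp_def sum_list_triv)
  then have "sum_list (map length rs') = sum_list (map length rs) + (G - g)"
    by (simp add: rs'_def)
  ultimately show ?thesis by blast
qed

section \<open>Star presentations for the finitely many small degrees\<close>

definition star_words :: "nat \<Rightarrow> nat word list" where
  "star_words N = [(0, True), (0, True)] #
    map (\<lambda>i. [(i, True), (i, True)]) [1..<Suc N] @
    map (\<lambda>i. [(0, True), (i, True), (0, True)] @ winv [(i, True), (0, True), (i, True)]) [1..<Suc N] @
    concat (map (\<lambda>i. map (\<lambda>j. comm_word [(i, True)] [(0, True), (j, True), (0, True)])
      (filter (\<lambda>j. j \<noteq> i) [1..<Suc N])) [1..<Suc N])"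

text \<open>The leaf 0 takes the role of \<open>x0\<close> in
  \<open>star_hom_commuting\<close>.\<close>

lemma presents_star:
  "presents TYPE('h::mgroup) (Suc N) (star_words N) (insert None (Some ` {..<Suc N})) (\<lambda>i. tr None (Some i))"
proof -
  let ?ev = "\<lambda>i::nat. tr None (Some i)"
  let ?J = "{1..<Suc N}"
  have J: "insert 0 ?J = {..<Suc N}" by auto
  have rel: "(\<forall>r\<in>set (star_words N). wev h r = 1) \<longleftrightarrow>
      h 0 * h 0 = 1 \<and> (\<forall>i\<in>?J. h i * h i = 1) \<and> (\<forall>i\<in>?J. h 0 * h i * h 0 = h i * h 0 * h i) \<and>
      (\<forall>i\<in>?J. \<forall>j\<in>?J. i \<noteq> j \<longrightarrow> cm (h i) (h 0 * h j * h 0))" for h :: "nat \<Rightarrow> 'g::mgroup"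
  proof -
    have 1: "wev h ([(0, True), (i, True), (0, True)] @ winv [(i, True), (0, True), (i, True)]) = 1 \<longleftrightarrow>
        h 0 * h i * h 0 = h i * h 0 * h i" for i
      using mult_inverse_eq_1_iff[of "h 0 * h i * h 0" "h i * h 0 * h i"] by (simp add: mult.assoc winv_Cons winv_def[of "[]"])
    have 2: "wev h (comm_word [(i, True)] [(0, True), (j, True), (0, True)]) = 1 \<longleftrightarrow> cm (h i) (h 0 * h j * h 0)" for i j
      by (simp add: mult.assoc)
    have 3: "wev h [(i, True), (i, True)] = 1 \<longleftrightarrow> h i * h i = 1" for i by simp
    have S: "set (star_words N) = insert [(0, True), (0, True)] ((\<lambda>i. [(i, True), (i, True)]) ` ?J \<union>
        (\<lambda>i. [(0, True), (i, True), (0, True)] @ winv [(i, True), (0, True), (i, True)]) ` ?J \<union>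
        (\<Union>i\<in>?J. (\<lambda>j. comm_word [(i, True)] [(0, True), (j, True), (0, True)]) ` {j \<in> ?J. j \<noteq> i}))"
      unfolding star_words_def by (auto simp del: upt_Suc append.simps)
    have 4: "(\<forall>i\<in>A. \<forall>j. j \<in> A \<and> j \<noteq> i \<longrightarrow> P i j) \<longleftrightarrow> (\<forall>i\<in>A. \<forall>j\<in>A. i \<noteq> j \<longrightarrow> P i j)"
      for A :: "nat set" and P by (rule ball_cong[OF HOL.refl]) metis
    show ?thesis unfolding S ball_Un ball_simps ball_UN 1 2 3 mem_Collect_eq 4 conj_assoc ..
  qed
  show ?thesis unfolding presents_def
  proof (intro conjI ballI allI impI)
    show "r \<in> words {..<Suc N}" if "r \<in> set (star_words N)" for r
      using that by (auto simp: star_words_def comm_word_def winv_Cons winv_def[of "[]"] simp del: upt_Suc)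
    have "tr None (Some 0) * tr None (Some i) * tr None (Some 0) = tr (Some 0) (Some i)"
      "tr None (Some i) * tr None (Some 0) * tr None (Some i) = tr (Some 0) (Some i)" if "i \<noteq> 0" for i :: nat
      using tr_conj3[of None "Some 0" "Some i"] tr_conj3[of None "Some i" "Some 0"] tr_sym[of "Some i" "Some 0"] that
      by simp_all
    moreover have "cm (tr None (Some i)) (tr (Some 0) (Some j))" if "i \<noteq> 0" "j \<noteq> 0" "i \<noteq> j" for i j :: nat
      using that by (simp add: cm_iff_cj cj_tr app_tr)
    ultimately have "\<forall>r\<in>set (star_words N). wev ?ev r = 1" unfolding rel by simp
    then show "wev ?ev r = 1" if "r \<in> set (star_words N)" for r using that by blast
    show "?ev i \<in> Sym (insert None (Some ` {..<Suc N}))" if "i < Suc N" for i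
      using that by (intro Sym_tr) auto
    show "\<exists>v\<in>words {..<Suc N}. wev ?ev v = p" if p: "p \<in> Sym (insert None (Some ` {..<Suc N}))" for p
    proof (rule generated_star[OF _ p])
      fix j assume "j \<in> Some ` {..<Suc N}"
      then obtain i where "j = Some i" "i < Suc N" by blast
      then show "\<exists>v\<in>words {..<Suc N}. wev ?ev v = tr None j"
        by (intro bexI[of _ "[(i, True)]"]) simp_all
    qed simp
    fix h :: "nat \<Rightarrow> 'h" assume "\<forall>r\<in>set (star_words N). wev h r = 1"
    then have h: "h 0 * h 0 = 1" "\<And>i. i \<in> ?J \<Longrightarrow> h i * h i = 1"
      "\<And>i. i \<in> ?J \<Longrightarrow> h 0 * h i * h 0 = h i * h 0 * h i"
      "\<And>i j. i \<in> ?J \<Longrightarrow> j \<in> ?J \<Longrightarrow> i \<noteq> j \<Longrightarrow> cm (h i) (h 0 * h j * h 0)"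
      unfolding rel by blast+
    have "\<exists>f. hom_on (insert None (Some ` insert 0 ?J)) f \<and> f (tr None (Some 0)) = h 0 \<and>
      (\<forall>i\<in>?J. f (tr None (Some i)) = h i)"
      by (rule star_hom_commuting[OF _ _ h]) simp_all
    then obtain f where f: "hom_on (insert None (Some ` {..<Suc N})) f" "f (tr None (Some 0)) = h 0"
      "\<And>i. i \<in> ?J \<Longrightarrow> f (tr None (Some i)) = h i"
      unfolding J by blast
    have "f (tr None (Some i)) = h i" if "i < Suc N" for i
      using f(2) f(3)[of i] that by (cases i) simp_all
    then show "\<exists>\<psi>. hom_on (insert None (Some ` {..<Suc N})) \<psi> \<and> (\<forall>i<Suc N. \<psi> (?ev i) = h i)"
      using f(1) by blast
  qed
qed

lemma length_star_words: "length (star_words N) \<le> (N + 1) * (N + 1)"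
proof -
  have "(\<Sum>i\<leftarrow>[1..<Suc N]. length (filter (\<lambda>j. j \<noteq> i) [1..<Suc N])) \<le> (\<Sum>i\<leftarrow>[1..<Suc N]. N)"
    by (intro sum_list_mono order_trans[OF length_filter_le]) (simp del: upt_Suc)
  then show ?thesis by (simp add: star_words_def length_concat comp_def sum_list_triv del: upt_Suc)
qed

lemma sum_length_star_words: "sum_list (map length (star_words N)) \<le> length (star_words N) * 8"
proof -
  have "length r \<le> 8" if "r \<in> set (star_words N)" for r
    using that by (auto simp: star_words_def comm_word_def simp del: upt_Suc)
  then show ?thesis using sum_list_mono[of "star_words N" length "\<lambda>_. 8"] by (simp add: sum_list_triv)
qed

text \<open>For \<open>q = 4, 8, 16, ...\<close> the intervals from \<open>q + 3\<close> to
  \<open>2 q + 2\<close> tile the integers from 7 on; the least \<open>k\<close> with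
  \<open>n\<close> below the upper end selects the right one.\<close>

lemma exists_dyadic_range:
  assumes "7 \<le> n"
  shows "\<exists>k d. 2 \<le> k \<and> 1 \<le> d \<and> d \<le> 2 ^ k \<and> n = 2 ^ k + 2 + (d::nat)"
proof -
  define k where "k = (LEAST k. n \<le> 2 ^ Suc k + 2)"
  have "n \<le> 2 ^ Suc n + 2" using less_exp[of "Suc n"] by simp
  then have le: "n \<le> 2 ^ Suc k + 2" unfolding k_def by (rule LeastI)
  have k2: "2 \<le> k"
  proof (rule ccontr)
    assume "\<not> 2 \<le> k"
    then have "k = 0 \<or> k = 1" by auto
    then show False using le assms by auto
  qed
  have "\<not> n \<le> 2 ^ Suc (k - 1) + 2" unfolding k_def by (rule not_less_Least) (use k2 in \<open>simp add: k_def\<close>)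
  then have "2 ^ k + 2 < n" using k2 by simp
  then have "1 \<le> n - (2 ^ k + 2)" "n - (2 ^ k + 2) \<le> 2 ^ k" "n = 2 ^ k + 2 + (n - (2 ^ k + 2))"
    using le by simp_all
  then show ?thesis using k2 by blast
qed

lemma bit_alg_closure_char2: "x + x = (0 :: bit alg_closure)"
proof -
  have "(1::bit alg_closure) + 1 = to_ac (1 + 1)" by (simp only: to_ac_add to_ac_1)
  also have "(1::bit) + 1 = 0" by simp
  finally have "(1::bit alg_closure) + 1 = 0" by (simp only: to_ac_0)
  then show ?thesis by (metis distrib_left mult_1_right mult_zero_right)
qed

theorem theorem3p17:
  "\<exists>C::real. \<forall>n::nat. n \<ge> 2 \<longrightarrow>
     (\<exists>(X :: nat set) (rs :: nat word list).
        is_presentation X rs (sym_group n) \<and>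
        card X = 18 \<and> length rs = 58 \<and>
        real (presentation_length X rs) \<le> C * ln (real n))"
proof (intro exI[of _ "8000 / ln 2"] allI impI)
  fix n :: nat assume n: "2 \<le> n"
  have finish: "\<exists>(X :: nat set) rs. is_presentation X rs (sym_group n) \<and> card X = 18 \<and> length rs = 58 \<and>
      real (presentation_length X rs) \<le> 8000 / ln 2 * ln (real n)"
    if pr: "presents TYPE(nat word set set prm) g rs A ev" and A: "finite A" "card A = n"
      and g: "g \<le> 18" "length rs + (18 - g) \<le> 58" and len: "sum_list (map length rs) \<le> 7000 * k"
      and k: "1 \<le> k" "2 ^ k \<le> n"
    for g k rs and A :: "'p set" and ev
  proof -
    obtain rs' ev' where pr': "presents TYPE(nat word set set prm) 18 rs' A ev'" and l: "length rs' = 58"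
      and s: "sum_list (map length rs') = sum_list (map length rs) + (18 - g)"
      using presents_pad[OF pr g] by blast
    have "is_presentation {..<18} rs' (sym_group n)" using presents_is_presentation[OF pr' A(1)] A(2) by simp
    \<comment> \<open>The 18 generators and at most 18 padding relators of length 1 add no more than
      36 to \<open>7000 * k\<close>.\<close>
    moreover have "presentation_length {..<18} rs' \<le> 8000 * k"
      unfolding presentation_length_def using s len k by simp
    moreover have "real k * ln 2 \<le> ln (real n)"
    proof -
      have "real k * ln 2 = ln (2 ^ k)" by (simp add: ln_realpow)
      also have "\<dots> \<le> ln (real n)" using k(2) by (subst ln_le_cancel_iff) (use n in \<open>auto simp flip: of_nat_le_iff\<close>)
      finally show ?thesis .
    qed
    then have "8000 * real k \<le> 8000 / ln 2 * ln (real n)" by (simp add: field_simps)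
    ultimately show ?thesis using l by (intro exI[of _ "{..<18}"] exI[of _ rs']) auto
  qed
  show "\<exists>(X :: nat set) rs. is_presentation X rs (sym_group n) \<and> card X = 18 \<and> length rs = 58 \<and>
      real (presentation_length X rs) \<le> 8000 / ln 2 * ln (real n)"
  proof (cases "7 \<le> n")
    case True
    then obtain k d where kd: "2 \<le> k" "1 \<le> d" "d \<le> 2 ^ k" "n = 2 ^ k + 2 + d"
      using exists_dyadic_range by blast
    obtain F :: "bit alg_closure set" and z y where "gf F z y k"
      using gf_exists[OF bit_alg_closure_char2 kd(1)] by blast
    then interpret gf F z y k .
    obtain rs ev and A :: "(bit alg_closure option \<times> bool) option set"
      where "presents TYPE(nat word set set prm) 14 rs A ev" "finite A" "card A = n" "length rs = 54"
        "sum_list (map length rs) \<le> 7000 * k"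
      using glue[OF kd(2,3)] kd(4) by metis
    then show ?thesis using finish[of 14 rs A ev k] kd by simp
  next
    case False
    define N where "N = n - 2"
    have N: "N \<le> 4" "n = N + 2" using False n by (simp_all add: N_def)
    let ?A = "insert None (Some ` {..<Suc N})"
    have "card (Some ` {..<Suc N}) = Suc N" by (simp add: card_image)
    then have "card ?A = n" using N(2) by (subst card_insert_disjoint) auto
    \<comment> \<open>At most 25 relators of length at most 8 and at most 17 padding letters fit the
      bounds of \<open>finish\<close> with \<open>k = 1\<close>.\<close>
    moreover have "length (star_words N) \<le> 25"
      using mult_le_mono[of "N + 1" 5 "N + 1" 5] length_star_words[of N] N(1) by simp
    ultimately show ?thesis
      using finish[OF presents_star[of N], of 1] sum_length_star_words[of N] N by simp
  qed
qed

end
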